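(* Let $T$ be the cubic Arnoux-Yoccoz interval exchange map, with its coding by nine intervals and associated matrix $M$ (the transpose of its renormalization matrix). Let $\beta$ be a non-real eigenvalue of $M$ satisfying $|\beta|>1$ and such that $\beta/|\beta|$ is not a root of unity. Then, for almost every eigenvector $\gamma\in\mathbb C^9$ of $M$ for $\beta$ (with respect to Lebesgue measure on the eigenspace), there exists an affine interval exchange map, semi-conjugate with $T$, with slope vector $\exp(-\operatorname{Re}(\gamma))=(\exp(-\operatorname{Re}(\gamma_a)))_{a=1,\dots,9}$ and exhibiting wandering intervals.
   Context: The map. Let $\alpha$ be the unique real number with $\alpha+\alpha^2+\alpha^3=1$. For $t_0<t_1$ let $G_{t_0,t_1}:[0,1)\to[0,1)$ exchange the two halves of $[t_0,t_1)$ preserving orientation: $G_{t_0,t_1}(t)=t+\frac{t_1-t_0}{2}$ on $[t_0,\frac{t_0+t_1}2)$, $G_{t_0,t_1}(t)=t-\frac{t_1-t_0}{2}$ on $[\frac{t_0+t_1}2,t_1)$, and $G_{t_0,t_1}(t)=t$ elsewhere. The cubic Arnoux-Yoccoz i.e.m. is $T=G_{0,1}\circ G_{0,\alpha}\circ G_{\alpha,\alpha+\alpha^2}\circ G_{\alpha+\alpha^2,1}$. The coding. $T$, regarded on the circle $[0,1)\cong\mathbb R/\mathbb Z$, is a translation (mod 1) on each of the nine consecutive intervals $I_1,\dots,I_9$ with successive endpoints $$0,\ \alpha+\tfrac{\alpha^2}{2}-\tfrac12,\ \tfrac{\alpha}{2},\ \tfrac12-\tfrac{\alpha^3}{2},\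 \alpha,\ \alpha+\tfrac{\alpha^2}{2},\ \tfrac{\alpha}{2}+\tfrac12,\ \alpha+\alpha^2,\ \alpha+\alpha^2+\tfrac{\alpha^3}{2},\ 1 .$$ The first return map of $T$ to $[0,\alpha)$ is, up to rescaling and rotation, equal to $T$, and the induced coding is given by the primitive substitution on $\mathcal A=\{1,\dots,9\}$: $\sigma(1)=35$, $\sigma(2)=45$, $\sigma(3)=46$, $\sigma(4)=17$, $\sigma(5)=18$, $\sigma(6)=19$, $\sigma(7)=29$, $\sigma(8)=2$, $\sigma(9)=3$. $M$ is the $9\times 9$ matrix with $M_{a,b}$ the number of occurrences of $b$ in $\sigma(a)$. Affine i.e.m. An affine i.e.m. is a bijective piecewise affine map $f:[0,1)\to[0,1)$ with positive slopes. It has slope vector $(\ell_a)_{a\in\mathcal A}$ if $[0,1)$ is partitioned into intervals $(J_a)_{a\in\mathcal A}$ such that $f$ has slope $\ell_a$ on $J_a$ (continuity on the $J_a$ being understood on the circle $\mathbb R/\mathbb Z$). $f$ is semi-conjugate with $T$ if there is a continuous, surjective, nondecreasing $h:[0,1)\to[0,1)$ with $h\circ f=T\circ h$. A wandering interval of $f$ is a nondegenerate interval $J$ whose iterates $f^n(J)$, $n\in\mathbb Z$, are pairwise disjoint. *)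

theory Defs
  imports "HOL-Analysis.Analysis"
begin

section \<open>The cubic Arnoux-Yoccoz interval exchange map\<close>

definition ay_alpha :: real where
  "ay_alpha = (THE x. x + x ^ 2 + x ^ 3 = 1)"

definition swap_halves :: "real \<Rightarrow> real \<Rightarrow> real \<Rightarrow> real" where
  "swap_halves t0 t1 t =
     (if t0 \<le> t \<and> t < (t0 + t1) / 2 then t + (t1 - t0) / 2
      else if (t0 + t1) / 2 \<le> t \<and> t < t1 then t - (t1 - t0) / 2
      else t)"

definition arnoux_yoccoz :: "real \<Rightarrow> real" where
  "arnoux_yoccoz =
     swap_halves 0 1
     \<circ> swap_halves 0 ay_alpha
     \<circ> swap_halves ay_alpha (ay_alpha + ay_alpha ^ 2)
     \<circ> swap_halves (ay_alpha + ay_alpha ^ 2) 1"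


section \<open>The substitution and its matrix\<close>

text \<open>
  A nine-element index type. The numeral type \<open>9\<close> is avoided because its element
  written \<open>9\<close> is \<open>0\<close>, which would come first in its order.
\<close>

datatype letter = L1 | L2 | L3 | L4 | L5 | L6 | L7 | L8 | L9

lemma UNIV_letter: "UNIV = {L1, L2, L3, L4, L5, L6, L7, L8, L9}"
  using letter.exhaust by blast

instance letter :: finite
  by standard (simp add: UNIV_letter)

primrec letter_number :: "letter \<Rightarrow> nat" where
  "letter_number L1 = 1"
| "letter_number L2 = 2"
| "letter_number L3 = 3"
| "letter_number L4 = 4"
| "letter_number L5 = 5"
| "letter_number L6 = 6"
| "letter_number L7 = 7"
| "letter_number L8 = 8"
| "letter_number L9 = 9"

primrec ay_subst :: "letter \<Rightarrow> letter list" where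
  "ay_subst L1 = [L3, L5]"
| "ay_subst L2 = [L4, L5]"
| "ay_subst L3 = [L4, L6]"
| "ay_subst L4 = [L1, L7]"
| "ay_subst L5 = [L1, L8]"
| "ay_subst L6 = [L1, L9]"
| "ay_subst L7 = [L2, L9]"
| "ay_subst L8 = [L2]"
| "ay_subst L9 = [L3]"

definition ay_matrix :: "complex ^ letter ^ letter" where
  "ay_matrix = (\<chi> a b. of_nat (count_list (ay_subst a) b))"

definition eigenvector :: "complex ^ 'n ^ 'n \<Rightarrow> complex \<Rightarrow> complex ^ 'n \<Rightarrow> bool" where
  "eigenvector A \<mu> v \<longleftrightarrow> v \<noteq> 0 \<and> A *v v = \<mu> *s v"

definition eigenvalue :: "complex ^ 'n ^ 'n \<Rightarrow> complex \<Rightarrow> bool" where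
  "eigenvalue A \<mu> \<longleftrightarrow> (\<exists>v. eigenvector A \<mu> v)"

definition eigenspace :: "complex ^ 'n ^ 'n \<Rightarrow> complex \<Rightarrow> (complex ^ 'n) set" where
  "eigenspace A \<mu> = {v. A *v v = \<mu> *s v}"


section \<open>Lebesgue measure on a linear subspace\<close>

text \<open>
  For a real-linear subspace \<open>E\<close>, this is \<^const>\<open>lborel\<close> transported along the coordinates
  of an orthonormal basis of \<open>E\<close>, just as \<^const>\<open>lborel\<close> itself is built from
  \<^const>\<open>Basis\<close>; it does not depend on the basis chosen. A complex subspace is regarded
  as a real one of twice the dimension.
\<close>

definition subspace_lborel :: "'v::euclidean_space set \<Rightarrow> 'v measure" where
  "subspace_lborel E =
     (let B = (SOME B. B \<subseteq> E \<and> pairwise orthogonal B \<and> (\<forall>b\<in>B. norm b = 1) \<and> span B = E)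
      in distr (\<Pi>\<^sub>M b\<in>B. (lborel :: real measure)) (restrict_space borel E)
           (\<lambda>x. \<Sum>b\<in>B. x b *\<^sub>R b))"


section \<open>Affine interval exchange maps\<close>

text \<open>
  Maps of \<open>[0,1)\<close> are functions \<^typ>\<open>real \<Rightarrow> real\<close> of which only the restriction to
  \<^term>\<open>{0..<1::real}\<close> matters.
\<close>

definition affine_iem :: "(real \<Rightarrow> real) \<Rightarrow> bool" where
  "affine_iem f \<longleftrightarrow>
     bij_betw f {0..<1} {0..<1} \<and>
     (\<exists>(n::nat) p. p 0 = 0 \<and> p n = 1 \<and> (\<forall>i<n. p i < p (Suc i)) \<and>
        (\<forall>i<n. \<exists>s>0. \<exists>c. \<forall>x\<in>{p i..<p (Suc i)}. f x = s * x + c))"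

text \<open>
  The intervals \<open>J\<^sub>a = [p (a - 1), p a)\<close>, for \<open>a = 1, \<dots>, 9\<close>, follow one another from left to
  right. Since \<open>f\<close> is required to be continuous on \<open>J\<^sub>a\<close> only as a map into the circle, it is
  affine there modulo 1, whence \<^const>\<open>frac\<close>.
\<close>

definition has_slope_vector :: "(real \<Rightarrow> real) \<Rightarrow> real ^ letter \<Rightarrow> bool" where
  "has_slope_vector f l \<longleftrightarrow>
     (\<exists>p. p 0 = 0 \<and> p 9 = 1 \<and> (\<forall>i<9. p i < p (Suc i)) \<and>
        (\<forall>a. \<exists>c. \<forall>x\<in>{p (letter_number a - 1)..<p (letter_number a)}.
           f x = frac (l $ a * x + c)))"

definition semiconjugate :: "(real \<Rightarrow> real) \<Rightarrow> (real \<Rightarrow> real) \<Rightarrow> bool" where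
  "semiconjugate f g \<longleftrightarrow>
     (\<exists>h. continuous_on {0..<1} h \<and> h ` {0..<1} = {0..<1} \<and> mono_on {0..<1} h \<and>
        (\<forall>x\<in>{0..<1}. h (f x) = g (h x)))"

definition int_iterate :: "(real \<Rightarrow> real) \<Rightarrow> int \<Rightarrow> real \<Rightarrow> real" where
  "int_iterate f n =
     (if 0 \<le> n then f ^^ nat n else inv_into {0..<1} f ^^ nat (- n))"

definition wandering_interval :: "(real \<Rightarrow> real) \<Rightarrow> real set \<Rightarrow> bool" where
  "wandering_interval f J \<longleftrightarrow>
     J \<subseteq> {0..<1} \<and> is_interval J \<and> (\<exists>x\<in>J. \<exists>y\<in>J. x < y) \<and>
     disjoint_family (\<lambda>n. int_iterate f n ` J)"

end

theory Submission
  imports Defs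
begin

text \<open>
  The map \<open>renorm\<close> conjugates \<open>T\<close> to its first return to \<open>[0, \<alpha>)\<close>, so the Birkhoff sums \<open>S x n\<close> of the
  eigenvector, normalized to have entries in \<open>\<int>[\<beta>]\<close>, are multiplied by \<open>\<beta>\<close> under renormalization.
  Replacing \<open>\<beta>\<close> by its conjugate \<open>\<alpha>\<close> turns them into the coboundary of a bounded function \<open>theta\<close> that is
  injective on each of three pieces. Hence \<open>n \<mapsto> S x n\<close> takes every value at most three times, and
  only polynomially many of its values lie in a disc.

  For every direction \<open>z \<noteq> 0\<close> a limit of lowest points on longer and longer orbit segments yields
  a point \<open>x0\<close> with \<open>Re (z * S x0 n) \<ge> 0\<close> for all \<open>n \<in> \<int>\<close>; the limit could be lost only in a left germ
  at a discontinuity, but these germs are periodic under renormalization and rotate by \<open>\<beta>\<^sup>3\<close>, which is not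
  real. For almost every \<open>z\<close>, a point of the orbit at distance about \<open>\<bar>\<beta>\<bar>\<^sup>k\<close> from the lowest one
  is eventually higher by at least \<open>\<bar>\<beta>\<bar>\<^sup>k\<^sup>/\<^sup>2\<close>: up to translation finitely many pairs of level-\<open>k\<close> blocks matter,
  and for each pair the exceptional directions have small measure because the lowest point depends
  monotonically on the direction, so Borel-Cantelli applies. Therefore \<open>exp (- Re (z * S x0 n))\<close> is
  summable over \<open>\<int>\<close>, and inserting intervals of these lengths along the orbit of \<open>x0\<close>, as in Denjoy's
  construction, produces the affine map.
\<close>

text \<open>The non-real eigenvalue \<open>\<beta>\<close> outside the unit disc turns out to be a
  root of x^3 + x^2 + x - 1, whose real root is \<open>\<alpha>\<close>. An integer vector is
  determined by its values at \<open>\<beta>\<close>, a complex number, and at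
  \<open>\<alpha>\<close>, a real one. Along an orbit the second value stays bounded, so counting
  the values of the first in a disc is counting lattice points. The main obstacle is that
  nonnegative heights on the extremal orbit do not give summability: distant points could be almost
  as low as the lowest one. Such near ties have to be excluded for almost every direction z before
  the extremal point is known, since that point depends on z. This is why the gap condition speaks
  of pairs of blocks at a bounded relative offset and not of an orbit. A height of order norm S ^
  (1/2) is then more than enough, because the exponential beats every power. The hypothesis on roots
  of unity enters through \<open>Im (\<beta>^3) \<noteq> 0\<close>: following the left germs at
  right ends of intervals back through renormalization leads into cycles of length 3.\<close>

abbreviation "\<alpha> \<equiv> ay_alpha"

section \<open>The constant \<open>\<alpha>\<close> and the explicit form of T\<close>

lemma ay_alpha_ex1: "\<exists>!x::real. x + x ^ 2 + x ^ 3 = 1"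
proof (rule ex_ex1I)
  have "\<exists>x\<ge>0. x \<le> 1 \<and> x + x ^ 2 + x ^ 3 = (1::real)"
    by (rule IVT) (auto intro!: continuous_intros)
  then show "\<exists>x::real. x + x ^ 2 + x ^ 3 = 1" by blast
next
  fix x y :: real
  assume "x + x ^ 2 + x ^ 3 = 1" "y + y ^ 2 + y ^ 3 = 1"
  then have "(x - y) * (1 + (x + y) + (x^2 + x * y + y^2)) = 0"
    by (simp add: algebra_simps power2_eq_square power3_eq_cube)
  \<comment> \<open>A sum of squares shows that the quadratic cofactor of x - y is positive.\<close>
  moreover have "4 * (1 + (x + y) + (x^2 + x * y + y^2)) = (x + y + 2)^2 + 2 * x^2 + 2 * y^2 + (x + y)^2"
    by (simp add: algebra_simps power2_eq_square)
  moreover have "(x + y + 2)^2 + 2 * x^2 + 2 * y^2 + (x + y)^2 > 0"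
  proof (cases "x = 0 \<and> y = 0")
    case False
    then have "0 < 2 * x^2 + 2 * y^2"
      by (auto intro: add_pos_nonneg add_nonneg_pos)
    then show ?thesis using zero_le_power2[of "x + y + 2"] zero_le_power2[of "x + y"] by linarith
  qed simp
  ultimately show "x = y" by auto
qed

lemma ay_alpha_cubic: "\<alpha> + \<alpha> ^ 2 + \<alpha> ^ 3 = 1"
  unfolding ay_alpha_def using theI'[OF ay_alpha_ex1] .

lemma ay_alpha_cube: "\<alpha> ^ 3 = 1 - \<alpha> - \<alpha> ^ 2"
  using ay_alpha_cubic by simp

text \<open>Linear arithmetic treats \<open>\<alpha>\<close> and \<open>\<alpha>^2\<close> as
  unrelated atoms; separate enclosures for both are sharp enough to decide every comparison of
  interval end points below.\<close>

lemma ay_alpha_bounds: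
  "0.5436 < \<alpha>" "\<alpha> < 0.5437" "0.2955 < \<alpha>^2" "\<alpha>^2 < 0.2957"
proof -
  have mono: "x + x ^ 2 + x ^ 3 \<le> y + y ^ 2 + y ^ 3" if "0 \<le> x" "x \<le> y" for x y :: real
    using that power_mono[of x y 2] power_mono[of x y 3] by linarith
  have pos: "0 < \<alpha>"
  proof (rule ccontr)
    assume "\<not> 0 < \<alpha>"
    moreover have "0 \<le> (\<alpha> + 1 / 2)^2 + 3 / 4" by simp
    then have "0 \<le> 1 + \<alpha> + \<alpha>^2" by (simp add: power2_eq_square algebra_simps)
    ultimately have "\<alpha> * (1 + \<alpha> + \<alpha>^2) \<le> 0"
      by (simp add: mult_nonpos_nonneg)
    then show False
      using ay_alpha_cubic by (simp add: algebra_simps power2_eq_square power3_eq_cube)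
  qed
  show 1: "0.5436 < \<alpha>"
  proof (rule ccontr)
    assume "\<not> ?thesis"
    then have "\<alpha> + \<alpha> ^ 2 + \<alpha> ^ 3 \<le> 0.5436 + 0.5436 ^ 2 + 0.5436 ^ 3"
      using mono[of \<alpha> "0.5436"] pos by simp
    then show False unfolding ay_alpha_cubic by (simp add: power2_eq_square power3_eq_cube)
  qed
  show 2: "\<alpha> < 0.5437"
  proof (rule ccontr)
    assume "\<not> ?thesis"
    then have "\<alpha> + \<alpha> ^ 2 + \<alpha> ^ 3 \<ge> 0.5437 + 0.5437 ^ 2 + 0.5437 ^ 3"
      using mono[of "0.5437" \<alpha>] by simp
    then show False unfolding ay_alpha_cubic by (simp add: power2_eq_square power3_eq_cube)
  qed
  show "0.2955 < \<alpha>^2" using power_strict_mono[OF 1, of 2] by (simp add: power2_eq_square)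
  show "\<alpha>^2 < 0.2957" using power_strict_mono[OF 2, of 2] pos by (simp add: power2_eq_square)
qed

lemma ay_alpha_pos: "0 < \<alpha>" and ay_alpha_less_1: "\<alpha> < 1"
  using ay_alpha_bounds by simp_all

lemma ay_alpha_mult: "\<alpha> * \<alpha> = \<alpha>^2" "\<alpha> * \<alpha>^2 = 1 - \<alpha> - \<alpha>^2" "\<alpha>^2 * \<alpha> = 1 - \<alpha> - \<alpha>^2"
  using ay_alpha_cube by (simp_all add: power2_eq_square power3_eq_cube)

text \<open>The cubic equation has been used to eliminate \<open>\<alpha>^3\<close> from the end
  points; for instance 1/2 - \<alpha>^3/2 appears as (\<alpha> + \<alpha>^2)/2.\<close>

primrec letter_lo :: "letter \<Rightarrow> real" where
  "letter_lo L1 = 0"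
| "letter_lo L2 = \<alpha> + \<alpha>^2 / 2 - 1 / 2"
| "letter_lo L3 = \<alpha> / 2"
| "letter_lo L4 = (\<alpha> + \<alpha>^2) / 2"
| "letter_lo L5 = \<alpha>"
| "letter_lo L6 = \<alpha> + \<alpha>^2 / 2"
| "letter_lo L7 = \<alpha> / 2 + 1 / 2"
| "letter_lo L8 = \<alpha> + \<alpha>^2"
| "letter_lo L9 = (1 + \<alpha> + \<alpha>^2) / 2"

primrec letter_hi :: "letter \<Rightarrow> real" where
  "letter_hi L1 = \<alpha> + \<alpha>^2 / 2 - 1 / 2"
| "letter_hi L2 = \<alpha> / 2"
| "letter_hi L3 = (\<alpha> + \<alpha>^2) / 2"
| "letter_hi L4 = \<alpha>"
| "letter_hi L5 = \<alpha> + \<alpha>^2 / 2"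
| "letter_hi L6 = \<alpha> / 2 + 1 / 2"
| "letter_hi L7 = \<alpha> + \<alpha>^2"
| "letter_hi L8 = (1 + \<alpha> + \<alpha>^2) / 2"
| "letter_hi L9 = 1"

definition letter_of :: "real \<Rightarrow> letter" where
  "letter_of x =
     (if x < letter_hi L1 then L1 else if x < letter_hi L2 then L2 else if x < letter_hi L3 then L3
      else if x < letter_hi L4 then L4 else if x < letter_hi L5 then L5 else if x < letter_hi L6 then L6
      else if x < letter_hi L7 then L7 else if x < letter_hi L8 then L8 else L9)"

lemma letter_lo_nonneg: "0 \<le> letter_lo a"
  using ay_alpha_bounds by (cases a) auto

lemma letter_hi_le_1: "letter_hi a \<le> 1"
  using ay_alpha_bounds by (cases a) auto

lemma letter_lo_less_hi: "letter_lo a < letter_hi a"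
  using ay_alpha_bounds by (cases a) auto

lemma letter_of_eq:
  assumes "letter_lo a \<le> x" "x < letter_hi a"
  shows "letter_of x = a"
  using assms ay_alpha_bounds by (cases a) (auto simp: letter_of_def)

lemma letter_of_bounds:
  assumes "x \<in> {0..<1}"
  shows "letter_lo (letter_of x) \<le> x" "x < letter_hi (letter_of x)"
  using assms by (auto simp: letter_of_def)

abbreviation "T \<equiv> arnoux_yoccoz"

text \<open>T is a translation only modulo 1. The one interval whose image crosses 1 is that of
  \<open>L2\<close>: the entry is right to the left of (1 - \<alpha>)/2, and beyond this break 1 has
  to be subtracted.\<close>

primrec letter_shift :: "letter \<Rightarrow> real" where
  "letter_shift L1 = (1 + \<alpha>) / 2"
| "letter_shift L2 = (1 + \<alpha>) / 2"
| "letter_shift L3 = (1 - \<alpha>) / 2"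
| "letter_shift L4 = (1 - \<alpha>) / 2"
| "letter_shift L5 = - (1 - \<alpha>^2) / 2"
| "letter_shift L6 = - (1 + \<alpha>^2) / 2"
| "letter_shift L7 = - (1 + \<alpha>^2) / 2"
| "letter_shift L8 = - (\<alpha> + \<alpha>^2) / 2"
| "letter_shift L9 = (\<alpha> + \<alpha>^2) / 2 - 1"

lemma swap_halves_left: "t0 \<le> t \<Longrightarrow> 2 * t < t0 + t1 \<Longrightarrow> swap_halves t0 t1 t = t + (t1 - t0) / 2"
  and swap_halves_right: "t0 + t1 \<le> 2 * t \<Longrightarrow> t < t1 \<Longrightarrow> swap_halves t0 t1 t = t - (t1 - t0) / 2"
  and swap_halves_outside: "t0 \<le> t1 \<Longrightarrow> t < t0 \<or> t1 \<le> t \<Longrightarrow> swap_halves t0 t1 t = t"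
  unfolding swap_halves_def by auto

lemma T_eq_shift:
  assumes "letter_lo a \<le> x" "x < letter_hi a"
  shows "T x = x + letter_shift a - (if a = L2 \<and> (1 - \<alpha>) / 2 \<le> x then 1 else 0)"
proof -
  note b = ay_alpha_bounds
  let ?T4 = "swap_halves (\<alpha> + \<alpha>^2) 1" and ?T3 = "swap_halves \<alpha> (\<alpha> + \<alpha>^2)"
    and ?T2 = "swap_halves 0 \<alpha>" and ?T1 = "swap_halves 0 1"
  have T: "T x = ?T1 (?T2 (?T3 (?T4 x)))"
    by (simp add: arnoux_yoccoz_def)
  have T4: "?T4 x = x" if "x < \<alpha> + \<alpha>^2"
    by (rule swap_halves_outside) (use that b in auto)
  have T3: "?T3 y = y" if "y < \<alpha> \<or> \<alpha> + \<alpha>^2 \<le> y" for y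
    by (rule swap_halves_outside) (use that b in auto)
  have T2: "?T2 y = y" if "\<alpha> \<le> y" for y
    by (rule swap_halves_outside) (use that b in auto)
  have low: "T x = ?T1 (x + \<alpha> / 2)" if "0 \<le> x" "x < \<alpha> / 2"
    unfolding T using that b swap_halves_left[of 0 x \<alpha>] by (simp add: T3 T4)
  have mid: "T x = x - \<alpha> / 2 + 1 / 2" if "\<alpha> / 2 \<le> x" "x < \<alpha>"
    unfolding T using that b swap_halves_right[of 0 \<alpha> x] swap_halves_left[of 0 "x - \<alpha> / 2" 1]
    by (simp add: T3 T4)
  have mid2: "T x = x - \<alpha>^2 / 2 - 1 / 2" if "\<alpha> + \<alpha>^2 / 2 \<le> x" "x < \<alpha> + \<alpha>^2"
    unfolding T using that b swap_halves_right[of \<alpha> "\<alpha> + \<alpha>^2" x]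
      swap_halves_right[of 0 1 "x - \<alpha>^2 / 2"] by (simp add: T2 T4)
  show ?thesis
  proof (cases a)
    case L1
    then show ?thesis
      using assms b low swap_halves_left[of 0 "x + \<alpha> / 2" 1] by (simp add: field_simps)
  next
    case L2
    show ?thesis
    proof (cases "(1 - \<alpha>) / 2 \<le> x")
      case True
      then show ?thesis
        using L2 assms b low swap_halves_right[of 0 1 "x + \<alpha> / 2"] by (simp add: field_simps)
    next
      case False
      then show ?thesis
        using L2 assms b low swap_halves_left[of 0 "x + \<alpha> / 2" 1] by (simp add: field_simps)
    qed
  next
    case L3
    then show ?thesis using assms b mid by (simp add: field_simps)
  next
    case L4
    then show ?thesis using assms b mid by (simp add: field_simps)
  next
    case L5
    then have "?T3 x = x + \<alpha>^2 / 2"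
      using assms b swap_halves_left[of \<alpha> x "\<alpha> + \<alpha>^2"] by simp
    then have "T x = ?T1 (x + \<alpha>^2 / 2)"
      unfolding T using L5 assms b by (simp add: T2 T4)
    then show ?thesis
      using L5 assms b swap_halves_right[of 0 1 "x + \<alpha>^2 / 2"] by (simp add: field_simps)
  next
    case L6
    then show ?thesis using assms b mid2 by (simp add: field_simps)
  next
    case L7
    then show ?thesis using assms b mid2 by (simp add: field_simps)
  next
    case L8
    then have "?T4 x = x + (1 - (\<alpha> + \<alpha>^2)) / 2"
      using assms b swap_halves_left[of "\<alpha> + \<alpha>^2" x 1] by simp
    moreover have "\<alpha> + \<alpha>^2 \<le> x + (1 - (\<alpha> + \<alpha>^2)) / 2"
      using L8 assms b by (simp add: field_simps)
    ultimately have "T x = ?T1 (x + (1 - (\<alpha> + \<alpha>^2)) / 2)"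
      unfolding T using b T2[of "x + (1 - (\<alpha> + \<alpha>^2)) / 2"] T3[of "x + (1 - (\<alpha> + \<alpha>^2)) / 2"]
      by simp
    then show ?thesis
      using L8 assms b swap_halves_right[of 0 1 "x + (1 - (\<alpha> + \<alpha>^2)) / 2"]
      by (simp add: field_simps)
  next
    case L9
    then have "?T4 x = x - (1 - (\<alpha> + \<alpha>^2)) / 2"
      using assms b swap_halves_right[of "\<alpha> + \<alpha>^2" 1 x] by simp
    moreover have "\<alpha> + \<alpha>^2 \<le> x - (1 - (\<alpha> + \<alpha>^2)) / 2"
      using L9 assms b by (simp add: field_simps)
    ultimately have "T x = ?T1 (x - (1 - (\<alpha> + \<alpha>^2)) / 2)"
      unfolding T using b T2[of "x - (1 - (\<alpha> + \<alpha>^2)) / 2"] T3[of "x - (1 - (\<alpha> + \<alpha>^2)) / 2"]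
      by simp
    then show ?thesis
      using L9 assms b swap_halves_right[of 0 1 "x - (1 - (\<alpha> + \<alpha>^2)) / 2"]
      by (simp add: field_simps)
  qed
qed

section \<open>Bijectivity and one-sided germs\<close>

text \<open>Exchanging two halves is an involution, so composing the same factors in reverse order
  inverts T.\<close>

definition arnoux_yoccoz_inv :: "real \<Rightarrow> real" where
  "arnoux_yoccoz_inv =
     swap_halves (\<alpha> + \<alpha>^2) 1 \<circ> swap_halves \<alpha> (\<alpha> + \<alpha>^2)
     \<circ> swap_halves 0 \<alpha> \<circ> swap_halves 0 1"

abbreviation "T' \<equiv> arnoux_yoccoz_inv"

lemma swap_halves_twice:
  assumes "t0 \<le> t1"
  shows "swap_halves t0 t1 (swap_halves t0 t1 t) = t"
  using assms unfolding swap_halves_def by (auto simp: field_simps)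

lemma swap_halves_unit:
  assumes "0 \<le> t0" "t0 \<le> t1" "t1 \<le> 1"
  shows "swap_halves t0 t1 t \<in> {0..<1} \<longleftrightarrow> t \<in> {0..<1}"
  using assms unfolding swap_halves_def by (auto simp: field_simps)

abbreviation eventually_right0 :: "(real \<Rightarrow> bool) \<Rightarrow> bool" (binder "\<forall>\<^sub>0" 10) where
  "\<forall>\<^sub>0s. P s \<equiv> eventually P (at_right 0)"

lemma right0_less:
  fixes t c :: real
  shows "\<forall>\<^sub>0s. t + s < c \<longleftrightarrow> t < c" "\<forall>\<^sub>0s. t - s < c \<longleftrightarrow> t \<le> c"
proof -
  have pos: "\<forall>\<^sub>0s. 0 < s" by (rule eventually_at_right_less)
  show "\<forall>\<^sub>0s. t + s < c \<longleftrightarrow> t < c"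
  proof (cases "t < c")
    case True
    then show ?thesis by (intro eventually_at_rightI[of 0 "c - t"]) auto
  next
    case False
    then show ?thesis using pos by (auto elim: eventually_mono)
  qed
  show "\<forall>\<^sub>0s. t - s < c \<longleftrightarrow> t \<le> c"
  proof (cases "t \<le> c")
    case True
    then show ?thesis using pos by (auto elim: eventually_mono)
  next
    case False
    then show ?thesis by (intro eventually_at_rightI[of 0 "t - c"]) auto
  qed
qed

lemma swap_germ_right: "\<forall>\<^sub>0s. swap_halves t0 t1 (t + s) = swap_halves t0 t1 t + s"
  using right0_less(1)[of t t0] right0_less(1)[of t "(t0 + t1) / 2"]
    right0_less(1)[of t t1]
  by eventually_elim (simp add: swap_halves_def flip: not_less)

lemma swap_germ_left: "\<exists>c. \<forall>\<^sub>0s. swap_halves t0 t1 (t - s) = c - s"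
proof
  show "\<forall>\<^sub>0s. swap_halves t0 t1 (t - s) =
      (if t0 < t \<and> t \<le> (t0 + t1) / 2 then t + (t1 - t0) / 2
       else if (t0 + t1) / 2 < t \<and> t \<le> t1 then t - (t1 - t0) / 2 else t) - s"
    using right0_less(2)[of t t0] right0_less(2)[of t "(t0 + t1) / 2"]
      right0_less(2)[of t t1]
    by eventually_elim (simp add: swap_halves_def flip: not_less)
qed

lemma arnoux_yoccoz_inv [simp]: "T' (T x) = x" "T (T' x) = x"
  using ay_alpha_bounds
  by (simp_all add: arnoux_yoccoz_def arnoux_yoccoz_inv_def swap_halves_twice)

lemma arnoux_yoccoz_mem [simp]: "T x \<in> {0..<1} \<longleftrightarrow> x \<in> {0..<1}" "T' x \<in> {0..<1} \<longleftrightarrow> x \<in> {0..<1}"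
  using ay_alpha_bounds
  by (simp_all add: arnoux_yoccoz_def arnoux_yoccoz_inv_def swap_halves_unit del: atLeastLessThan_iff)

definition germ_right :: "(real \<Rightarrow> real) \<Rightarrow> bool" where
  "germ_right g \<longleftrightarrow> (\<forall>t. \<forall>\<^sub>0s. g (t + s) = g t + s)"

text \<open>The base point \<open>c\<close> of the image germ is existential because at a
  discontinuity the left limit differs from the value. On the right no such freedom is needed, as
  all maps here are right-continuous.\<close>

definition germ_left :: "(real \<Rightarrow> real) \<Rightarrow> bool" where
  "germ_left g \<longleftrightarrow> (\<forall>t. \<exists>c. \<forall>\<^sub>0s. g (t - s) = c - s)"

lemma germ_right_comp: "germ_right g \<Longrightarrow> germ_right h \<Longrightarrow> germ_right (g \<circ> h)"
  unfolding germ_right_def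
proof
  fix t
  assume "\<forall>t. \<forall>\<^sub>0s. g (t + s) = g t + s" "\<forall>t. \<forall>\<^sub>0s. h (t + s) = h t + s"
  then have "\<forall>\<^sub>0s. h (t + s) = h t + s" "\<forall>\<^sub>0s. g (h t + s) = g (h t) + s"
    by blast+
  then show "\<forall>\<^sub>0s. (g \<circ> h) (t + s) = (g \<circ> h) t + s"
    by eventually_elim simp
qed

lemma germ_left_comp:
  assumes "germ_left g" "germ_left h"
  shows "germ_left (g \<circ> h)"
  unfolding germ_left_def
proof
  fix t
  obtain c where c: "\<forall>\<^sub>0s. h (t - s) = c - s"
    using assms unfolding germ_left_def by blast
  obtain d where "\<forall>\<^sub>0s. g (c - s) = d - s"
    using assms unfolding germ_left_def by blast
  with c have "\<forall>\<^sub>0s. (g \<circ> h) (t - s) = d - s"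
    by eventually_elim simp
  then show "\<exists>c. \<forall>\<^sub>0s. (g \<circ> h) (t - s) = c - s" ..
qed

lemma germ_swap_halves: "germ_right (swap_halves t0 t1)" "germ_left (swap_halves t0 t1)"
  unfolding germ_right_def germ_left_def using swap_germ_right swap_germ_left by auto

lemma germ_T: "germ_right T" "germ_left T" "germ_right T'" "germ_left T'"
  unfolding arnoux_yoccoz_def arnoux_yoccoz_inv_def
  by (intro germ_right_comp germ_left_comp germ_swap_halves)+

section \<open>Orbits and cocycles\<close>

definition orb :: "real \<Rightarrow> int \<Rightarrow> real" where
  "orb x n = (if 0 \<le> n then (T ^^ nat n) x else (T' ^^ nat (- n)) x)"

lemma orb_0 [simp]: "orb x 0 = x"
  by (simp add: orb_def)

lemma orb_succ: "orb x (n + 1) = T (orb x n)"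
proof (cases "0 \<le> n")
  case True
  then show ?thesis by (simp add: orb_def nat_add_distrib)
next
  case False
  then have "nat (- n) = Suc (nat (- (n + 1)))" by linarith
  then show ?thesis using False by (auto simp: orb_def)
qed

lemma orb_1 [simp]: "orb x 1 = T x"
  using orb_succ[of x 0] by simp

lemma orb_pred: "orb x (n - 1) = T' (orb x n)"
  using orb_succ[of x "n - 1"] by (metis arnoux_yoccoz_inv(1) diff_add_cancel)

lemma orb_add: "orb x (m + n) = orb (orb x m) n"
proof (induction n rule: int_induct[of _ 0])
  case (step1 i)
  then show ?case using orb_succ[of x "m + i"] orb_succ[of "orb x m" i] by (simp add: add.assoc)
next
  case (step2 i)
  then show ?case using orb_pred[of x "m + i"] orb_pred[of "orb x m" i] by (simp add: algebra_simps)
qed simp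

lemma orb_unit [simp]: "orb x n \<in> {0..<1} \<longleftrightarrow> x \<in> {0..<1}"
  by (induction n rule: int_induct[of _ 0]) (simp_all only: orb_0 orb_succ orb_pred arnoux_yoccoz_mem)

lemma orb_mem: "x \<in> {0..<1} \<Longrightarrow> orb x n \<in> {0..<1}"
  by (simp only: orb_unit)

lemma orb_inj: "orb x n = orb y n \<Longrightarrow> x = y"
  using orb_add[of x n "- n"] orb_add[of y n "- n"] by simp

lemma germ_orb: "germ_right (\<lambda>x. orb x n)" "germ_left (\<lambda>x. orb x n)"
proof -
  have "germ_right (\<lambda>x. orb x n) \<and> germ_left (\<lambda>x. orb x n)"
  proof (induction n rule: int_induct[of _ 0])
    case base
    show ?case by (auto simp: germ_right_def germ_left_def)
  next
    case (step1 i)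
    have "(\<lambda>x. orb x (i + 1)) = T \<circ> (\<lambda>x. orb x i)" by (auto simp: orb_succ)
    with step1 show ?case by (metis germ_T germ_right_comp germ_left_comp)
  next
    case (step2 i)
    have "(\<lambda>x. orb x (i - 1)) = T' \<circ> (\<lambda>x. orb x i)" by (auto simp: orb_pred)
    with step2 show ?case by (metis germ_T germ_right_comp germ_left_comp)
  qed
  then show "germ_right (\<lambda>x. orb x n)" "germ_left (\<lambda>x. orb x n)" by auto
qed

text \<open>The sign at negative times makes the identity \<open>cocycle_add\<close> hold for all
  integers. The values lie in an arbitrary abelian group because integer vectors, complex steps and
  tower heights are all summed in this way.\<close>

definition cocycle :: "(letter \<Rightarrow> 'a::ab_group_add) \<Rightarrow> real \<Rightarrow> int \<Rightarrow> 'a" where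
  "cocycle \<phi> x n =
     (if 0 \<le> n then \<Sum>i\<in>{0..<n}. \<phi> (letter_of (orb x i)) else - (\<Sum>i\<in>{n..<0}. \<phi> (letter_of (orb x i))))"

lemma cocycle_0 [simp]: "cocycle \<phi> x 0 = 0"
  by (simp add: cocycle_def)

lemma cocycle_succ: "cocycle \<phi> x (n + 1) = cocycle \<phi> x n + \<phi> (letter_of (orb x n))"
proof (cases "0 \<le> n")
  case True
  then have "{0..<n + 1} = insert n {0..<n}" by auto
  then show ?thesis using True by (simp add: cocycle_def add.commute)
next
  case False
  then have "{n..<0} = insert n {n + 1..<0}" by auto
  then show ?thesis using False by (auto simp: cocycle_def)
qed

lemma cocycle_1 [simp]: "cocycle \<phi> x 1 = \<phi> (letter_of x)"
  using cocycle_succ[of \<phi> x 0] by simp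

lemma cocycle_pred: "cocycle \<phi> x (n - 1) = cocycle \<phi> x n - \<phi> (letter_of (orb x (n - 1)))"
  using cocycle_succ[of \<phi> x "n - 1"] by simp

lemma cocycle_add: "cocycle \<phi> x (m + n) = cocycle \<phi> x m + cocycle \<phi> (orb x m) n"
proof (induction n rule: int_induct[of _ 0])
  case (step1 i)
  then show ?case
    using cocycle_succ[of \<phi> x "m + i"] cocycle_succ[of \<phi> "orb x m" i]
    by (simp add: add.assoc orb_add)
next
  case (step2 i)
  have "cocycle \<phi> x (m + (i - 1)) = cocycle \<phi> x (m + i) - \<phi> (letter_of (orb x (m + (i - 1))))"
    using cocycle_pred[of \<phi> x "m + i"] by (simp add: add_diff_eq)
  also have "\<dots> = cocycle \<phi> x m + (cocycle \<phi> (orb x m) i - \<phi> (letter_of (orb (orb x m) (i - 1))))"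
    by (simp only: step2 orb_add[of x m "i - 1"] add_diff_eq[symmetric])
  finally show ?case by (simp only: cocycle_pred)
qed simp

lemma cocycle_hom:
  assumes "\<And>u v. g (u + v) = g u + g v"
  shows "cocycle (\<lambda>a. g (\<phi> a)) x n = g (cocycle \<phi> x n)"
proof -
  interpret additive g by standard (rule assms)
  show ?thesis by (simp add: cocycle_def sum minus)
qed

section \<open>Renormalization\<close>

text \<open>This is \<open>\<alpha> * frac (x - letter_lo L4)\<close>.\<close>

definition renorm :: "real \<Rightarrow> real" where
  "renorm x = \<alpha> * x - (1 - \<alpha>) / 2 + (if x < (\<alpha> + \<alpha>^2) / 2 then \<alpha> else 0)"

text \<open>With \<open>s\<close> the translation part of \<open>renorm\<close> on the interval of
  \<open>a\<close>, the first four items place its image, and the T-image of that, inside the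
  intervals of the letters of \<open>ay_subst a\<close>. The last two concern \<open>L7\<close> and
  \<open>L8\<close>, whose images lie in \<open>L2\<close> on opposite sides of the break (1 -
  \<alpha>)/2.\<close>

lemma renorm_endpoints:
  assumes "s = (if a \<in> {L1, L2, L3} then \<alpha> else 0) - (1 - \<alpha>) / 2"
  shows "letter_lo (hd (ay_subst a)) \<le> \<alpha> * letter_lo a + s"
    and "\<alpha> * letter_hi a + s \<le> letter_hi (hd (ay_subst a))"
    and "tl (ay_subst a) = [c] \<Longrightarrow> letter_lo c \<le> \<alpha> * letter_lo a + s + letter_shift (hd (ay_subst a))"
    and "tl (ay_subst a) = [c] \<Longrightarrow> \<alpha> * letter_hi a + s + letter_shift (hd (ay_subst a)) \<le> letter_hi c"
    and "tl (ay_subst a) = [c] \<Longrightarrow> hd (ay_subst a) = L2 \<Longrightarrow> \<alpha> * letter_hi a + s \<le> (1 - \<alpha>) / 2"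
    and "tl (ay_subst a) = [] \<Longrightarrow> hd (ay_subst a) = L2 \<Longrightarrow> (1 - \<alpha>) / 2 \<le> \<alpha> * letter_lo a + s"
  unfolding assms using ay_alpha_bounds
  by (cases a; auto simp: ay_alpha_mult ring_distribs add_divide_distrib diff_divide_distrib)+

lemma renorm_desubst:
  assumes "x \<in> {0..<1}"
  shows "renorm x \<in> {0..<1}"
    and "letter_of (renorm x) = hd (ay_subst (letter_of x))"
    and "tl (ay_subst (letter_of x)) = [] \<Longrightarrow> T (renorm x) = renorm (T x)"
    and "tl (ay_subst (letter_of x)) = [c] \<Longrightarrow> letter_of (T (renorm x)) = c \<and> T (T (renorm x)) = renorm (T x)"
proof -
  define a where "a = letter_of x"
  define s where "s = (if a \<in> {L1, L2, L3} then \<alpha> else 0) - (1 - \<alpha>) / 2"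
  have x: "letter_lo a \<le> x" "x < letter_hi a"
    using letter_of_bounds[OF assms] by (auto simp: a_def)
  have bx: "\<alpha> * letter_lo a \<le> \<alpha> * x" "\<alpha> * x < \<alpha> * letter_hi a"
    using x ay_alpha_pos by auto
  note b = ay_alpha_bounds
  note ends = renorm_endpoints[OF s_def]
  define y where "y = renorm x"
  have "x < (\<alpha> + \<alpha>^2) / 2 \<longleftrightarrow> a \<in> {L1, L2, L3}"
    using x b by (cases a; simp)
  then have y: "y = \<alpha> * x + s"
    by (simp add: y_def renorm_def s_def)
  let ?c = "hd (ay_subst a)"
  have yc: "letter_lo ?c \<le> y" "y < letter_hi ?c"
    using bx ends(1,2) y by linarith+
  then show "renorm x \<in> {0..<1}"
    using letter_lo_nonneg[of ?c] letter_hi_le_1[of ?c] by (auto simp: y_def)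
  have letter_y: "letter_of y = ?c"
    using yc by (rule letter_of_eq)
  then show "letter_of (renorm x) = hd (ay_subst (letter_of x))"
    by (simp add: y_def a_def)
  have Tx: "T x = x + letter_shift a - (if a = L2 \<and> (1 - \<alpha>) / 2 \<le> x then 1 else 0)"
    using x by (rule T_eq_shift)
  \<comment> \<open>\<open>renorm\<close> jumps at (\<alpha> + \<alpha>^2)/2, so its value at T x
    depends on the side of T x. The letter of x decides this, except on \<open>L2\<close>, where the
    break at (1 - \<alpha>)/2 does.\<close>
  have Tx_side: "T x < (\<alpha> + \<alpha>^2) / 2 \<longleftrightarrow> a \<in> {L5, L6, L7, L9} \<or> (a = L2 \<and> (1 - \<alpha>) / 2 \<le> x)"
    unfolding Tx using x b by (cases a) (auto simp: field_simps)
  have Ty: "T y = y + letter_shift ?c - (if ?c = L2 \<and> (1 - \<alpha>) / 2 \<le> y then 1 else 0)"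
    using yc by (rule T_eq_shift)
  note simps = ay_alpha_mult ring_distribs add_divide_distrib diff_divide_distrib
  show "T (renorm x) = renorm (T x)" if "tl (ay_subst (letter_of x)) = []"
  proof -
    from that have a: "a = L8 \<or> a = L9" by (cases a) (auto simp: a_def[symmetric])
    have "(1 - \<alpha>) / 2 \<le> y" if "a = L8"
      using ends(6) that bx y by simp
    then show ?thesis
      unfolding y_def[symmetric] Ty renorm_def[of "T x"] Tx_side
      using a unfolding Tx by (auto simp: y s_def simps)
  qed
  show "letter_of (T (renorm x)) = c \<and> T (T (renorm x)) = renorm (T x)"
    if "tl (ay_subst (letter_of x)) = [c]"
  proof -
    have c: "tl (ay_subst a) = [c]" using that by (simp add: a_def)
    have Ty': "T y = y + letter_shift ?c"
      unfolding Ty using ends(5)[OF c] bx y by auto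
    have Tyc: "letter_lo c \<le> T y" "T y < letter_hi c"
      using ends(3,4)[OF c] bx Ty' y by linarith+
    have "c \<noteq> L2" using c by (cases a) auto
    then have "T (T y) = T y + letter_shift c"
      using T_eq_shift[OF Tyc] by simp
    also have "\<dots> = \<alpha> * x + s + letter_shift ?c + letter_shift c"
      using Ty' y by simp
    also have "\<dots> = renorm (T x)"
      unfolding renorm_def[of "T x"] Tx_side unfolding Tx
      using c by (cases a) (auto simp: s_def simps)
    finally show ?thesis using letter_of_eq[OF Tyc] by (simp add: y_def)
  qed
qed

definition itin :: "real \<Rightarrow> nat \<Rightarrow> letter list" where
  "itin x n = map (\<lambda>i. letter_of (orb x (int i))) [0..<n]"

lemma length_itin [simp]: "length (itin x n) = n"
  by (simp add: itin_def)

lemma itin_0 [simp]: "itin x 0 = []"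
  by (simp add: itin_def)

lemma itin_Suc: "itin x (Suc n) = itin x n @ [letter_of (orb x (int n))]"
  by (simp add: itin_def)

lemma itin_add: "itin x (m + n) = itin x m @ itin (orb x (int m)) n"
  by (induction n) (simp_all add: itin_Suc flip: orb_add)

lemma itin_nth: "i < n \<Longrightarrow> itin x n ! i = letter_of (orb x (int i))"
  by (simp add: itin_def)

lemma cocycle_itin: "cocycle \<phi> x (int n) = sum_list (map \<phi> (itin x n))"
proof (induction n)
  case (Suc n)
  then show ?case using cocycle_succ[of \<phi> x "int n"] by (simp add: itin_Suc add.commute)
qed simp

primrec subst_pow :: "nat \<Rightarrow> letter \<Rightarrow> letter list" where
  "subst_pow 0 a = [a]"
| "subst_pow (Suc k) a = concat (map (subst_pow k) (ay_subst a))"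

abbreviation "tower k \<equiv> (\<lambda>a. int (length (subst_pow k a)))"

text \<open>The time that the orbit of \<open>(renorm ^^ k) y\<close> takes to traverse the level-k
  blocks of the first j letters of y; for negative j it runs backwards.\<close>

abbreviation "clock k \<equiv> cocycle (tower k)"

lemma subst_pow_nonempty: "subst_pow k a \<noteq> []"
  by (induction k arbitrary: a) (auto, case_tac a, auto)

lemma tower_pos: "0 < tower k a"
  using subst_pow_nonempty by simp

lemma renorm_unit [simp]: "x \<in> {0..<1} \<Longrightarrow> renorm x \<in> {0..<1}"
  by (rule renorm_desubst)

lemma renorm_pow_unit [simp]: "x \<in> {0..<1} \<Longrightarrow> (renorm ^^ k) x \<in> {0..<1}"
  by (induction k) (auto simp del: atLeastLessThan_iff)

lemma itin_renorm:
  assumes "x \<in> {0..<1}"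
  shows "itin (renorm x) (length (ay_subst (letter_of x))) = ay_subst (letter_of x)"
    and "orb (renorm x) (int (length (ay_subst (letter_of x)))) = renorm (T x)"
proof -
  have two: "orb y 2 = T (T y)" for y
    using orb_succ[of y 1] by simp
  have "itin (renorm x) (length (ay_subst (letter_of x))) = ay_subst (letter_of x) \<and>
    orb (renorm x) (int (length (ay_subst (letter_of x)))) = renorm (T x)"
    using renorm_desubst[OF assms]
    by (cases "letter_of x") (simp_all add: itin_def two)
  then show "itin (renorm x) (length (ay_subst (letter_of x))) = ay_subst (letter_of x)"
    and "orb (renorm x) (int (length (ay_subst (letter_of x)))) = renorm (T x)" by auto
qed

lemma itin_renorm_pow:
  assumes "x \<in> {0..<1}"
  shows "itin ((renorm ^^ k) x) (length (subst_pow k (letter_of x))) = subst_pow k (letter_of x)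
    \<and> orb ((renorm ^^ k) x) (tower k (letter_of x)) = (renorm ^^ k) (T x)"
  using assms
proof (induction k arbitrary: x)
  case 0
  then show ?case by (simp add: itin_def)
next
  case (Suc k)
  \<comment> \<open>The induction hypothesis concerns one letter; here it is extended to words, to
    be applied to the word of \<open>renorm x\<close> that is the substituted letter of x.\<close>
  have *: "itin ((renorm ^^ k) y) (length (concat (map (subst_pow k) (itin y n)))) = concat (map (subst_pow k) (itin y n))
    \<and> orb ((renorm ^^ k) y) (int (length (concat (map (subst_pow k) (itin y n))))) = (renorm ^^ k) (orb y (int n))"
    if "y \<in> {0..<1}" for y n
  proof (induction n)
    case (Suc n)
    have "orb y (int n) \<in> {0..<1}" using that by (intro orb_mem)
    from Suc.IH \<open>\<And>x. x \<in> {0..<1} \<Longrightarrow> _\<close>[OF this] show ?case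
      by (auto simp: itin_Suc itin_add orb_add orb_succ[of y "int n"] add.commute[of 1])
  qed simp
  show ?case
    using *[OF renorm_unit[OF Suc.prems], of "length (ay_subst (letter_of x))"] itin_renorm[OF Suc.prems]
    by (simp add: funpow_swap1)
qed

lemma orb_renorm_pow:
  assumes "y \<in> {0..<1}"
  shows "orb ((renorm ^^ k) y) (clock k y j) = (renorm ^^ k) (orb y j)"
proof (induction j rule: int_induct[of _ 0])
  case (step1 i)
  have "orb y i \<in> {0..<1}" using assms by (intro orb_mem)
  from itin_renorm_pow[OF this, of k] step1 show ?case
    by (simp add: cocycle_succ orb_add orb_succ)
next
  case (step2 i)
  have "orb y (i - 1) \<in> {0..<1}" using assms by (intro orb_mem)
  note r = itin_renorm_pow[OF this, of k, THEN conjunct2]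
  have "orb (orb ((renorm ^^ k) y) (clock k y (i - 1))) (tower k (letter_of (orb y (i - 1))))
      = orb ((renorm ^^ k) (orb y (i - 1))) (tower k (letter_of (orb y (i - 1))))"
    unfolding r using step2 by (simp add: cocycle_pred orb_succ[symmetric] flip: orb_add)
  then show ?case by (rule orb_inj)
qed simp

text \<open>Summing over whole blocks replaces the function \<open>\<phi>\<close> on letters by its
  sums over substituted words, that is, by the k-th power of the substitution matrix applied to
  \<open>\<phi>\<close>.\<close>

lemma cocycle_renorm_pow:
  assumes "y \<in> {0..<1}"
  shows "cocycle \<phi> ((renorm ^^ k) y) (clock k y j)
    = cocycle (\<lambda>a. sum_list (map \<phi> (subst_pow k a))) y j"
proof -
  have block: "cocycle \<phi> ((renorm ^^ k) (orb y i)) (tower k (letter_of (orb y i)))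
      = sum_list (map \<phi> (subst_pow k (letter_of (orb y i))))" for i
  proof -
    have "orb y i \<in> {0..<1}" using assms by (intro orb_mem)
    from itin_renorm_pow[OF this, of k] show ?thesis by (simp add: cocycle_itin)
  qed
  show ?thesis
  proof (induction j rule: int_induct[of _ 0])
    case (step1 i)
    then show ?case
      by (simp add: cocycle_succ cocycle_add orb_renorm_pow[OF assms] block)
  next
    case (step2 i)
    have "cocycle \<phi> ((renorm ^^ k) y) (clock k y i)
      = cocycle \<phi> ((renorm ^^ k) y) (clock k y (i - 1) + tower k (letter_of (orb y (i - 1))))"
      by (simp add: cocycle_pred)
    also have "\<dots> = cocycle \<phi> ((renorm ^^ k) y) (clock k y (i - 1))
        + sum_list (map \<phi> (subst_pow k (letter_of (orb y (i - 1)))))"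
      by (simp only: cocycle_add orb_renorm_pow[OF assms] block)
    finally show ?case using step2 by (simp add: cocycle_pred)
  qed simp
qed

lemma cocycle_strict_mono:
  fixes \<phi> :: "letter \<Rightarrow> int"
  assumes "\<And>a. 0 < \<phi> a" "m < n"
  shows "cocycle \<phi> x m < cocycle \<phi> x n"
  using assms(2)
proof (induction n rule: int_gr_induct)
  case base
  then show ?case using assms(1) by (simp add: cocycle_succ)
next
  case (step i)
  then show ?case using assms(1)[of "letter_of (orb x i)"] by (simp add: cocycle_succ)
qed

lemma cocycle_bracket:
  fixes \<phi> :: "letter \<Rightarrow> int"
  assumes pos: "\<And>a. 0 < \<phi> a"
  obtains j where "cocycle \<phi> x j \<le> n" "n < cocycle \<phi> x (j + 1)"
proof -
  let ?c = "cocycle \<phi> x"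
  have up: "?c m + int i \<le> ?c (m + int i)" for m i
  proof (induction i)
    case (Suc i)
    then show ?case using cocycle_succ[of \<phi> x "m + int i"] pos[of "letter_of (orb x (m + int i))"]
      by (simp add: algebra_simps)
  qed simp
  have "\<exists>j. ?c j \<le> n \<and> n < ?c (j + 1)"
  proof (rule ccontr)
    assume no: "\<not> ?thesis"
    \<comment> \<open>The cocycle grows by at least 1 per step, so at a time j0 \<le> 0 it is at
      most j0; the minimum with n makes this at most n.\<close>
    define j0 where "j0 = min 0 n"
    have "?c j0 \<le> n"
      using up[of j0 "nat (- j0)"] by (auto simp: j0_def min_def split: if_splits)
    then have "?c (j0 + int i) \<le> n" for i
    proof (induction i)
      case (Suc i)
      then show ?case using no by (force simp: algebra_simps not_less)
    qed simp
    from this[of "nat (n + 1 - ?c j0)"] up[of j0 "nat (n + 1 - ?c j0)"] \<open>?c j0 \<le> n\<close>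
    show False by simp
  qed
  then show ?thesis using that by blast
qed

text \<open>\<open>renorm\<close> fills [0, \<alpha>), and T maps [\<alpha>, 1) into [0, \<alpha>).
  A point outside the image therefore has its T-preimage in the image.\<close>

lemma renorm_onto:
  assumes "x \<in> {0..<1}"
  shows "\<exists>y\<in>{0..<1}. x = renorm y \<or> x = T (renorm y)"
proof -
  note b = ay_alpha_bounds ay_alpha_pos
  have mid: "\<alpha> * ((\<alpha> + \<alpha>^2) / 2) = (1 - \<alpha>) / 2"
    by (simp add: ay_alpha_mult ring_distribs)
  have low: "\<exists>y\<in>{0..<1}. x = renorm y" if x: "0 \<le> x" "x < \<alpha>" for x
  proof (cases "x + (1 - \<alpha>) / 2 < \<alpha>")
    case True
    define y where "y = (x + (1 - \<alpha>) / 2) / \<alpha>"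
    have y: "\<alpha> * y = x + (1 - \<alpha>) / 2" using b by (simp add: y_def)
    have "\<alpha> * ((\<alpha> + \<alpha>^2) / 2) \<le> \<alpha> * y" "\<alpha> * y < \<alpha> * 1"
      using x True unfolding y mid by linarith+
    then have "(\<alpha> + \<alpha>^2) / 2 \<le> y" "y < 1" using b by simp_all
    then show ?thesis using y b by (intro bexI[of _ y]) (auto simp: renorm_def)
  next
    case False
    define y where "y = (x + (1 - \<alpha>) / 2 - \<alpha>) / \<alpha>"
    have y: "\<alpha> * y = x + (1 - \<alpha>) / 2 - \<alpha>" using b by (simp add: y_def)
    have "\<alpha> * y < \<alpha> * ((\<alpha> + \<alpha>^2) / 2)" "\<alpha> * 0 \<le> \<alpha> * y"
      using x False unfolding y mid by linarith+
    then have "y < (\<alpha> + \<alpha>^2) / 2" "0 \<le> y" using b by (simp_all add: zero_le_mult_iff)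
    then show ?thesis using y b by (intro bexI[of _ y]) (auto simp: renorm_def)
  qed
  show ?thesis
  proof (cases "x < \<alpha>")
    case True
    then show ?thesis using low assms by auto
  next
    case False
    define u where "u = T' x"
    have u: "u \<in> {0..<1}" using assms by (simp add: u_def del: atLeastLessThan_iff)
    have "u < \<alpha>"
    proof (rule ccontr)
      assume "\<not> u < \<alpha>"
      then have "letter_of u \<in> {L5, L6, L7, L8, L9}"
        using letter_of_bounds[OF u] ay_alpha_bounds by (cases "letter_of u") simp_all
      moreover have "T u \<le> u + letter_shift (letter_of u)"
        using T_eq_shift[OF letter_of_bounds[OF u]] by simp
      ultimately have "T u < \<alpha>"
        using letter_of_bounds[OF u] ay_alpha_bounds by (cases "letter_of u") (auto simp: field_simps)
      then show False using False by (simp add: u_def)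
    qed
    then obtain y where "y \<in> {0..<1}" "u = renorm y" using low[of u] u by auto
    then show ?thesis by (metis arnoux_yoccoz_inv(2) u_def)
  qed
qed

lemma renorm_cover:
  assumes "x \<in> {0..<1}"
  obtains y n where "y \<in> {0..<1}" "x = orb ((renorm ^^ k) y) n" "0 \<le> n" "n < tower k (letter_of y)"
proof -
  have "\<exists>y\<in>{0..<1}. \<exists>n. x = orb ((renorm ^^ k) y) n"
  proof (induction k)
    case 0
    then show ?case using assms by (intro bexI[of _ x] exI[of _ 0]) auto
  next
    case (Suc k)
    then obtain y n where y: "y \<in> {0..<1}" "x = orb ((renorm ^^ k) y) n" by blast
    from renorm_onto[OF y(1)] obtain u m where u: "u \<in> {0..<1}" "y = orb (renorm u) m"
      using orb_0 orb_1 by metis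
    have "x = orb ((renorm ^^ Suc k) u) (clock k (renorm u) m + n)"
      using y(2) orb_renorm_pow[OF renorm_unit[OF u(1)], of k m] u(2)
      by (simp add: orb_add funpow_swap1)
    then show ?case using u(1) by blast
  qed
  then obtain y n where y: "y \<in> {0..<1}" "x = orb ((renorm ^^ k) y) n" by blast
  obtain j where j: "clock k y j \<le> n" "n < clock k y (j + 1)"
    by (rule cocycle_bracket[where \<phi> = "tower k" and x = y and n = n]) (rule tower_pos)
  show ?thesis
  proof (rule that)
    show "orb y j \<in> {0..<1}" using y by (intro orb_mem)
    show "x = orb ((renorm ^^ k) (orb y j)) (n - clock k y j)"
      using y(2) by (simp add: orb_renorm_pow[OF y(1), symmetric] flip: orb_add)
  qed (use j in \<open>auto simp: cocycle_succ\<close>)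
qed

section \<open>Minimality\<close>

lemma subst_pow_1: "subst_pow (Suc 0) a = ay_subst a"
  by (cases a) simp_all

lemma letter_of_renorm_pow:
  assumes "y \<in> {0..<1}" "i < length (subst_pow k (letter_of y))"
  shows "letter_of (orb ((renorm ^^ k) y) (int i)) = subst_pow k (letter_of y) ! i"
  using itin_renorm_pow[OF assms(1), of k] assms(2) by (metis itin_nth)

definition visits :: "real \<Rightarrow> letter \<Rightarrow> bool" where
  "visits x a \<longleftrightarrow> (\<exists>j. letter_of (orb x j) = a)"

lemma visits_orb: "visits (orb x n) a \<longleftrightarrow> visits x a"
  unfolding visits_def by (metis add.commute diff_add_cancel orb_add)

text \<open>Primitivity in two pieces: the fifth substitution of every letter contains
  \<open>L1\<close>, and every other letter is reached from \<open>L1\<close> by repeated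
  substitution. The towers over renormalized orbits turn occurrences in words into visits.\<close>

lemma visits_all:
  assumes "x \<in> {0..<1}"
  shows "visits x a"
proof -
  have L1: "visits x L1" if x: "x \<in> {0..<1}" for x
  proof -
    obtain y n where y: "y \<in> {0..<1}" "x = orb ((renorm ^^ 5) y) n"
      using renorm_cover[OF x, of 5] by metis
    have "L1 \<in> set (subst_pow 5 (letter_of y))"
      by (cases "letter_of y") (simp_all add: eval_nat_numeral)
    then obtain i where "i < length (subst_pow 5 (letter_of y))" "subst_pow 5 (letter_of y) ! i = L1"
      by (metis in_set_conv_nth)
    then have "visits ((renorm ^^ 5) y) L1"
      using letter_of_renorm_pow[OF y(1), of i 5] unfolding visits_def by metis
    then show ?thesis using y(2) by (simp add: visits_orb)
  qed
  have step: "\<forall>x\<in>{0..<1}. visits x c" if a: "\<forall>x\<in>{0..<1}. visits x a" and c: "c \<in> set (ay_subst a)" for a c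
  proof
    fix x :: real assume x: "x \<in> {0..<1}"
    obtain y n where y: "y \<in> {0..<1}" "x = orb ((renorm ^^ 1) y) n"
      using renorm_cover[OF x, of 1] by metis
    obtain j where j: "letter_of (orb y j) = a"
      using a y(1) unfolding visits_def by blast
    have yj: "orb y j \<in> {0..<1}" using y(1) by (intro orb_mem)
    obtain i where "i < length (ay_subst a)" "ay_subst a ! i = c"
      using c by (metis in_set_conv_nth)
    then have "visits ((renorm ^^ 1) (orb y j)) c"
      using letter_of_renorm_pow[OF yj, of i 1] j unfolding visits_def
      by (auto intro!: exI[of _ "int i"] simp: subst_pow_1 simp del: subst_pow.simps)
    then show "visits x c"
      unfolding y(2) visits_orb orb_renorm_pow[OF y(1), symmetric] by (simp add: visits_orb)
  qed
  have 1: "\<forall>x\<in>{0..<1}. visits x L1" using L1 by blast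
  have 3: "\<forall>x\<in>{0..<1}. visits x L3" and 5: "\<forall>x\<in>{0..<1}. visits x L5" using step[OF 1] by auto
  have 4: "\<forall>x\<in>{0..<1}. visits x L4" and 6: "\<forall>x\<in>{0..<1}. visits x L6" using step[OF 3] by auto
  have 7: "\<forall>x\<in>{0..<1}. visits x L7" using step[OF 4] by auto
  have 8: "\<forall>x\<in>{0..<1}. visits x L8" using step[OF 5] by auto
  have 2: "\<forall>x\<in>{0..<1}. visits x L2" and 9: "\<forall>x\<in>{0..<1}. visits x L9" using step[OF 7] by auto
  show ?thesis using 1 2 3 4 5 6 7 8 9 assms by (cases a) auto
qed

lemma itin_take: "m \<le> n \<Longrightarrow> itin x m = take m (itin x n)"
  by (auto simp: itin_def take_map)

text \<open>Points with the same letter are moved by the same amount modulo 1; the integer accounts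
  for the break inside \<open>L2\<close>.\<close>

lemma orb_diff_itin:
  assumes "x \<in> {0..<1}" "y \<in> {0..<1}" "itin x n = itin y n"
  shows "\<exists>m::int. orb x (int n) - orb y (int n) = x - y + of_int m"
  using assms(3)
proof (induction n)
  case 0
  then show ?case by (auto intro!: exI[of _ 0])
next
  case (Suc n)
  then obtain m :: int where m: "orb x (int n) - orb y (int n) = x - y + of_int m"
    and eq: "letter_of (orb x (int n)) = letter_of (orb y (int n))"
    by (auto simp: itin_Suc)
  have T: "\<exists>l::int. T u = u + letter_shift (letter_of u) + of_int l" if "u \<in> {0..<1}" for u
    using T_eq_shift[OF letter_of_bounds[OF that]]
    by (auto intro!: exI[of _ "if letter_of u = L2 \<and> (1 - \<alpha>) / 2 \<le> u then -1 else 0"])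
  have xu: "orb x (int n) \<in> {0..<1}" and yu: "orb y (int n) \<in> {0..<1}"
    using assms by (simp_all del: atLeastLessThan_iff)
  obtain l l' :: int where
    "T (orb x (int n)) = orb x (int n) + letter_shift (letter_of (orb x (int n))) + of_int l"
    "T (orb y (int n)) = orb y (int n) + letter_shift (letter_of (orb y (int n))) + of_int l'"
    using T[OF xu] T[OF yu] by blast
  then show ?case using m eq
    by (intro exI[of _ "m + l - l'"]) (simp add: orb_succ[of _ "int n", simplified add.commute])
qed

lemma renorm_pow_diff:
  assumes "x \<in> {0..<1}" "y \<in> {0..<1}" "letter_of x = letter_of y"
  shows "(renorm ^^ k) x - (renorm ^^ k) y = \<alpha> ^ k * (x - y)"
  using assms
proof (induction k arbitrary: x y)
  case (Suc k)
  have side: "u < (\<alpha> + \<alpha>^2) / 2 \<longleftrightarrow> letter_of u \<in> {L1, L2, L3}" if "u \<in> {0..<1}" for u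
    using letter_of_bounds[OF that] ay_alpha_bounds by (cases "letter_of u"; simp)
  have "renorm x - renorm y = \<alpha> * (x - y)"
    unfolding renorm_def side[OF Suc.prems(1)] side[OF Suc.prems(2)] Suc.prems(3)
    by (simp add: algebra_simps)
  moreover have "letter_of (renorm x) = letter_of (renorm y)"
    using renorm_desubst(2)[OF Suc.prems(1)] renorm_desubst(2)[OF Suc.prems(2)] Suc.prems(3) by simp
  ultimately show ?case
    using Suc.IH[of "renorm x" "renorm y"] Suc.prems(1,2)
    by (simp add: funpow_swap1 del: atLeastLessThan_iff)
qed simp

text \<open>The midpoint of the target lies on some floor of a level-k tower. The orbit of x0 visits
  the same floor of a tower of the same letter, and two points there differ, modulo 1, by at most
  \<alpha>^k.\<close>

lemma orb_dense:
  assumes x0: "x0 \<in> {0..<1}" and uv: "0 \<le> u" "u < v" "v \<le> 1"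
  shows "\<exists>n. orb x0 n \<in> {u<..<v}"
proof -
  define x where "x = (u + v) / 2"
  have x: "x \<in> {0..<1}" using uv by (auto simp: x_def)
  obtain k where k: "\<alpha> ^ k < (v - u) / 2"
    using real_arch_pow_inv[of "(v - u) / 2" \<alpha>] ay_alpha_less_1 uv by auto
  obtain y n where y: "y \<in> {0..<1}" "x = orb ((renorm ^^ k) y) n" "0 \<le> n" "n < tower k (letter_of y)"
    using renorm_cover[OF x] by metis
  obtain y0 n0 where y0: "y0 \<in> {0..<1}" "x0 = orb ((renorm ^^ k) y0) n0"
    using renorm_cover[OF x0] by metis
  obtain j where j: "letter_of (orb y0 j) = letter_of y"
    using visits_all[OF y0(1)] unfolding visits_def by blast
  define y' where "y' = orb y0 j"
  have y': "y' \<in> {0..<1}" "letter_of y' = letter_of y"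
    using y0 j by (auto simp: y'_def simp del: atLeastLessThan_iff)
  define q where "q = orb ((renorm ^^ k) y') n"
  have "q = orb x0 (- n0 + (clock k y0 j + n))"
    unfolding q_def y'_def orb_renorm_pow[OF y0(1), symmetric] y0(2)
    by (simp flip: orb_add)
  moreover have "q \<in> {u<..<v}"
  proof -
    have "itin ((renorm ^^ k) y) (nat n) = itin ((renorm ^^ k) y') (nat n)"
      using itin_renorm_pow[OF y(1), of k] itin_renorm_pow[OF y'(1), of k] y' y(3,4)
        itin_take[of "nat n" "length (subst_pow k (letter_of y))"]
      by (metis nat_int nat_le_eq_zle less_imp_le of_nat_0_le_iff)
    from orb_diff_itin[OF _ _ this] obtain m :: int where
      m: "x - q = (renorm ^^ k) y - (renorm ^^ k) y' + of_int m"
      using y y' by (auto simp: q_def simp del: atLeastLessThan_iff)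
    define e where "e = \<alpha> ^ k * (y - y')"
    have "\<bar>y - y'\<bar> \<le> 1" using y y' by auto
    then have "\<bar>e\<bar> \<le> \<alpha> ^ k"
      using ay_alpha_pos by (simp add: e_def abs_mult mult_left_le)
    then have e: "\<bar>e\<bar> < (v - u) / 2" using k by simp
    have eq: "x - q = e + of_int m"
      using m renorm_pow_diff[OF y(1) y'(1)] y' by (simp add: e_def)
    have "q \<in> {0..<1}" using y' by (simp add: q_def del: atLeastLessThan_iff)
    \<comment> \<open>As x is the midpoint of a subinterval of [0, 1] and e is less than half its
      length, no integer other than 0 keeps q in [0, 1).\<close>
    moreover have "0 < x - e" "x - e < 1" using e uv by (auto simp: x_def abs_if field_simps split: if_splits)
    ultimately have "\<bar>real_of_int m\<bar> < 1" using eq by auto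
    then have "m = 0" by linarith
    then have "q = x - e" using eq by simp
    then show ?thesis using e by (auto simp: x_def abs_if field_simps split: if_splits)
  qed
  ultimately show ?thesis by auto
qed

text \<open>A periodic orbit would be finite and would miss the interval between 0 and its least
  positive point, contradicting density.\<close>

lemma orb_aperiodic:
  assumes x: "x \<in> {0..<1}" and eq: "orb x m = orb x n"
  shows "m = n"
proof (rule ccontr)
  assume "m \<noteq> n"
  define p where "p = \<bar>m - n\<bar>"
  have "0 < p" using \<open>m \<noteq> n\<close> by (simp add: p_def)
  have "orb (orb x (min m n)) p = orb x (max m n)"
    unfolding p_def by (simp flip: orb_add) (simp add: min_def max_def)
  then have per: "orb (orb x (min m n)) p = orb x (min m n)"
    using eq by (simp add: min_def max_def split: if_splits)
  define y where "y = orb x (min m n)"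
  have y: "y \<in> {0..<1}" using x by (simp add: y_def del: atLeastLessThan_iff)
  have per': "orb y (p * k) = y" for k
  proof (induction k rule: int_induct[of _ 0])
    case (step1 i)
    then show ?case using per by (simp add: distrib_left orb_add y_def)
  next
    case (step2 i)
    have "orb (orb y (p * (i - 1))) p = orb y p"
      using step2 per by (simp add: algebra_simps y_def flip: orb_add)
    then show ?case using orb_inj by blast
  qed simp
  have "orb y i \<in> orb y ` {0..<p}" for i
  proof (rule image_eqI)
    show "orb y i = orb y (i mod p)"
      using per'[of "i div p"] orb_add[of y "p * (i div p)" "i mod p"] by simp
  qed (use \<open>0 < p\<close> in auto)
  then have fin: "finite (range (orb y))" by (meson finite_atLeastLessThan_int finite_imageI finite_subset image_subsetI)
  define v where "v = Min (insert 1 {s \<in> range (orb y). 0 < s})"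
  have "v \<in> insert 1 {s \<in> range (orb y). 0 < s}"
    unfolding v_def using fin by (intro Min_in) auto
  then have "0 < v" by auto
  have "v \<le> 1" unfolding v_def using fin by (intro Min_le) auto
  obtain i where "orb y i \<in> {0<..<v}" using orb_dense[OF y _ \<open>0 < v\<close> \<open>v \<le> 1\<close>] by auto
  moreover from this have "v \<le> orb y i" unfolding v_def using fin by (intro Min_le) auto
  ultimately show False by simp
qed

section \<open>The integer cocycle\<close>

text \<open>
  The coordinates, in the basis \<open>1, \<beta>, \<beta>\<^sup>2\<close>, of the eigenvector whose entry at \<^const>\<open>L8\<close> is \<open>1\<close>.
\<close>

primrec vec3 :: "letter \<Rightarrow> int \<times> int \<times> int" where
  "vec3 L1 = (-1, -1, -1)"
| "vec3 L2 = (0, 1, 0)"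
| "vec3 L3 = (0, 1, 0)"
| "vec3 L4 = (1, 1, 1)"
| "vec3 L5 = (-1, -1, 0)"
| "vec3 L6 = (-1, -1, 0)"
| "vec3 L7 = (2, 1, 1)"
| "vec3 L8 = (1, 0, 0)"
| "vec3 L9 = (1, 0, 0)"

text \<open>The ring is arbitrary so that one integer vector can be evaluated both at
  \<open>\<beta>\<close> and at its conjugate \<open>\<alpha>\<close>.\<close>

definition eval3 :: "'a::comm_ring_1 \<Rightarrow> int \<times> int \<times> int \<Rightarrow> 'a" where
  "eval3 b v = of_int (fst v) + of_int (fst (snd v)) * b + of_int (snd (snd v)) * b^2"

lemma eval3_add: "eval3 b (u + v) = eval3 b u + eval3 b v"
  by (simp add: eval3_def algebra_simps)

lemma eval3_diff: "eval3 b (u - v) = eval3 b u - eval3 b v"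
  by (simp add: eval3_def algebra_simps)

text \<open>
  The solution of \<open>theta (renorm x) = \<alpha> * theta x\<close> that is a translation on each piece.
\<close>

definition theta :: "real \<Rightarrow> real" where
  "theta x = x + (if x < letter_hi L1 then 1 / 2 - \<alpha> else if x < letter_hi L3 then 1 / 2 - \<alpha> - \<alpha>^2
     else if x < letter_hi L6 then - 1 / 2 else - 1 / 2 - \<alpha>)"

text \<open>The first and the last interval share a number: their translations differ by 1, so
  \<open>theta\<close> is still injective on their union.\<close>

definition theta_piece :: "real \<Rightarrow> nat" where
  "theta_piece x = (if x < letter_hi L1 then 0 else if x < letter_hi L3 then 1
     else if x < letter_hi L6 then 2 else 0)"

text \<open>Both sides are compared letter by letter in the basis 1, \<alpha>, \<alpha>^2. The
  factor (\<alpha> - \<alpha>^2)/2 is the increment of \<open>theta\<close> on \<open>L8\<close>,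
  where the integer vector is 1.\<close>

lemma theta_T:
  assumes "x \<in> {0..<1}"
  shows "theta (T x) - theta x = (\<alpha> - \<alpha>^2) / 2 * eval3 \<alpha> (vec3 (letter_of x))"
proof -
  have q4: "\<alpha>^2 * \<alpha>^2 = 2 * \<alpha> - 1"
  proof -
    have "\<alpha>^2 * \<alpha>^2 = \<alpha> * (\<alpha> * \<alpha>^2)" by (simp add: power2_eq_square)
    then show ?thesis by (simp add: ay_alpha_mult ring_distribs)
  qed
  have k: "(\<alpha> / 2 - \<alpha>^2 / 2) * eval3 \<alpha> (l, m, n)
      = of_int l * (\<alpha> / 2 - \<alpha>^2 / 2) + of_int m * (\<alpha>^2 + \<alpha> / 2 - 1 / 2) + of_int n * (1 - 3 / 2 * \<alpha> - \<alpha>^2 / 2)" for l m n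
  proof -
    have "(\<alpha> / 2 - \<alpha>^2 / 2) * eval3 \<alpha> (l, m, n) = of_int l * ((\<alpha> - \<alpha>^2) / 2)
        + of_int m * ((\<alpha> * \<alpha> - \<alpha>^2 * \<alpha>) / 2) + of_int n * ((\<alpha> * \<alpha>^2 - \<alpha>^2 * \<alpha>^2) / 2)"
      by (simp add: eval3_def field_simps)
    also have "(\<alpha> * \<alpha> - \<alpha>^2 * \<alpha>) / 2 = \<alpha>^2 + \<alpha> / 2 - 1 / 2"
      unfolding ay_alpha_mult by simp
    also have "(\<alpha> * \<alpha>^2 - \<alpha>^2 * \<alpha>^2) / 2 = 1 - 3 / 2 * \<alpha> - \<alpha>^2 / 2"
      unfolding ay_alpha_mult q4 by (simp add: field_simps)
    finally show ?thesis by (simp add: diff_divide_distrib)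
  qed
  have "theta (T x) = T x + (case letter_of x of L1 \<Rightarrow> - 1 / 2 - \<alpha>
      | L2 \<Rightarrow> if (1 - \<alpha>) / 2 \<le> x then 1 / 2 - \<alpha> else - 1 / 2 - \<alpha>
      | L5 \<Rightarrow> 1 / 2 - \<alpha> - \<alpha>^2 | L9 \<Rightarrow> 1 / 2 - \<alpha> - \<alpha>^2
      | L6 \<Rightarrow> 1 / 2 - \<alpha> | L7 \<Rightarrow> 1 / 2 - \<alpha> | _ \<Rightarrow> - 1 / 2)"
    using letter_of_bounds[OF assms] ay_alpha_bounds
    unfolding T_eq_shift[OF letter_of_bounds[OF assms]] theta_def
    by (cases "letter_of x") (auto simp: field_simps)
  moreover have "theta x = x + (case letter_of x of L1 \<Rightarrow> 1 / 2 - \<alpha> | L2 \<Rightarrow> 1 / 2 - \<alpha> - \<alpha>^2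
      | L3 \<Rightarrow> 1 / 2 - \<alpha> - \<alpha>^2 | L4 \<Rightarrow> - 1 / 2 | L5 \<Rightarrow> - 1 / 2 | L6 \<Rightarrow> - 1 / 2 | _ \<Rightarrow> - 1 / 2 - \<alpha>)"
    using letter_of_bounds[OF assms] ay_alpha_bounds unfolding theta_def
    by (cases "letter_of x") (auto simp: field_simps)
  moreover note T_eq_shift[OF letter_of_bounds[OF assms]]
  moreover have "eval3 \<alpha> (1, 0, 0) = 1" by (simp add: eval3_def)
  ultimately show ?thesis
    by (cases "letter_of x") (simp_all add: k add_divide_distrib diff_divide_distrib)
qed

lemma theta_bounded:
  assumes "x \<in> {0..<1}"
  shows "\<bar>theta x\<bar> \<le> 2"
  using assms ay_alpha_bounds by (auto simp: theta_def abs_if)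

lemma theta_inj:
  assumes "x \<in> {0..<1}" "y \<in> {0..<1}" "theta x = theta y" "theta_piece x = theta_piece y"
  shows "x = y"
  using assms ay_alpha_bounds by (auto simp: theta_def theta_piece_def split: if_splits)

lemma theta_cocycle:
  assumes "x \<in> {0..<1}"
  shows "theta (orb x n) - theta x = (\<alpha> - \<alpha>^2) / 2 * eval3 \<alpha> (cocycle vec3 x n)"
proof (induction n rule: int_induct[of _ 0])
  case base
  show ?case by (simp add: eval3_def)
next
  case (step1 i)
  have "orb x i \<in> {0..<1}" using assms by (intro orb_mem)
  from theta_T[OF this] step1 show ?case
    by (simp add: orb_succ cocycle_succ eval3_add distrib_left)
next
  case (step2 i)
  have "orb x (i - 1) \<in> {0..<1}" using assms by (intro orb_mem)
  from theta_T[OF this] step2 show ?case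
    by (simp add: orb_succ[symmetric] cocycle_pred eval3_diff right_diff_distrib)
qed

text \<open>Two values of \<open>theta\<close> differ by at most 4, and the factor in
  \<open>theta_cocycle\<close> is at least 1/10.\<close>

lemma eval3_alpha_bounded:
  assumes "x \<in> {0..<1}"
  shows "\<bar>eval3 \<alpha> (cocycle vec3 x n)\<bar> \<le> 40"
proof -
  have "orb x n \<in> {0..<1}" using assms by (intro orb_mem)
  then have "\<bar>(\<alpha> - \<alpha>^2) / 2 * eval3 \<alpha> (cocycle vec3 x n)\<bar> \<le> 4"
    using theta_cocycle[OF assms, of n] theta_bounded[OF assms] theta_bounded[of "orb x n"] by linarith
  moreover have "1 / 10 \<le> (\<alpha> - \<alpha>^2) / 2" using ay_alpha_bounds by simp
  then have "1 / 10 * \<bar>eval3 \<alpha> (cocycle vec3 x n)\<bar> \<le> (\<alpha> - \<alpha>^2) / 2 * \<bar>eval3 \<alpha> (cocycle vec3 x n)\<bar>"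
    by (rule mult_right_mono) simp
  ultimately show ?thesis
    using \<open>1 / 10 \<le> (\<alpha> - \<alpha>^2) / 2\<close> by (simp add: abs_mult)
qed

lemma cocycle_vec3_inj:
  assumes "x \<in> {0..<1}" "cocycle vec3 x m = cocycle vec3 x n"
    "theta_piece (orb x m) = theta_piece (orb x n)"
  shows "m = n"
proof (rule orb_aperiodic[OF assms(1)], rule theta_inj)
  show "theta (orb x m) = theta (orb x n)"
    using theta_cocycle[OF assms(1), of m] theta_cocycle[OF assms(1), of n] assms(2) by simp
qed (use assms in \<open>simp_all del: atLeastLessThan_iff\<close>)

section \<open>The expanding eigenvalue\<close>

text \<open>Division by x - \<alpha> leaves x^2 + (1 + \<alpha>) x + 1/\<alpha>, whose coefficients
  give the trace and the norm of a pair of conjugate roots.\<close>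

lemma nonreal_cubic_root:
  fixes w :: complex
  assumes "w^3 = 1 - w - w^2" "Im w \<noteq> 0"
  shows "Re w = - (1 + \<alpha>) / 2" "(norm w)^2 = 1 / \<alpha>"
proof -
  have "(w - of_real \<alpha>) * (w^2 + of_real (1 + \<alpha>) * w + of_real (1 / \<alpha>)) = 0"
  proof -
    have ia: "1 / \<alpha> = 1 + \<alpha> + \<alpha>^2"
      using ay_alpha_pos ay_alpha_cubic by (simp add: field_simps power2_eq_square power3_eq_cube)
    have "(of_real \<alpha> :: complex)^3 = 1 - of_real \<alpha> - of_real \<alpha>^2"
      using arg_cong[OF ay_alpha_cube, of complex_of_real] by simp
    then show ?thesis
      unfolding ia using assms(1) by (simp add: algebra_simps power2_eq_square power3_eq_cube)
  qed
  moreover have "w \<noteq> of_real \<alpha>" using assms(2) by auto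
  ultimately have q: "w^2 + of_real (1 + \<alpha>) * w + of_real (1 / \<alpha>) = 0" by simp
  from arg_cong[OF q, of Im] have "Im w * (2 * Re w + (1 + \<alpha>)) = 0"
    by (simp add: power2_eq_square algebra_simps)
  then show re: "Re w = - (1 + \<alpha>) / 2" using assms(2) by simp
  from arg_cong[OF q, of Re] have "(Re w)^2 - (Im w)^2 + (1 + \<alpha>) * Re w + 1 / \<alpha> = 0"
    by (simp add: power2_eq_square algebra_simps)
  moreover have "(1 + \<alpha>) * Re w = - 2 * (Re w)^2"
    unfolding re by (simp add: power2_eq_square field_simps)
  ultimately show "(norm w)^2 = 1 / \<alpha>"
    by (simp add: cmod_power2)
qed

lemma sum_letter: "(\<Sum>a\<in>UNIV. g a) = g L1 + g L2 + g L3 + g L4 + g L5 + g L6 + g L7 + g L8 + g L9"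
  by (simp add: UNIV_letter add.assoc)

text \<open>Expressing the entries through those at \<open>L8\<close> and \<open>L5\<close> leaves
  two equations for the latter. Eliminating it shows that a product of two cubics vanishes at
  \<open>\<beta>\<close>, and the bound on \<open>norm \<beta>\<close> selects the factor.\<close>

lemma eigenvector_form:
  assumes ev: "eigenvector ay_matrix \<beta> \<gamma>" and nr: "\<beta> \<notin> \<real>" and exp: "norm \<beta> > 1"
  shows "\<beta>^3 = 1 - \<beta> - \<beta>^2" and "\<gamma> $ a = \<gamma> $ L8 * eval3 \<beta> (vec3 a)"
proof -
  have im: "Im \<beta> \<noteq> 0" using nr by (simp add: complex_is_Real_iff)
  have b0: "\<beta> \<noteq> 0" using exp by auto
  have comp: "(ay_matrix *v \<gamma>) $ c = \<beta> * \<gamma> $ c" for c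
    using ev by (simp add: eigenvector_def vector_scalar_mult_def)
  have row: "\<beta> * \<gamma> $ c = (\<Sum>d\<in>UNIV. of_nat (count_list (ay_subst c) d) * \<gamma> $ d)" for c
    using comp[of c] by (simp add: matrix_vector_mult_def ay_matrix_def)
  note r = row[unfolded sum_letter]
  define s where "s = \<gamma> $ L8"
  have r1: "\<beta> * \<gamma> $ L1 = \<gamma> $ L3 + \<gamma> $ L5" and r2: "\<beta> * \<gamma> $ L2 = \<gamma> $ L4 + \<gamma> $ L5"
    and r3: "\<beta> * \<gamma> $ L3 = \<gamma> $ L4 + \<gamma> $ L6" and r4: "\<beta> * \<gamma> $ L4 = \<gamma> $ L1 + \<gamma> $ L7"
    and r5: "\<beta> * \<gamma> $ L5 = \<gamma> $ L1 + s" and r6: "\<beta> * \<gamma> $ L6 = \<gamma> $ L1 + \<gamma> $ L9"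
    and r7: "\<beta> * \<gamma> $ L7 = \<gamma> $ L2 + \<gamma> $ L9" and r8: "\<beta> * s = \<gamma> $ L2"
    and r9: "\<beta> * \<gamma> $ L9 = \<gamma> $ L3"
    using r[of L1] r[of L2] r[of L3] r[of L4] r[of L5] r[of L6] r[of L7] r[of L8] r[of L9]
    by (simp_all add: s_def)
  have pow1: "\<beta>^n \<noteq> 1" if "n > 0" for n
    using one_less_power[OF exp that] by (metis norm_one norm_power less_irrefl)
  have g9: "\<gamma> $ L9 = s"
  proof -
    \<comment> \<open>The differences within the pairs \<open>L8\<close>/\<open>L9\<close>,
      \<open>L2\<close>/\<open>L3\<close> and \<open>L5\<close>/\<open>L6\<close> are permuted in a
      cycle of length three by the matrix, so they vanish unless \<beta>^3 = 1.\<close>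
    have "\<beta>^3 * (s - \<gamma> $ L9) = \<beta> * (\<gamma> $ L5 - \<gamma> $ L6)"
      using r2 r3 r8 r9 by (simp add: power3_eq_cube algebra_simps)
    also have "\<dots> = s - \<gamma> $ L9" using r5 r6 by (simp add: algebra_simps)
    finally have "(\<beta>^3 - 1) * (s - \<gamma> $ L9) = 0" by (simp add: algebra_simps)
    then show ?thesis using pow1[of 3] by simp
  qed
  have g23: "\<gamma> $ L2 = \<beta> * s" "\<gamma> $ L3 = \<beta> * s" using r8 r9 g9 by simp_all
  have g4: "\<gamma> $ L4 = \<beta>^2 * s - \<gamma> $ L5" using r2 g23 by (simp add: power2_eq_square algebra_simps)
  have g6: "\<gamma> $ L6 = \<gamma> $ L5" using r3 g4 g23 by (simp add: power2_eq_square algebra_simps)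
  have g7: "\<beta> * \<gamma> $ L7 = (\<beta> + 1) * s" using r7 g23 g9 by (simp add: algebra_simps)
  have g1: "\<gamma> $ L1 = \<beta> * \<gamma> $ L5 - s" using r5 by simp
  have g5: "(\<beta>^2 - 1) * \<gamma> $ L5 = 2 * \<beta> * s"
    using r1 unfolding g1 g23 by (simp add: power2_eq_square algebra_simps)
  have "\<beta> * (\<beta> * \<gamma> $ L4) = \<beta> * \<gamma> $ L1 + \<beta> * \<gamma> $ L7" using r4 by (simp add: algebra_simps)
  then have g5': "2 * \<beta>^2 * \<gamma> $ L5 = \<beta>^4 * s - s"
    unfolding g4 g1 g7 by (simp add: algebra_simps power2_eq_square power4_eq_xxxx)
  have s0: "s \<noteq> 0"
  proof
    assume "s = 0"
    then have "\<gamma> $ L5 = 0" using g5 pow1[of 2] by auto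
    then have "\<gamma> $ c = 0" for c
      using g1 g23 g4 g6 g7 g9 \<open>s = 0\<close> b0 by (cases c) (auto simp: s_def)
    then have "\<gamma> = 0" by (simp add: vec_eq_iff)
    then show False using ev by (simp add: eigenvector_def)
  qed
  have "(\<beta>^3 + \<beta>^2 + \<beta> - 1) * (\<beta>^3 - \<beta>^2 - \<beta> - 1) * s = (\<beta>^4 * s - s) * (\<beta>^2 - 1) - 4 * \<beta>^3 * s"
    by (simp add: algebra_simps power2_eq_square power3_eq_cube power4_eq_xxxx)
  also have "\<dots> = 2 * \<beta>^2 * ((\<beta>^2 - 1) * \<gamma> $ L5) - 4 * \<beta>^3 * s"
    unfolding g5'[symmetric] by (simp add: algebra_simps)
  also have "\<dots> = 0" unfolding g5 by (simp add: algebra_simps power2_eq_square power3_eq_cube)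
  finally have "\<beta>^3 + \<beta>^2 + \<beta> - 1 = 0 \<or> \<beta>^3 - \<beta>^2 - \<beta> - 1 = 0" using s0 by simp
  \<comment> \<open>Up to sign this is the reciprocal polynomial of the other factor. Its non-real
    roots are inverses of numbers of modulus greater than 1, hence lie inside the unit disc.\<close>
  moreover have "\<beta>^3 - \<beta>^2 - \<beta> - 1 \<noteq> 0"
  proof
    assume *: "\<beta>^3 - \<beta>^2 - \<beta> - 1 = 0"
    define w where "w = inverse \<beta>"
    have "\<beta>^3 * (w^3 + w^2 + w - 1) = - (\<beta>^3 - \<beta>^2 - \<beta> - 1)"
      using b0 by (simp add: w_def field_simps power2_eq_square power3_eq_cube)
    then have "w^3 + w^2 + w - 1 = 0" using * b0 by simp
    then have "w^3 = 1 - w - w^2" by (simp add: algebra_simps)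
    moreover have "Im w \<noteq> 0" using im b0 by (simp add: w_def)
    ultimately have "(norm w)^2 = 1 / \<alpha>" by (rule nonreal_cubic_root)
    moreover have "norm w < 1" using exp by (simp add: w_def norm_inverse inverse_less_1_iff)
    then have "(norm w)^2 < 1" by (simp add: power_less_one_iff abs_square_less_1)
    moreover have "1 < 1 / \<alpha>" using ay_alpha_pos ay_alpha_less_1 by simp
    ultimately show False by simp
  qed
  ultimately show cubic: "\<beta>^3 = 1 - \<beta> - \<beta>^2" by (auto simp: algebra_simps)
  have g5'': "\<gamma> $ L5 = - (1 + \<beta>) * s"
  proof -
    have "(\<beta>^2 - 1) * (- (1 + \<beta>) * s) = (2 * \<beta> + (1 - \<beta> - \<beta>^2 - \<beta>^3)) * s"
      by (simp add: algebra_simps power2_eq_square power3_eq_cube)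
    also have "\<dots> = (\<beta>^2 - 1) * \<gamma> $ L5" unfolding g5 cubic by simp
    finally show ?thesis using pow1[of 2] by simp
  qed
  have "\<beta> * \<gamma> $ L7 = \<beta> * ((2 + \<beta> + \<beta>^2) * s)"
  proof -
    have "\<beta> * (2 + \<beta> + \<beta>^2) = \<beta> + 1"
      using cubic by (simp add: algebra_simps power2_eq_square power3_eq_cube)
    then show ?thesis unfolding g7 by (simp flip: mult.assoc)
  qed
  then have g7': "\<gamma> $ L7 = (2 + \<beta> + \<beta>^2) * s" using b0 by simp
  have g1': "\<gamma> $ L1 = (- 1 - \<beta> - \<beta>^2) * s"
    unfolding g1 g5'' by (simp add: algebra_simps power2_eq_square)
  show "\<gamma> $ a = \<gamma> $ L8 * eval3 \<beta> (vec3 a)"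
    using g1' g23 g4 g5'' g6 g7' g9 unfolding s_def[symmetric]
    by (cases a) (simp_all add: eval3_def s_def[symmetric] algebra_simps power2_eq_square)
qed

locale expanding_eigenvalue =
  fixes \<beta> :: complex
  assumes cubic: "\<beta>^3 = 1 - \<beta> - \<beta>^2" and nonreal: "Im \<beta> \<noteq> 0" and nonreal3: "Im (\<beta>^3) \<noteq> 0"
begin

lemma norm_beta: "(norm \<beta>)^2 = 1 / \<alpha>" "norm \<beta> > 1"
proof -
  show *: "(norm \<beta>)^2 = 1 / \<alpha>" using nonreal_cubic_root cubic nonreal by blast
  have "1 < 1 / \<alpha>" using ay_alpha_pos ay_alpha_less_1 by simp
  then have "1^2 < (norm \<beta>)^2" by (simp add: *)
  then show "norm \<beta> > 1" by (rule power_less_imp_less_base) simp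
qed

lemma beta_nz [simp]: "\<beta> \<noteq> 0"
  using nonreal by auto

definition step :: "letter \<Rightarrow> complex" where
  "step a = eval3 \<beta> (vec3 a)"

text \<open>Defined through the integer vector and not as a sum of complex steps, so that the vector
  remains available for evaluation at \<open>\<alpha>\<close>.\<close>

definition S :: "real \<Rightarrow> int \<Rightarrow> complex" where
  "S x n = eval3 \<beta> (cocycle vec3 x n)"

lemma S_cocycle: "S x n = cocycle step x n"
  unfolding S_def step_def using cocycle_hom[of "eval3 \<beta>" vec3] eval3_add by metis

lemma S_0 [simp]: "S x 0 = 0"
  by (simp add: S_cocycle)

lemma S_add: "S x (m + n) = S x m + S (orb x m) n"
  by (simp add: S_cocycle cocycle_add)

lemma S_1: "S x 1 = step (letter_of x)"
  by (simp add: S_cocycle)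

lemma sum_step_subst_pow: "sum_list (map step (subst_pow k a)) = \<beta>^k * step a"
proof (induction k arbitrary: a)
  case (Suc k)
  have "sum_list (map step (ay_subst a)) = \<beta> * step a" for a
    using cubic by (cases a) (simp_all add: step_def eval3_def algebra_simps power2_eq_square power3_eq_cube)
  moreover have "sum_list (map step (concat (map (subst_pow k) l))) = \<beta>^k * sum_list (map step l)" for l
    by (induction l) (simp_all add: Suc.IH distrib_left)
  ultimately show ?case by simp
qed simp

lemma S_renorm_pow:
  assumes "y \<in> {0..<1}"
  shows "S ((renorm ^^ k) y) (clock k y j) = \<beta>^k * S y j"
  unfolding S_cocycle cocycle_renorm_pow[OF assms] sum_step_subst_pow
  using cocycle_hom[of "\<lambda>z. \<beta>^k * z" step] by (simp add: distrib_left)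

text \<open>Sums over proper prefixes, the empty one included: the heights of the floors of a
  level-k tower relative to its base.\<close>

definition block :: "nat \<Rightarrow> letter \<Rightarrow> complex set" where
  "block k a = (\<lambda>i. sum_list (map step (take i (subst_pow k a)))) ` {..<length (subst_pow k a)}"

lemma finite_block [simp]: "finite (block k a)"
  by (simp add: block_def)

lemma S_block:
  assumes "y \<in> {0..<1}" "i < length (subst_pow k (letter_of y))"
  shows "S ((renorm ^^ k) y) (int i) = sum_list (map step (take i (subst_pow k (letter_of y))))"
  using itin_renorm_pow[OF assms(1), of k] assms(2)
    itin_take[of i "length (subst_pow k (letter_of y))" "(renorm ^^ k) y"]
  by (simp add: S_cocycle cocycle_itin)

lemma S_in_block:
  assumes "y \<in> {0..<1}"
  obtains j p where "p \<in> block k (letter_of (orb y j))" "S ((renorm ^^ k) y) n = \<beta>^k * S y j + p"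
    "clock k y j \<le> n" "n < clock k y (j + 1)"
proof -
  obtain j where j: "clock k y j \<le> n" "n < clock k y (j + 1)"
    by (rule cocycle_bracket[where \<phi> = "tower k" and x = y and n = n]) (rule tower_pos)
  define i where "i = nat (n - clock k y j)"
  have i: "i < length (subst_pow k (letter_of (orb y j)))" "n = clock k y j + int i"
    using j by (auto simp: i_def cocycle_succ)
  have yj: "orb y j \<in> {0..<1}" using assms by (intro orb_mem)
  have "S ((renorm ^^ k) y) n = \<beta>^k * S y j + sum_list (map step (take i (subst_pow k (letter_of (orb y j)))))"
    unfolding i(2) S_add S_renorm_pow[OF assms] orb_renorm_pow[OF assms] S_block[OF yj i(1)] ..
  then show ?thesis using that i(1) j unfolding block_def by blast
qed

lemma block_in_S:
  assumes "y \<in> {0..<1}" "p \<in> block k (letter_of (orb y j))"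
  obtains n where "S ((renorm ^^ k) y) n = \<beta>^k * S y j + p"
proof -
  obtain i where i: "i < length (subst_pow k (letter_of (orb y j)))"
      "p = sum_list (map step (take i (subst_pow k (letter_of (orb y j)))))"
    using assms(2) unfolding block_def by blast
  have yj: "orb y j \<in> {0..<1}" using assms by (intro orb_mem)
  have "S ((renorm ^^ k) y) (clock k y j + int i) = \<beta>^k * S y j + p"
    unfolding i(2) S_add S_renorm_pow[OF assms(1)] orb_renorm_pow[OF assms(1)] S_block[OF yj i(1)] ..
  then show ?thesis by (rule that)
qed

definition step_bound :: real where
  "step_bound = (\<Sum>a\<in>UNIV. norm (step a))"

lemma norm_step_le: "norm (step a) \<le> step_bound"
  unfolding step_bound_def by (rule member_le_sum) auto

lemma step_bound_nonneg: "0 \<le> step_bound"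
  using norm_step_le[of L1] norm_ge_zero order_trans by blast

definition block_bound :: real where
  "block_bound = step_bound / (norm \<beta> - 1)"

lemma block_bound_nonneg: "0 \<le> block_bound"
  using step_bound_nonneg norm_beta(2) by (simp add: block_bound_def)

lemma norm_block_le:
  assumes "p \<in> block k a"
  shows "norm p \<le> block_bound * norm \<beta> ^ k"
proof -
  \<comment> \<open>The induction needs the term - 1: passing a complete first block costs at most
    step_bound * norm \<beta> ^ k, which is exactly the increase of this bound from k to k +
    1.\<close>
  have "norm (sum_list (map step (take i (subst_pow k a)))) \<le> block_bound * (norm \<beta> ^ k - 1)"
    if "i < length (subst_pow k a)" for i
    using that
  proof (induction k arbitrary: a i)
    case (Suc k)
    have mono: "block_bound * (norm \<beta> ^ k - 1) \<le> block_bound * (norm \<beta> ^ Suc k - 1)"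
      using norm_beta(2) block_bound_nonneg by (intro mult_left_mono) auto
    have two: "(\<exists>c d. ay_subst a = [c, d]) \<or> (\<exists>c. ay_subst a = [c])"
      by (cases a) auto
    then obtain c where c: "ay_subst a = [c] \<or> (\<exists>d. ay_subst a = [c, d])" by blast
    show ?case
    proof (cases "i < length (subst_pow k c)")
      case True
      then have "take i (subst_pow (Suc k) a) = take i (subst_pow k c)" using c by auto
      then show ?thesis using order_trans[OF Suc.IH[OF True] mono] by (simp only:)
    next
      case False
      then obtain d where d: "ay_subst a = [c, d]" using c Suc.prems by auto
      define i' where "i' = i - length (subst_pow k c)"
      have i': "i' < length (subst_pow k d)" using Suc.prems False d by (simp add: i'_def)
      have "sum_list (map step (take i (subst_pow (Suc k) a)))
          = \<beta>^k * step c + sum_list (map step (take i' (subst_pow k d)))"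
        using False d by (simp add: i'_def sum_step_subst_pow)
      then have "norm (sum_list (map step (take i (subst_pow (Suc k) a))))
          \<le> norm \<beta> ^ k * norm (step c) + norm (sum_list (map step (take i' (subst_pow k d))))"
        by (metis norm_mult norm_power norm_triangle_ineq)
      also have "\<dots> \<le> norm \<beta> ^ k * step_bound + block_bound * (norm \<beta> ^ k - 1)"
        using norm_step_le[of c] Suc.IH[OF i'] by (intro add_mono mult_left_mono) auto
      also have "\<dots> = block_bound * (norm \<beta> ^ Suc k - 1)"
        using norm_beta(2) by (simp add: block_bound_def field_simps)
      finally show ?thesis .
    qed
  qed simp
  moreover have "block_bound * (norm \<beta> ^ k - 1) \<le> block_bound * norm \<beta> ^ k"
    using norm_beta(2) block_bound_nonneg by (intro mult_left_mono) auto
  ultimately show ?thesis using assms unfolding block_def by force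
qed

definition size3 :: "int \<times> int \<times> int \<Rightarrow> int" where
  "size3 v = max \<bar>fst v\<bar> (max \<bar>fst (snd v)\<bar> \<bar>snd (snd v)\<bar>)"

text \<open>The three coordinates solve a linear system given by the real and imaginary parts of the
  value at \<open>\<beta>\<close> and by the value at \<open>\<alpha>\<close>, which is at most 40.
  The system is invertible because \<open>\<beta>\<close> is not real.\<close>

lemma size3_bounded:
  obtains K where "0 \<le> K" "\<And>x n. x \<in> {0..<1} \<Longrightarrow> real_of_int (size3 (cocycle vec3 x n)) \<le> K * (1 + norm (S x n))"
proof -
  define b where "b = Re \<beta>"
  define c where "c = Im \<beta>"
  define D where "D = (\<alpha> - b)^2 + c^2"
  define Kp where "Kp = (41 + \<bar>\<alpha> - b\<bar> / \<bar>c\<bar>) / D"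
  define Km where "Km = 1 / \<bar>c\<bar> + 2 * \<bar>b\<bar> * Kp"
  have c: "c \<noteq> 0" using nonreal by (simp add: c_def)
  have D: "0 < D" unfolding D_def using c by (simp add: add_nonneg_pos)
  have Kp0: "0 \<le> Kp" using D by (simp add: Kp_def)
  have Km0: "0 \<le> Km" using Kp0 by (simp add: Km_def)
  have bound: "\<bar>l\<bar> \<le> (40 + Km + Kp) * n1 \<and> \<bar>m\<bar> \<le> (40 + Km + Kp) * n1 \<and> \<bar>p\<bar> \<le> (40 + Km + Kp) * n1"
    if s: "Re s = l + m * b + p * (b^2 - c^2)" "Im s = m * c + p * (2 * b * c)"
      and A: "\<bar>l + m * \<alpha> + p * \<alpha>^2\<bar> \<le> 40" and n1: "n1 = 1 + norm s" for l m p n1 :: real and s :: complex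
  proof -
    have n1': "1 \<le> n1" "\<bar>Re s\<bar> \<le> n1" "\<bar>Im s\<bar> \<le> n1"
      using n1 abs_Re_le_cmod[of s] abs_Im_le_cmod[of s] by auto
    define t where "t = m + 2 * b * p"
    have "c * t = Im s" by (simp add: t_def s algebra_simps)
    then have "\<bar>c\<bar> * \<bar>t\<bar> \<le> n1" using n1' by (metis abs_mult)
    then have t: "\<bar>t\<bar> \<le> n1 / \<bar>c\<bar>" using c by (simp add: field_simps)
    \<comment> \<open>D is the squared distance of \<open>\<alpha>\<close> and
      \<open>\<beta>\<close>; it is what remains as coefficient of p after l and m are
      eliminated.\<close>
    have "p * D = (l + m * \<alpha> + p * \<alpha>^2) - Re s - t * (\<alpha> - b)"
      by (simp add: D_def t_def s algebra_simps power2_eq_square)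
    then have "\<bar>p\<bar> * D \<le> 40 + n1 + \<bar>t\<bar> * \<bar>\<alpha> - b\<bar>"
      using A n1' D abs_mult[of p D] abs_mult[of t "\<alpha> - b"] by linarith
    also have "\<dots> \<le> 40 * n1 + n1 + n1 / \<bar>c\<bar> * \<bar>\<alpha> - b\<bar>"
      using n1' t by (intro add_mono mult_right_mono) auto
    also have "\<dots> = Kp * n1 * D"
      using D by (simp add: Kp_def field_simps)
    finally have p: "\<bar>p\<bar> \<le> Kp * n1" using D by simp
    have "\<bar>m\<bar> \<le> \<bar>t\<bar> + 2 * \<bar>b\<bar> * \<bar>p\<bar>"
    proof -
      have "m = t - 2 * b * p" by (simp add: t_def)
      then show ?thesis using abs_triangle_ineq4[of t "2 * b * p"] by (simp add: abs_mult)
    qed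
    also have "\<dots> \<le> n1 / \<bar>c\<bar> + 2 * \<bar>b\<bar> * (Kp * n1)"
      using t p by (intro add_mono mult_left_mono) auto
    also have "\<dots> = Km * n1" by (simp add: Km_def field_simps)
    finally have m: "\<bar>m\<bar> \<le> Km * n1" .
    have "\<bar>m * \<alpha>\<bar> \<le> \<bar>m\<bar>" "\<bar>p * \<alpha>^2\<bar> \<le> \<bar>p\<bar>"
      using ay_alpha_bounds by (simp_all add: abs_mult mult_left_le)
    then have l: "\<bar>l\<bar> \<le> 40 * n1 + Km * n1 + Kp * n1" using A m p n1' by linarith
    have "0 \<le> Km * n1" "0 \<le> Kp * n1" using Km0 Kp0 n1' by auto
    then show ?thesis using l m p n1' by (simp add: distrib_right)
  qed
  have *: "real_of_int (size3 (cocycle vec3 x n)) \<le> (40 + Km + Kp) * (1 + norm (S x n))"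
    if x: "x \<in> {0..<1}" for x n
  proof -
    obtain l m p where v: "cocycle vec3 x n = (l, m, p)" by (rule prod_cases3)
    have "\<bar>real_of_int l + real_of_int m * \<alpha> + real_of_int p * \<alpha>^2\<bar> \<le> 40"
      using eval3_alpha_bounded[OF x, of n] by (simp add: v eval3_def)
    from bound[OF _ _ this refl, of "S x n"] show ?thesis
      unfolding S_def v by (auto simp: eval3_def b_def c_def power2_eq_square size3_def max_def)
  qed
  show ?thesis
    by (rule that[of "40 + Km + Kp"]) (use Km0 Kp0 * in auto)
qed

end

section \<open>Existence of an extremal orbit\<close>

text \<open>Dividing by the growth leaves a rotation v with v \<noteq> 1, whose geometric sums are
  bounded. An upper bound makes the positive parts of Re (w v^m) summable, hence the absolute values
  too. So these real parts tend to 0, and rotating once more so do the imaginary parts, against the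
  constant modulus of w v^m.\<close>

lemma Re_rotation_unbounded:
  fixes u w :: complex
  assumes u: "1 < norm u" "Im u \<noteq> 0" and w: "w \<noteq> 0"
  shows "\<exists>m. C < Re (w * u ^ m)"
proof (rule ccontr)
  assume "\<not> ?thesis"
  then have le: "Re (w * u ^ m) \<le> max C 0" for m by (auto simp: not_less intro: order_trans)
  define r where "r = 1 / norm u"
  define v where "v = u * of_real r"
  have "0 < norm u" using u by linarith
  then have r: "0 < r" "r < 1" using u by (simp_all add: r_def)
  have v: "norm v = 1" "Im v \<noteq> 0" using u r by (auto simp: v_def r_def norm_mult norm_divide)
  then have v1: "v \<noteq> 1" by auto
  define y where "y m = Re (w * v ^ m)" for m
  have y_eq: "y m = r ^ m * Re (w * u ^ m)" for m
  proof -
    have "w * v ^ m = of_real (r ^ m) * (w * u ^ m)" by (simp add: v_def power_mult_distrib)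
    then show ?thesis unfolding y_def by (simp only: scaleR_conv_of_real[symmetric] scaleR_complex.sel)
  qed
  have y_le: "y m \<le> max C 0 * r ^ m" for m
    unfolding y_eq using le[of m] r by (simp add: mult.commute mult_left_mono)
  have abs_y: "\<bar>y m\<bar> \<le> 2 * (max C 0 * r ^ m) - y m" for m
    using y_le[of m] r by (cases "0 \<le> y m") (auto intro: order_trans)
  have "summable (\<lambda>m. \<bar>y m\<bar>)"
  proof (rule summableI_nonneg_bounded)
    fix n
    have "(\<Sum>m<n. \<bar>y m\<bar>) \<le> (\<Sum>m<n. 2 * (max C 0 * r ^ m) - y m)"
      by (intro sum_mono abs_y)
    also have "\<dots> = 2 * max C 0 * (\<Sum>m<n. r ^ m) - Re (w * (\<Sum>m<n. v ^ m))"
      by (simp add: sum_subtractf sum_distrib_left y_def mult.assoc)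
    also have "\<dots> \<le> 2 * max C 0 * (1 / (1 - r)) + norm w * (2 / norm (v - 1))"
    proof -
      have "(\<Sum>m<n. r ^ m) = (1 - r ^ n) / (1 - r)" using r by (simp add: sum_gp_strict)
      also have "\<dots> \<le> 1 / (1 - r)" using r by (intro divide_right_mono) auto
      finally have 1: "2 * max C 0 * (\<Sum>m<n. r ^ m) \<le> 2 * max C 0 * (1 / (1 - r))"
        by (intro mult_left_mono) auto
      have "norm (\<Sum>m<n. v ^ m) = norm (v ^ n - 1) / norm (v - 1)"
        using v1 by (simp add: geometric_sum norm_divide)
      also have "\<dots> \<le> 2 / norm (v - 1)"
        using norm_triangle_ineq4[of "v ^ n" 1] v by (intro divide_right_mono) (auto simp: norm_power)
      finally have "norm (w * (\<Sum>m<n. v ^ m)) \<le> norm w * (2 / norm (v - 1))"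
        unfolding norm_mult by (rule mult_left_mono) simp
      then show ?thesis using 1 abs_Re_le_cmod[of "w * (\<Sum>m<n. v ^ m)"] by linarith
    qed
    finally show "(\<Sum>m<n. \<bar>y m\<bar>) \<le> 2 * max C 0 * (1 / (1 - r)) + norm w * (2 / norm (v - 1))" .
  qed simp
  then have "(\<lambda>m. \<bar>y m\<bar>) \<longlonglongrightarrow> 0" by (rule summable_LIMSEQ_zero)
  then have y0: "y \<longlonglongrightarrow> 0" by (rule tendsto_rabs_zero_cancel)
  have "Im (w * v ^ m) = (y m * Re v - y (Suc m)) / Im v" for m
  proof -
    have "w * v ^ Suc m = (w * v ^ m) * v" by simp
    then have "y (Suc m) = y m * Re v - Im (w * v ^ m) * Im v"
      unfolding y_def by (simp only: times_complex.sel)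
    then show ?thesis using v by (simp add: field_simps)
  qed
  moreover have "(\<lambda>m. (y m * Re v - y (Suc m)) / Im v) \<longlonglongrightarrow> (0 * Re v - 0) / Im v"
    using v by (intro tendsto_intros y0 LIMSEQ_Suc[OF y0])
  ultimately have im: "(\<lambda>m. Im (w * v ^ m)) \<longlonglongrightarrow> 0" by simp
  have "(\<lambda>m. (y m)^2 + (Im (w * v ^ m))^2) \<longlonglongrightarrow> 0^2 + 0^2"
    by (intro tendsto_intros y0 im)
  moreover have "(y m)^2 + (Im (w * v ^ m))^2 = (norm w)^2" for m
    unfolding y_def cmod_power2[symmetric] using v by (simp add: norm_mult norm_power)
  ultimately have "(norm w)^2 = 0" by (simp add: LIMSEQ_const_iff)
  then show False using w by simp
qed

section \<open>Letters and cocycles along one-sided germs\<close>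

lemma letter_of_germ_right:
  assumes "x \<in> {0..<1}"
  shows "\<forall>\<^sub>0s. letter_of (x + s) = letter_of x"
  using right0_less(1)[of x "letter_hi (letter_of x)"] eventually_at_right_less[of 0]
  by eventually_elim (use letter_of_bounds[OF assms] in \<open>auto intro!: letter_of_eq\<close>)

lemma letter_left_exists:
  assumes "x \<in> {0<..1}"
  shows "\<exists>a. letter_lo a < x \<and> x \<le> letter_hi a"
proof (rule ccontr)
  assume "\<not> ?thesis"
  then have "\<not> (letter_lo a < x \<and> x \<le> letter_hi a)" for a by blast
  from this[of L1] this[of L2] this[of L3] this[of L4] this[of L5] this[of L6] this[of L7] this[of L8]
    this[of L9] assms show False by simp
qed

lemma letter_of_germ_left:
  assumes "letter_lo a < x" "x \<le> letter_hi a"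
  shows "\<forall>\<^sub>0s. letter_of (x - s) = a"
  using right0_less(2)[of x "letter_lo a"] eventually_at_right_less[of 0]
  by eventually_elim (use assms in \<open>auto intro!: letter_of_eq simp: not_less\<close>)

lemma ev_letter:
  fixes n :: int
  assumes "\<And>i. \<forall>\<^sub>F s in F. letter_of (orb (g s) i) = l i"
  shows "\<forall>\<^sub>F s in F. \<forall>i\<in>{0..<n} \<union> {n..<0}. letter_of (orb (g s) i) = l i"
  using assms by (intro eventually_ball_finite) auto

lemma cocycle_const:
  assumes "\<And>i. \<forall>\<^sub>F s in F. letter_of (orb (g s) i) = l i"
  shows "\<exists>c. \<forall>\<^sub>F s in F. cocycle \<phi> (g s) n = c"
proof -
  have "\<forall>\<^sub>F s in F. cocycle \<phi> (g s) n =
      (if 0 \<le> n then \<Sum>i\<in>{0..<n}. \<phi> (l i) else - (\<Sum>i\<in>{n..<0}. \<phi> (l i)))"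
    using ev_letter[OF assms, of n] by eventually_elim (simp add: cocycle_def)
  then show ?thesis by blast
qed

lemma cocycle_germ_right:
  assumes x: "x \<in> {0..<1}"
  shows "\<forall>\<^sub>0s. cocycle \<phi> (x + s) n = cocycle \<phi> x n"
proof -
  have ev: "\<forall>\<^sub>0s. letter_of (orb (x + s) i) = letter_of (orb x i)" for i
  proof -
    have "orb x i \<in> {0..<1}" using x by (intro orb_mem)
    from letter_of_germ_right[OF this] germ_orb(1)[of i, unfolded germ_right_def, rule_format, of x]
    show ?thesis by eventually_elim simp
  qed
  show ?thesis using ev_letter[OF ev, of n] by eventually_elim (simp add: cocycle_def)
qed

lemma germ_left_orb:
  assumes "x \<in> {0<..1}"
  obtains c a where "\<forall>\<^sub>0s. orb (x - s) n = c - s" "letter_lo a < c" "c \<le> letter_hi a"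
    "\<forall>\<^sub>0s. letter_of (orb (x - s) n) = a"
proof -
  obtain c where c: "\<forall>\<^sub>0s. orb (x - s) n = c - s"
    using germ_orb(2)[of n] unfolding germ_left_def by blast
  have "\<forall>\<^sub>0s. x - s \<in> {0..<1}"
    using assms by (intro eventually_at_rightI[of 0 x]) auto
  then have unit: "\<forall>\<^sub>0s. c - s \<in> {0..<1}"
    using c by eventually_elim (metis orb_unit)
  have "c \<in> {0<..1}"
  proof -
    obtain b where b: "0 < b" "\<And>s. 0 < s \<Longrightarrow> s < b \<Longrightarrow> c - s \<in> {0..<1}"
      using unit unfolding eventually_at_right_field by auto
    have "0 < c" using b(1) b(2)[of "b / 2"] by auto
    moreover have "c \<le> 1"
    proof (rule ccontr)
      assume "\<not> c \<le> 1"
      define s where "s = min (b / 2) ((c - 1) / 2)"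
      have "s \<le> b / 2" unfolding s_def by (rule min.cobounded1)
      moreover have "s \<le> (c - 1) / 2" unfolding s_def by (rule min.cobounded2)
      moreover have "0 < s" using b(1) \<open>\<not> c \<le> 1\<close> by (simp add: s_def)
      ultimately show False using b(1) b(2)[of s] \<open>\<not> c \<le> 1\<close> by (auto simp: field_simps)
    qed
    ultimately show ?thesis by auto
  qed
  then obtain a where a: "letter_lo a < c" "c \<le> letter_hi a" using letter_left_exists by blast
  have "\<forall>\<^sub>0s. letter_of (orb (x - s) n) = a"
    using letter_of_germ_left[OF a] c by eventually_elim simp
  then show ?thesis using that c a by blast
qed

text \<open>\<open>og n\<close> is the left limit of the orbit at time n. If it is never a right end
  point, it lies in the half-open interval of its left letter, so the left limits follow the same
  rule as points and form the orbit of x itself.\<close>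

lemma germ_left_regular:
  assumes x: "x \<in> {0<..1}"
    and og: "\<And>n. \<forall>\<^sub>0s. orb (x - s) n = og n - s"
    and reg: "\<And>n a. og n \<noteq> letter_hi a"
  shows "x \<in> {0..<1}" "\<forall>\<^sub>0s. cocycle \<phi> (x - s) n = cocycle \<phi> x n"
proof -
  have ev_pos: "\<forall>\<^sub>0s. (0::real) < s" by (rule eventually_at_right_less)
  have uniq: "c = d" if "\<forall>\<^sub>F s in at_right (0::real). c - s = d - s" for c d :: real
    using eventually_happens[OF that] by (auto simp: trivial_limit_at_right_real)
  have o0: "og 0 = x"
    using og[of 0] by (intro uniq) (auto elim: eventually_mono)
  show x1: "x \<in> {0..<1}" using x reg[of 0 L9] o0 by auto
  have step: "T (og n) = og (n + 1) \<and> letter_of (og n) = a"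
    if a: "letter_lo a < og n" "og n \<le> letter_hi a" "\<forall>\<^sub>0s. letter_of (orb (x - s) n) = a" for n a
  proof -
    have lt: "og n < letter_hi a" using a reg[of n a] by simp
    have Ton: "T (og n) = og n + letter_shift a - (if a = L2 \<and> (1 - \<alpha>) / 2 \<le> og n then 1 else 0)"
      using a lt by (intro T_eq_shift) auto
    have Ts: "\<forall>\<^sub>0s. og (n + 1) - s = og n - s + letter_shift a - (if a = L2 \<and> (1 - \<alpha>) / 2 \<le> og n - s then 1 else 0)"
    proof -
      have "\<forall>\<^sub>0s. s < og n - letter_lo a"
        using a by (intro eventually_at_rightI[of 0 "og n - letter_lo a"]) auto
      with ev_pos og[of n] og[of "n + 1"] show ?thesis
      proof eventually_elim
        case (elim s)
        have "T (og n - s) = og n - s + letter_shift a - (if a = L2 \<and> (1 - \<alpha>) / 2 \<le> og n - s then 1 else 0)"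
          using elim a by (intro T_eq_shift) auto
        then show ?case using elim orb_succ[of "x - s" n] by simp
      qed
    qed
    have "og (n + 1) = T (og n)"
    proof (cases "a = L2 \<and> (1 - \<alpha>) / 2 \<le> og n")
      case True
      show ?thesis
      \<comment> \<open>Just to the left of the break T tends to 1, the right end of
        \<open>L9\<close>, which \<open>reg\<close> forbids at time n + 1.\<close>
      proof (cases "og n = (1 - \<alpha>) / 2")
        case eq: True
        have "og (n + 1) = 1"
        proof (rule uniq)
          show "\<forall>\<^sub>0s. og (n + 1) - s = 1 - s"
            using Ts ev_pos by eventually_elim (use eq True in \<open>simp add: field_simps\<close>)
        qed
        then show ?thesis using reg[of "n + 1" L9] by simp
      next
        case False
        have "\<forall>\<^sub>0s. s < og n - (1 - \<alpha>) / 2"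
          using False True by (intro eventually_at_rightI[of 0 "og n - (1 - \<alpha>) / 2"]) auto
        with Ts have "\<forall>\<^sub>0s. og (n + 1) - s = T (og n) - s"
          unfolding Ton by eventually_elim (use True in \<open>auto simp: field_simps\<close>)
        then show ?thesis by (rule uniq)
      qed
    next
      case False
      have "\<forall>\<^sub>0s. og (n + 1) - s = T (og n) - s"
        unfolding Ton using Ts ev_pos by eventually_elim (use False in auto)
      then show ?thesis by (rule uniq)
    qed
    moreover have "letter_of (og n) = a" using a lt by (intro letter_of_eq) auto
    ultimately show ?thesis by simp
  qed
  have ex: "\<exists>a. letter_lo a < og n \<and> og n \<le> letter_hi a \<and> (\<forall>\<^sub>0s. letter_of (orb (x - s) n) = a)" for n
  proof -
    obtain c a where c: "\<forall>\<^sub>0s. orb (x - s) n = c - s" "letter_lo a < c" "c \<le> letter_hi a"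
      "\<forall>\<^sub>0s. letter_of (orb (x - s) n) = a" by (rule germ_left_orb[OF x, of n])
    have "\<forall>\<^sub>0s. c - s = og n - s"
      using c(1) og[of n] by eventually_elim simp
    from uniq[OF this] show ?thesis using c by auto
  qed
  have T: "T (og n) = og (n + 1)" for n using ex[of n] step[of _ n] by blast
  have orb_o: "orb x n = og n" for n
  proof (induction n rule: int_induct[of _ 0])
    case (step2 i)
    then show ?case using T[of "i - 1"] by (simp add: orb_pred) (metis arnoux_yoccoz_inv(1))
  qed (simp_all add: o0 orb_succ T)
  have ev: "\<forall>\<^sub>0s. letter_of (orb (x - s) i) = letter_of (orb x i)" for i
    using ex[of i] step[of _ i] orb_o by auto
  show "\<forall>\<^sub>0s. cocycle \<phi> (x - s) n = cocycle \<phi> x n"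
    using ev_letter[OF ev, of n] by eventually_elim (simp add: cocycle_def)
qed

context expanding_eigenvalue
begin

lemma norm_S_le: "norm (S x n) \<le> step_bound * \<bar>real_of_int n\<bar>"
proof (induction n rule: int_induct[of _ 0])
  case (step1 i)
  have "norm (S x (i + 1)) \<le> norm (S x i) + step_bound"
    using norm_triangle_ineq[of "S x i" "step (letter_of (orb x i))"] norm_step_le[of "letter_of (orb x i)"]
    by (simp add: S_cocycle cocycle_succ)
  with step1 show ?case by (simp add: algebra_simps)
next
  case (step2 i)
  have "norm (S x (i - 1)) \<le> norm (S x i) + step_bound"
    using norm_triangle_ineq4[of "S x i" "step (letter_of (orb x (i - 1)))"] norm_step_le[of "letter_of (orb x (i - 1))"]
    by (simp add: S_cocycle cocycle_pred)
  with step2 show ?case by (simp add: algebra_simps)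
qed simp

text \<open>
  A closed walk through \<open>\<plusminus> 1\<close> and \<open>\<plusminus> \<beta>\<close> goes below its end points in every direction, so the minimum over
  its renormalizations is attained far from both ends.
\<close>

lemma loop_exists:
  obtains y where "y \<in> {0..<1}" "S y 1 = \<beta>" "S y 4 = - 1" "S y 12 = 1" "S y 13 = - \<beta>" "S y 14 = 0"
proof -
  have l0: "letter_of 0 = L1"
    using ay_alpha_bounds by (intro letter_of_eq) auto
  define w where "w = subst_pow 5 L1"
  have w: "w = [L4, L6, L1, L8, L4, L5, L3, L4, L6, L1, L8, L4, L6, L1, L7, L1, L9, L3, L5, L2, L1, L7, L1, L8]"
    by (simp add: w_def eval_nat_numeral)
  define x where "x = (renorm ^^ 5) 0"
  have x: "x \<in> {0..<1}" unfolding x_def by (rule renorm_pow_unit) simp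
  have Sx: "S x (int i) = sum_list (map step (take i w))" if "i < 24" for i
    using S_block[of 0 i 5] that w unfolding l0 w_def[symmetric] x_def by simp
  \<comment> \<open>The loop is the factor of length 14 of the word w that starts at position
    6.\<close>
  have Sy: "S (orb x 6) (int i) = sum_list (map step (take (6 + i) w)) - sum_list (map step (take 6 w))" if "i < 18" for i
    using S_add[of x 6 "int i"] Sx[of 6] Sx[of "6 + i"] that by (simp add: eq_diff_eq add.commute)
  show ?thesis
  proof (rule that[of "orb x 6"])
    show "orb x 6 \<in> {0..<1}" using x by (intro orb_mem)
    show "S (orb x 6) 1 = \<beta>" "S (orb x 6) 4 = - 1" "S (orb x 6) 12 = 1" "S (orb x 6) 13 = - \<beta>" "S (orb x 6) 14 = 0"
      using Sy[of 1] Sy[of 4] Sy[of 12] Sy[of 13] Sy[of 14] unfolding w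
      by (simp_all add: step_def eval3_def)
  qed
qed

definition lowest_upto :: "complex \<Rightarrow> nat \<Rightarrow> real set" where
  "lowest_upto z D = {x \<in> {0..<1}. \<forall>n. \<bar>n\<bar> \<le> int D \<longrightarrow> 0 \<le> Re (z * S x n)}"

text \<open>With u = z * \<beta>^k, the four prescribed vertices push the minimum below - norm u /
  C. Both ends have height 0 and one step changes the height by a bounded amount, so for large k the
  minimizer is more than D steps away from either end.\<close>

lemma lowest_upto_nonempty:
  assumes z: "z \<noteq> 0"
  shows "lowest_upto z D \<noteq> {}"
proof -
  obtain y where y: "y \<in> {0..<1}" "S y 1 = \<beta>" "S y 4 = - 1" "S y 12 = 1" "S y 13 = - \<beta>" "S y 14 = 0"
    by (rule loop_exists)
  \<comment> \<open>1 and \<open>\<beta>\<close> are independent over the reals, so Re u and Re (u *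
    \<beta>) control u with this constant.\<close>
  define C where "C = 1 + (1 + \<bar>Re \<beta>\<bar>) / \<bar>Im \<beta>\<bar>"
  have C: "0 < C" by (simp add: C_def add_pos_nonneg)
  have norm_le: "norm u \<le> C * max \<bar>Re u\<bar> \<bar>Re (u * \<beta>)\<bar>" for u
  proof -
    define m where "m = max \<bar>Re u\<bar> \<bar>Re (u * \<beta>)\<bar>"
    have m: "\<bar>Re u\<bar> \<le> m" "\<bar>Re (u * \<beta>)\<bar> \<le> m" by (auto simp: m_def)
    have "Im u * Im \<beta> = Re u * Re \<beta> - Re (u * \<beta>)" by simp
    then have "\<bar>Im u\<bar> * \<bar>Im \<beta>\<bar> \<le> \<bar>Re u\<bar> * \<bar>Re \<beta>\<bar> + \<bar>Re (u * \<beta>)\<bar>"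
      by (metis abs_mult abs_triangle_ineq4)
    also have "\<dots> \<le> m * \<bar>Re \<beta>\<bar> + m"
      using m by (intro add_mono mult_right_mono) auto
    finally have "\<bar>Im u\<bar> \<le> m * ((1 + \<bar>Re \<beta>\<bar>) / \<bar>Im \<beta>\<bar>)"
      using nonreal by (simp add: field_simps)
    then show ?thesis
      using m cmod_le[of u] unfolding m_def[symmetric] C_def by (simp add: algebra_simps)
  qed
  obtain k where k: "C * step_bound * (real D + 1) < norm \<beta> ^ k"
    using real_arch_pow[OF norm_beta(2)] by blast
  define Y where "Y = (renorm ^^ k) y"
  have Y: "Y \<in> {0..<1}" using y unfolding Y_def by (intro renorm_pow_unit)
  define N where "N = clock k y 14"
  define f where "f n = Re (z * S Y n)" for n
  have mono: "clock k y i < clock k y j" if "i < j" for i j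
    using tower_pos that by (rule cocycle_strict_mono)
  have f_tower: "f (clock k y j) = Re (z * \<beta>^k * S y j)" for j
    unfolding f_def Y_def S_renorm_pow[OF y(1)] by (simp add: mult.assoc)
  obtain m where m: "m \<in> {0..N}" "\<And>n. n \<in> {0..N} \<Longrightarrow> f m \<le> f n"
  proof -
    have "finite {0..N}" "{0..N} \<noteq> {}" using mono[of 0 14] by (auto simp: N_def)
    then have "Min (f ` {0..N}) \<in> f ` {0..N}" by (intro Min_in) auto
    then obtain m where "m \<in> {0..N}" "f m = Min (f ` {0..N})" by auto
    then show ?thesis using that by auto
  qed
  define u where "u = z * \<beta>^k"
  have "f m \<le> Re (u * S y j)" if "j \<in> {1, 4, 12, 13}" for j
  proof -
    have "clock k y j \<in> {0..N}"
      using mono[of 0 j] mono[of j 14] that by (auto simp: N_def)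
    from m(2)[OF this] show ?thesis by (simp add: f_tower u_def)
  qed
  from this[of 1] this[of 4] this[of 12] this[of 13]
  have "f m \<le> Re (u * \<beta>)" "f m \<le> - Re u" "f m \<le> Re u" "f m \<le> - Re (u * \<beta>)"
    unfolding y by simp_all
  then have "max \<bar>Re u\<bar> \<bar>Re (u * \<beta>)\<bar> \<le> - f m" by linarith
  then have "norm u \<le> C * (- f m)"
    using norm_le[of u] C by (meson mult_left_mono less_imp_le order_trans)
  then have fm: "norm z * norm \<beta> ^ k \<le> C * (- f m)" by (simp add: u_def norm_mult norm_power)
  have far: "real D + 1 < real_of_int l" if l: "0 \<le> l" "- f m \<le> norm z * (step_bound * real_of_int l)" for l
  proof (rule ccontr)
    assume "\<not> ?thesis"
    then have "step_bound * real_of_int l \<le> step_bound * (real D + 1)"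
      using step_bound_nonneg by (intro mult_left_mono) auto
    then have "norm z * (step_bound * real_of_int l) \<le> norm z * (step_bound * (real D + 1))"
      by (rule mult_left_mono) simp
    then have "C * (- f m) \<le> C * (norm z * (step_bound * (real D + 1)))"
      using C l by (intro mult_left_mono) auto
    also have "\<dots> = norm z * (C * step_bound * (real D + 1))" by simp
    also have "\<dots> < norm z * norm \<beta> ^ k" using k z by (intro mult_strict_left_mono) auto
    finally show False using fm by simp
  qed
  have f0: "f 0 = 0" "f N = 0" using f_tower[of 14] y by (auto simp: f_def N_def)
  have diff: "\<bar>f (a + l) - f a\<bar> \<le> norm z * (step_bound * \<bar>real_of_int l\<bar>)" for a l
  proof -
    have "f (a + l) - f a = Re (z * S (orb Y a) l)" by (simp add: f_def S_add distrib_left)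
    then have "\<bar>f (a + l) - f a\<bar> \<le> norm z * norm (S (orb Y a) l)"
      using abs_Re_le_cmod[of "z * S (orb Y a) l"] by (simp only: norm_mult)
    also have "\<dots> \<le> norm z * (step_bound * \<bar>real_of_int l\<bar>)"
      by (intro mult_left_mono norm_S_le) simp
    finally show ?thesis .
  qed
  have "real D + 1 < real_of_int m" "real D + 1 < real_of_int (N - m)"
    using far[of m] far[of "N - m"] diff[of 0 m] diff[of m "N - m"] f0 m(1) by auto
  then have range: "m + n \<in> {0..N}" if "\<bar>n\<bar> \<le> int D" for n
    using that by auto
  have "orb Y m \<in> lowest_upto z D"
    unfolding lowest_upto_def
  proof safe
    fix n assume "\<bar>n\<bar> \<le> int D"
    from m(2)[OF range[OF this]] show "0 \<le> Re (z * S (orb Y m) n)"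
      by (simp add: f_def S_add distrib_left)
  qed (use Y in \<open>simp del: atLeastLessThan_iff\<close>)
  then show ?thesis by blast
qed

text \<open>The neighbourhood may shrink as the window D grows, so this speaks of the whole orbit of
  a left germ and not of the orbit of any point.\<close>

definition germ_bounded :: "complex \<Rightarrow> real \<Rightarrow> letter \<Rightarrow> bool" where
  "germ_bounded z C a \<longleftrightarrow>
     (\<forall>D::nat. \<forall>\<^sub>0s. \<forall>n. \<bar>n\<bar> \<le> int D \<longrightarrow> - C \<le> Re (z * S (letter_hi a - s) n))"

text \<open>
  The left germ at the right end of the interval of \<open>a\<close> is the image, under the renormalization
  followed by \<open>p\<close> steps, of the left germ at the right end of the interval of \<open>b\<close>.
\<close>

definition right_parent :: "letter \<Rightarrow> letter \<Rightarrow> nat \<Rightarrow> bool" where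
  "right_parent a b p \<longleftrightarrow> (a, b, p) \<in> {(L1, L6, 0), (L2, L8, 0), (L3, L1, 0), (L4, L3, 0), (L5, L2, 1),
     (L6, L3, 1), (L7, L4, 1), (L8, L5, 1), (L9, L7, 1)}"

lemma parent_germ:
  assumes "right_parent a b p"
  shows "\<forall>\<^sub>0s. letter_hi b - s \<in> {0..<1} \<and>
    orb (renorm (letter_hi b - s)) (int p) = letter_hi a - \<alpha> * s \<and>
    S (renorm (letter_hi b - s)) (int p) = (if p = 0 then 0 else step (hd (ay_subst b)))"
proof -
  have ev: "\<forall>\<^sub>0s. letter_of (letter_hi b - s) = b"
    using letter_lo_less_hi by (intro letter_of_germ_left) auto
  have "\<forall>\<^sub>0s. s < letter_hi b - letter_lo b"
    using letter_lo_less_hi[of b] by (intro eventually_at_rightI[of 0 "letter_hi b - letter_lo b"]) auto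
  with eventually_at_right_less[of 0] ev show ?thesis
  proof eventually_elim
    case (elim s)
    define y where "y = letter_hi b - s"
    have y: "y \<in> {0..<1}" using elim letter_lo_nonneg[of b] letter_hi_le_1[of b] by (auto simp: y_def)
    have lo: "letter_lo b \<le> y" using elim by (simp add: y_def)
    have ly: "letter_of y = b" using elim by (simp add: y_def)
    have ry: "renorm y \<in> {0..<1}" using y by (rule renorm_unit)
    have lry: "letter_of (renorm y) = hd (ay_subst b)" using renorm_desubst(2)[OF y] ly by simp
    have r: "renorm y = \<alpha> * letter_hi b - \<alpha> * s - (1 - \<alpha>) / 2 + (if b \<in> {L1, L2, L3} then \<alpha> else 0)"
    proof -
      have "y < (\<alpha> + \<alpha>^2) / 2 \<longleftrightarrow> b \<in> {L1, L2, L3}"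
        using lo elim ay_alpha_bounds by (cases b) (auto simp: y_def field_simps)
      then show ?thesis unfolding renorm_def by (simp add: y_def right_diff_distrib)
    qed
    have as: "0 < \<alpha> * s" using elim ay_alpha_pos by simp
    note simps = ay_alpha_mult ring_distribs add_divide_distrib diff_divide_distrib
    have "orb (renorm y) (int p) = letter_hi a - \<alpha> * s"
    proof (cases "p = 0")
      case True
      then show ?thesis
        using assms unfolding right_parent_def by (auto simp: r simps)
    next
      case False
      have T: "T (renorm y) = renorm y + letter_shift (hd (ay_subst b))
          - (if hd (ay_subst b) = L2 \<and> (1 - \<alpha>) / 2 \<le> renorm y then 1 else 0)"
        using T_eq_shift[OF letter_of_bounds[OF ry]] unfolding lry .
      have p: "int p = 1" using assms False by (auto simp: right_parent_def)
      show ?thesis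
        using assms False as unfolding p orb_1 T right_parent_def by (auto simp: r simps)
    qed
    moreover have "S (renorm y) (int p) = (if p = 0 then 0 else step (hd (ay_subst b)))"
      using assms S_1[of "renorm y"] unfolding lry by (auto simp: right_parent_def)
    ultimately show ?case using y unfolding y_def by blast
  qed
qed

lemma right0_mult:
  fixes c :: real
  assumes "\<forall>\<^sub>0s. P s" "0 < c"
  shows "\<forall>\<^sub>0s. P (c * s)"
proof -
  obtain b where b: "0 < b" "\<And>s. 0 < s \<Longrightarrow> s < b \<Longrightarrow> P s"
    using assms(1) unfolding eventually_at_right_field by auto
  show ?thesis
    by (rule eventually_at_rightI[of 0 "b / c"]) (use b assms(2) in \<open>auto simp: field_simps\<close>)
qed

lemma germ_bounded_parent:
  assumes bd: "germ_bounded z C a" and par: "right_parent a b p"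
  shows "germ_bounded (z * \<beta>) (C - Re (z * (if p = 0 then 0 else step (hd (ay_subst b))))) b"
  unfolding germ_bounded_def
proof
  fix D :: nat
  define v where "v = (if p = 0 then 0 else step (hd (ay_subst b)))"
  have p: "p \<le> 1" using par by (auto simp: right_parent_def)
  \<comment> \<open>One letter takes at most two steps after renormalization, and the germ sits at
    most one floor above the base: a window D upstairs needs 2 D + 1 here.\<close>
  have "\<forall>\<^sub>0s. \<forall>n. \<bar>n\<bar> \<le> int (2 * D + 1) \<longrightarrow> - C \<le> Re (z * S (letter_hi a - s) n)"
    using bd unfolding germ_bounded_def by (rule spec)
  from right0_mult[OF this ay_alpha_pos]
  have "\<forall>\<^sub>0s. \<forall>n. \<bar>n\<bar> \<le> int (2 * D + 1) \<longrightarrow> - C \<le> Re (z * S (letter_hi a - \<alpha> * s) n)" .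
  with parent_germ[OF par] show "\<forall>\<^sub>0s. \<forall>n. \<bar>n\<bar> \<le> int D \<longrightarrow>
      - (C - Re (z * (if p = 0 then 0 else step (hd (ay_subst b))))) \<le> Re (z * \<beta> * S (letter_hi b - s) n)"
  proof eventually_elim
    case (elim s)
    define y where "y = letter_hi b - s"
    have y: "y \<in> {0..<1}" "orb (renorm y) (int p) = letter_hi a - \<alpha> * s" "S (renorm y) (int p) = v"
      using elim unfolding y_def v_def by auto
    have "- (C - Re (z * v)) \<le> Re (z * \<beta> * S y j)" if j: "\<bar>j\<bar> \<le> int D" for j
    proof -
      define n where "n = clock 1 y j"
      have "\<bar>clock 1 y j\<bar> \<le> 2 * \<bar>j\<bar>" for j
      proof -
        have "tower 1 a \<le> 2 \<and> 0 \<le> tower 1 a" for a by (cases a) auto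
        then have t: "tower 1 (letter_of (orb y i)) \<le> 2 \<and> 0 \<le> tower 1 (letter_of (orb y i))" for i by blast
        show ?thesis
        proof (induction j rule: int_induct[of _ 0])
          case (step1 i)
          then show ?case using t[of i] by (simp add: cocycle_succ)
        next
          case (step2 i)
          then show ?case using t[of "i - 1"] by (simp add: cocycle_pred)
        qed simp
      qed
      from this[of j] have "\<bar>n - int p\<bar> \<le> int (2 * D + 1)" using j p by (auto simp: n_def)
      then have "- C \<le> Re (z * S (orb (renorm y) (int p)) (n - int p))" using elim y by metis
      also have "S (orb (renorm y) (int p)) (n - int p) = S (renorm y) n - v"
        using S_add[of "renorm y" "int p" "n - int p"] y by simp
      also have "S (renorm y) n = \<beta> * S y j"
        using S_renorm_pow[OF y(1), of 1 j] by (simp add: n_def)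
      finally show ?thesis by (simp add: algebra_simps)
    qed
    then show ?case unfolding y_def v_def by blast
  qed
qed

text \<open>Going around the cycle repeatedly bounds \<open>Re (w * \<beta>\<^sup>3\<^sup>m)\<close> from above for a fixed \<open>w \<noteq> 0\<close>.\<close>

lemma not_germ_bounded_cycle:
  assumes cyc: "\<And>z C. germ_bounded z C a \<Longrightarrow> germ_bounded (z * \<beta>^3) (C - Re (z * c)) a"
    and c: "c \<noteq> 0" and z: "z \<noteq> 0"
  shows "\<not> germ_bounded z C a"
proof
  assume bd: "germ_bounded z C a"
  have it: "germ_bounded (z * (\<beta>^3)^m) (C - Re (z * c * (\<Sum>l<m. (\<beta>^3)^l))) a" for m
  proof (induction m)
    case (Suc m)
    from cyc[OF Suc] show ?case by (simp add: algebra_simps)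
  qed (use bd in simp)
  have C: "0 \<le> C" if "germ_bounded z C a" for z C
  proof -
    have "\<forall>\<^sub>0s. - C \<le> Re (z * S (letter_hi a - s) 0)"
      using that unfolding germ_bounded_def by (auto dest: spec[of _ 0] elim: eventually_mono)
    then show ?thesis using eventually_happens by (fastforce simp: trivial_limit_at_right_real)
  qed
  have b3: "\<beta>^3 \<noteq> 1" using nonreal3 by auto
  \<comment> \<open>With this w the accumulated drift z * c * (1 + \<beta>^3 + ...) over m turns is
    w * (\<beta>^3)^m - w.\<close>
  define w where "w = z * c / (\<beta>^3 - 1)"
  have "w \<noteq> 0" using z c b3 by (simp add: w_def)
  moreover have "1 < norm (\<beta>^3)" using norm_beta(2) by (simp add: norm_power)
  ultimately obtain m where "C + Re w < Re (w * (\<beta>^3)^m)"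
    using Re_rotation_unbounded[of "\<beta>^3" w] nonreal3 by blast
  moreover have "z * c * (\<Sum>l<m. (\<beta>^3)^l) = w * (\<beta>^3)^m - w"
  proof -
    have "w * (\<beta>^3)^m - w = z * c / (\<beta>^3 - 1) * ((\<beta>^3)^m - 1)"
      by (simp add: w_def right_diff_distrib)
    then show ?thesis by (simp add: geometric_sum[OF b3])
  qed
  ultimately have "C < Re (z * c * (\<Sum>l<m. (\<beta>^3)^l))" by simp
  then show False using C[OF it[of m]] by simp
qed

text \<open>Passing to parents, the letters fall into the cycles \<open>L1\<close>,
  \<open>L6\<close>, \<open>L3\<close> and \<open>L2\<close>, \<open>L8\<close>, \<open>L5\<close>,
  while \<open>L9\<close>, \<open>L7\<close>, \<open>L4\<close> lead into the first one. The drifts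
  around the cycles are 1 and \<beta> - 1, both nonzero.\<close>

lemma not_germ_bounded:
  assumes "z \<noteq> 0"
  shows "\<not> germ_bounded z C a"
proof -
  have b3: "z * \<beta> * \<beta> * \<beta> = z * \<beta>^3" for z by (simp add: power3_eq_cube)
  have 1: "\<not> germ_bounded z C L1" if "z \<noteq> 0" for z C
  proof (rule not_germ_bounded_cycle[OF _ _ that])
    fix z C assume "germ_bounded z C L1"
    then have "germ_bounded (z * \<beta>) C L6"
      using germ_bounded_parent[of z C L1 L6 0] by (simp add: right_parent_def)
    then have "germ_bounded (z * \<beta> * \<beta>) (C - Re (z * \<beta> * step L4)) L3"
      using germ_bounded_parent[of "z * \<beta>" C L6 L3 1] by (simp add: right_parent_def)
    from germ_bounded_parent[OF this, of L1 0]
    show "germ_bounded (z * \<beta>^3) (C - Re (z * (\<beta> * step L4))) L1"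
      by (simp add: right_parent_def b3 mult.assoc[symmetric] del: times_complex.sel)
  next
    have "\<beta> * step L4 = 1" using cubic
      by (simp add: step_def eval3_def algebra_simps power2_eq_square power3_eq_cube)
    then show "\<beta> * step L4 \<noteq> 0" by simp
  qed
  have 2: "\<not> germ_bounded z C L2" if "z \<noteq> 0" for z C
  proof (rule not_germ_bounded_cycle[OF _ _ that])
    fix z C assume "germ_bounded z C L2"
    then have "germ_bounded (z * \<beta>) C L8"
      using germ_bounded_parent[of z C L2 L8 0] by (simp add: right_parent_def)
    then have "germ_bounded (z * \<beta> * \<beta>) (C - Re (z * \<beta> * step L1)) L5"
      using germ_bounded_parent[of "z * \<beta>" C L8 L5 1] by (simp add: right_parent_def)
    from germ_bounded_parent[OF this, of L2 1]
    have "germ_bounded (z * \<beta> * \<beta> * \<beta>) (C - Re (z * \<beta> * step L1) - Re (z * \<beta> * \<beta> * step L4)) L2"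
      by (simp add: right_parent_def)
    also have "C - Re (z * \<beta> * step L1) - Re (z * \<beta> * \<beta> * step L4) = C - Re (z * (\<beta> * step L1 + \<beta> * \<beta> * step L4))"
      by (simp add: algebra_simps)
    finally show "germ_bounded (z * \<beta>^3) (C - Re (z * (\<beta> * step L1 + \<beta> * \<beta> * step L4))) L2"
      by (simp only: b3)
  next
    have "\<beta> * step L1 + \<beta> * \<beta> * step L4 = \<beta> - 1" using cubic
    proof -
      have "\<beta> * step L1 + \<beta> * \<beta> * step L4 = (\<beta> - 1) * (\<beta> + \<beta>^2 + \<beta>^3)"
        by (simp add: step_def eval3_def algebra_simps power2_eq_square power3_eq_cube)
      then show ?thesis using cubic by simp
    qed
    then show "\<beta> * step L1 + \<beta> * \<beta> * step L4 \<noteq> 0" using nonreal by auto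
  qed
  define never where "never a \<longleftrightarrow> (\<forall>z C. z \<noteq> 0 \<longrightarrow> \<not> germ_bounded z C a)" for a
  have up: "never a" if "right_parent a b p" "never b" for a b p
    using germ_bounded_parent[OF _ that(1)] that(2) beta_nz unfolding never_def by (metis mult_eq_0_iff)
  have "never L1" "never L2" using 1 2 by (auto simp: never_def)
  moreover from this have "never L3" "never L5"
    using up[of L3 L1 0] up[of L5 L2 1] by (auto simp: right_parent_def)
  moreover from this have "never L4" "never L6" "never L8"
    using up[of L4 L3 0] up[of L6 L3 1] up[of L8 L5 1] by (auto simp: right_parent_def)
  moreover from this have "never L7" using up[of L7 L4 1] by (auto simp: right_parent_def)
  moreover from this have "never L9" using up[of L9 L7 1] by (auto simp: right_parent_def)
  ultimately have "never a" by (cases a) auto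
  then show ?thesis using assms by (simp add: never_def)
qed

text \<open>Sums up to time D are constant on a short interval to the right of any point, so the set
  contains its limits from the right.\<close>

lemma lowest_upto_Inf:
  assumes z: "z \<noteq> 0"
  shows "Inf (lowest_upto z D) \<in> lowest_upto z D"
proof (rule ccontr)
  let ?C = "lowest_upto z D"
  define x where "x = Inf ?C"
  assume no: "Inf ?C \<notin> ?C"
  obtain c where c: "c \<in> ?C" using lowest_upto_nonempty[OF z] by blast
  have bdd: "bdd_below ?C" by (intro bdd_belowI[of _ 0]) (auto simp: lowest_upto_def)
  have "0 \<le> x" unfolding x_def using c by (intro cInf_greatest) (auto simp: lowest_upto_def)
  moreover have "x \<le> c" unfolding x_def by (rule cInf_lower[OF c bdd])
  ultimately have x: "x \<in> {0..<1}" using c by (auto simp: lowest_upto_def)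
  have "\<forall>\<^sub>0s. \<forall>n\<in>{- int D..int D}. cocycle step (x + s) n = cocycle step x n"
    using cocycle_germ_right[OF x] by (intro eventually_ball_finite) auto
  then obtain b where b: "0 < b" "\<And>s n. 0 < s \<Longrightarrow> s < b \<Longrightarrow> n \<in> {- int D..int D} \<Longrightarrow> S (x + s) n = S x n"
    unfolding eventually_at_right_field S_cocycle by auto
  have "x < x + b" using b by simp
  then obtain y where y: "y \<in> ?C" "y < x + b"
    using cInf_less_iff[OF lowest_upto_nonempty[OF z] bdd] unfolding x_def by blast
  have "x \<le> y" unfolding x_def by (rule cInf_lower[OF y(1) bdd])
  moreover have "y \<noteq> x" using no y(1) by (auto simp: x_def)
  ultimately have "S y n = S x n" if "n \<in> {- int D..int D}" for n
    using b(2)[of "y - x" n] y(2) that by simp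
  moreover have "0 \<le> Re (z * S y n)" if "n \<in> {- int D..int D}" for n
    using y(1) that unfolding lowest_upto_def by (auto simp del: times_complex.sel)
  ultimately have "0 \<le> Re (z * S x n)" if "n \<in> {- int D..int D}" for n
    using that by metis
  then have "x \<in> ?C" using x unfolding lowest_upto_def
    by (auto simp del: times_complex.sel simp: abs_le_iff)
  then show False using no by (simp add: x_def)
qed

text \<open>Choosing the least point of each nested set makes the approximations increase, so only
  limits from the left occur. If the limit is not attained, its left germ has nonnegative heights;
  this passes to the limit point unless the germ meets a right end point, which
  \<open>not_germ_bounded\<close> excludes.\<close>

lemma extremal_exists:
  assumes z: "z \<noteq> 0"
  obtains x where "x \<in> {0..<1}" "\<And>n. 0 \<le> Re (z * S x n)"
proof -
  define m where "m D = Inf (lowest_upto z D)" for D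
  have m: "m D \<in> lowest_upto z D" for D
    unfolding m_def by (rule lowest_upto_Inf[OF z])
  have anti: "lowest_upto z D' \<subseteq> lowest_upto z D" if "D \<le> D'" for D D'
    using that by (auto simp: lowest_upto_def)
  have m_mono: "m D \<le> m D'" if "D \<le> D'" for D D'
    unfolding m_def
    by (rule cInf_superset_mono[OF lowest_upto_nonempty[OF z] _ anti[OF that]])
      (auto intro!: bdd_belowI[of _ 0] simp: lowest_upto_def)
  have m01: "0 \<le> m D" "m D < 1" for D using m[of D] by (auto simp: lowest_upto_def)
  define x where "x = (SUP D. m D)"
  have bdd: "bdd_above (range m)" using m01 by (intro bdd_aboveI[of _ 1]) (auto intro: less_imp_le)
  have mx: "m D \<le> x" for D unfolding x_def by (rule cSUP_upper[OF _ bdd]) simp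
  show ?thesis
  proof (cases "\<exists>D. m D = x")
    case True
    then obtain D where D: "m D = x" by blast
    have "x \<in> lowest_upto z D'" for D'
    proof -
      have "m (max D D') = x" using m_mono[of D "max D D'"] mx[of "max D D'"] D by simp
      then show ?thesis using m[of "max D D'"] anti[of D' "max D D'"] by auto
    qed
    from this[of 0] this[of "nat \<bar>n\<bar>" for n] have "x \<in> {0..<1}" "0 \<le> Re (z * S x n)" for n
      unfolding lowest_upto_def by (auto simp del: times_complex.sel)
    then show ?thesis using that by blast
  next
    case False
    then have lt: "m D < x" for D using mx[of D] by (metis less_eq_real_def)
    have "x \<le> 1" unfolding x_def using m01 by (intro cSUP_least) (auto intro: less_imp_le)
    then have x: "x \<in> {0<..1}" using lt[of 0] m01[of 0] by auto
    have "\<exists>c. \<forall>\<^sub>0s. orb (x - s) n = c - s" for n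
      using germ_orb(2)[of n] unfolding germ_left_def by blast
    then obtain og where og: "\<And>n. \<forall>\<^sub>0s. orb (x - s) n = og n - s" by metis
    have "\<exists>a. \<forall>\<^sub>0s. letter_of (orb (x - s) n) = a" for n
      by (rule germ_left_orb[OF x, of n]) blast
    then obtain l where l: "\<And>n. \<forall>\<^sub>0s. letter_of (orb (x - s) n) = l n" by metis
    have "\<exists>c. \<forall>\<^sub>0s. S (x - s) n = c" for n
      unfolding S_cocycle by (rule cocycle_const[OF l])
    then obtain c where c: "\<And>n. \<forall>\<^sub>0s. S (x - s) n = c n" by metis
    have c_nonneg: "0 \<le> Re (z * c n)" for n
    proof -
      obtain b where b: "0 < b" "\<And>s. 0 < s \<Longrightarrow> s < b \<Longrightarrow> S (x - s) n = c n"
        using c[of n] unfolding eventually_at_right_field by auto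
      obtain D where D: "x - b < m D"
        using less_cSUP_iff[OF _ bdd, of "x - b"] b(1) unfolding x_def by auto
      define D' where "D' = max D (nat \<bar>n\<bar>)"
      have "x - b < m D'" using D m_mono[of D D'] by (simp add: D'_def)
      then have "S (m D') n = c n" using b(2)[of "x - m D'"] lt[of D'] by simp
      moreover have "0 \<le> Re (z * S (m D') n)"
        using m[of D'] unfolding lowest_upto_def D'_def by auto
      ultimately show ?thesis by simp
    qed
    show ?thesis
    proof (cases "\<exists>n a. og n = letter_hi a")
      case True
      then obtain k a where a: "og k = letter_hi a" by blast
      \<comment> \<open>Starting the germ at time k subtracts \<open>c k\<close> from all sums, so
        nonnegative heights become heights at least - Re (z * c k).\<close>
      have "germ_bounded z (Re (z * c k)) a"
        unfolding germ_bounded_def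
      proof
        fix D :: nat
        have "\<forall>\<^sub>0s. \<forall>n\<in>{- int D..int D}. S (x - s) (k + n) = c (k + n)"
          using c by (intro eventually_ball_finite) auto
        with c[of k] og[of k] show "\<forall>\<^sub>0s. \<forall>n. \<bar>n\<bar> \<le> int D \<longrightarrow>
            - Re (z * c k) \<le> Re (z * S (letter_hi a - s) n)"
        proof eventually_elim
          case (elim s)
          show ?case
          proof safe
            fix n assume n: "\<bar>n\<bar> \<le> int D"
            have "S (x - s) (k + n) = S (x - s) k + S (letter_hi a - s) n"
              using elim a by (simp add: S_add)
            moreover have "S (x - s) (k + n) = c (k + n)"
              using elim(3) n by (simp add: abs_le_iff)
            ultimately have "S (letter_hi a - s) n = c (k + n) - c k"
              using elim by simp
            then have "Re (z * S (letter_hi a - s) n) = Re (z * c (k + n)) - Re (z * c k)"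
              by (simp add: right_diff_distrib)
            then show "- Re (z * c k) \<le> Re (z * S (letter_hi a - s) n)"
              using c_nonneg[of "k + n"] by linarith
          qed
        qed
      qed
      then show ?thesis using not_germ_bounded[OF z] by blast
    next
      case False
      then have reg: "\<And>n a. og n \<noteq> letter_hi a" by blast
      note regular = germ_left_regular[OF x og reg]
      have "S x n = c n" for n
      proof -
        have "\<forall>\<^sub>F s in at_right (0::real). S x n = c n"
          using regular(2)[of step n] c[of n] by eventually_elim (simp add: S_cocycle)
        then show ?thesis using eventually_happens by (fastforce simp: trivial_limit_at_right_real)
      qed
      then show ?thesis using that[of x] regular(1) c_nonneg by simp
    qed
  qed
qed

end

section \<open>Gaps above the lowest point\<close>

lemma sum_shift3_telescope:
  fixes g :: "nat \<Rightarrow> real"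
  shows "(\<Sum>i<m. g i - g (i + 3)) = g 0 + g 1 + g 2 - g m - g (m + 1) - g (m + 2)"
  by (induction m) (simp_all add: eval_nat_numeral)

text \<open>A drop of \<rho> near t forces the same drop across three consecutive grid cells. The
  three-cell drops telescope to at most 3 D, so at most 3 D / \<rho> cells, each of length 2 \<eta>,
  can contain such t.\<close>

lemma antimono_drop_measure:
  fixes p :: "real \<Rightarrow> real"
  assumes anti: "\<And>s t. s \<le> t \<Longrightarrow> p t \<le> p s" and bd: "\<And>s t. p s - p t \<le> D"
    and pos: "0 < \<eta>" "0 < \<rho>"
  shows "\<exists>A\<in>sets lborel. {t. \<rho> \<le> p (t - \<eta>) - p (t + \<eta>)} \<subseteq> A \<and> emeasure lborel A \<le> ennreal (6 * \<eta> * D / \<rho>)"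
proof -
  \<comment> \<open>The shift by one cell lets \<open>f j\<close> and \<open>f (j + 3)\<close>
    bracket the window of radius \<eta> around every point of the cell that starts at 2 \<eta>
    j.\<close>
  define f where "f j = p (2 * \<eta> * (of_int j - 1))" for j :: int
  have bd_f: "f i - f j \<le> D" for i j unfolding f_def by (rule bd)
  define J where "J = {j. \<rho> \<le> f j - f (j + 3)}"
  have card: "real (card J0) * \<rho> \<le> 3 * D" if J0: "finite J0" "J0 \<subseteq> J" for J0
  proof -
    define n where "n = Max (insert 0 ((\<lambda>j. \<bar>j\<bar>) ` J0))"
    have n: "\<bar>j\<bar> \<le> n" if "j \<in> J0" for j unfolding n_def using J0 that by (intro Max_ge) auto
    have n0: "0 \<le> n" unfolding n_def using J0 by (intro Max_ge) auto
    define m where "m = nat (2 * n + 1)"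
    have sub: "J0 \<subseteq> (\<lambda>i. int i - n) ` {..<m}"
    proof
      fix j assume "j \<in> J0"
      from n[OF this] show "j \<in> (\<lambda>i. int i - n) ` {..<m}"
        by (intro image_eqI[of _ _ "nat (j + n)"]) (auto simp: m_def)
    qed
    have drop: "0 \<le> f j - f (j + 3)" for j
      using anti[of "2 * \<eta> * (of_int j - 1)" "2 * \<eta> * (of_int (j + 3) - 1)"] pos by (simp add: f_def)
    have "real (card J0) * \<rho> \<le> (\<Sum>j\<in>J0. f j - f (j + 3))"
      using J0 sum_bounded_below[of J0 \<rho> "\<lambda>j. f j - f (j + 3)"] by (auto simp: J_def)
    also have "\<dots> \<le> (\<Sum>j\<in>(\<lambda>i. int i - n) ` {..<m}. f j - f (j + 3))"
      using sub drop by (intro sum_mono2) auto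
    also have "\<dots> = (\<Sum>i<m. f (int i - n) - f (int (i + 3) - n))"
      by (subst sum.reindex) (auto simp: inj_on_def algebra_simps)
    also have "\<dots> = f (int 0 - n) + f (int 1 - n) + f (int 2 - n)
        - f (int m - n) - f (int (m + 1) - n) - f (int (m + 2) - n)"
      by (rule sum_shift3_telescope)
    also have "\<dots> \<le> 3 * D"
      using bd_f[of "int 0 - n" "int m - n"] bd_f[of "int 1 - n" "int (m + 1) - n"]
        bd_f[of "int 2 - n" "int (m + 2) - n"] by linarith
    finally show ?thesis .
  qed
  have fin: "finite J"
  proof (rule ccontr)
    assume "infinite J"
    then obtain J0 where J0: "finite J0" "card J0 = nat \<lceil>3 * D / \<rho>\<rceil> + 1" "J0 \<subseteq> J"
      using infinite_arbitrarily_large by blast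
    have "3 * D / \<rho> < real (card J0)" unfolding J0(2) by linarith
    then show False using card[OF J0(1,3)] pos by (simp add: field_simps)
  qed
  define A where "A = (\<Union>j\<in>J. {2 * \<eta> * of_int j..2 * \<eta> * (of_int j + 1)})"
  have "t \<in> A" if t: "\<rho> \<le> p (t - \<eta>) - p (t + \<eta>)" for t
  proof -
    define j where "j = \<lfloor>t / (2 * \<eta>)\<rfloor>"
    have j: "2 * \<eta> * of_int j \<le> t" "t \<le> 2 * \<eta> * (of_int j + 1)"
    proof -
      have "of_int j \<le> t / (2 * \<eta>)" "t / (2 * \<eta>) < of_int j + 1" unfolding j_def by linarith+
      then show "2 * \<eta> * of_int j \<le> t" "t \<le> 2 * \<eta> * (of_int j + 1)"
        using pos by (simp_all add: pos_le_divide_eq pos_divide_less_eq mult.commute)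
    qed
    have "p (t - \<eta>) \<le> f j" unfolding f_def using j pos by (intro anti) (simp add: algebra_simps)
    moreover have "f (j + 3) \<le> p (t + \<eta>)" unfolding f_def using j pos by (intro anti) (simp add: algebra_simps)
    ultimately have "j \<in> J" using t by (simp add: J_def)
    then show ?thesis unfolding A_def using j by auto
  qed
  then have "{t. \<rho> \<le> p (t - \<eta>) - p (t + \<eta>)} \<subseteq> A" by blast
  moreover have A: "A \<in> sets lborel" unfolding A_def using fin by auto
  moreover have "emeasure lborel A \<le> ennreal (6 * \<eta> * D / \<rho>)"
  proof -
    have "emeasure lborel A \<le> (\<Sum>j\<in>J. emeasure lborel {2 * \<eta> * of_int j..2 * \<eta> * (of_int j + 1)})"
      unfolding A_def using fin by (intro emeasure_subadditive_finite) auto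
    also have "\<dots> = (\<Sum>j\<in>J. ennreal (2 * \<eta>))"
      using pos by (intro sum.cong) (auto simp: algebra_simps)
    also have "\<dots> = ennreal (real (card J) * (2 * \<eta>))"
      using pos by (simp add: ennreal_mult ennreal_of_nat_eq_real_of_nat)
    also have "\<dots> \<le> ennreal (6 * \<eta> * D / \<rho>)"
    proof (rule ennreal_leI)
      have "real (card J) * \<rho> * (2 * \<eta>) \<le> 3 * D * (2 * \<eta>)"
        using card[OF fin] pos by (intro mult_right_mono) auto
      then show "real (card J) * (2 * \<eta>) \<le> 6 * \<eta> * D / \<rho>" using pos by (simp add: field_simps)
    qed
    finally show ?thesis .
  qed
  ultimately show ?thesis by blast
qed

text \<open>
  Along a line of directions, the component of the lowest point of \<open>F\<close> in the direction of the
  line is monotone. If a distant point is almost as low, then this component changes by at least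
  \<open>r / 2\<close> nearby, which can happen only for few directions.
\<close>

lemma near_minimum_measure:
  fixes F :: "complex set" and z0 e :: complex
  assumes fin: "finite F" and diam: "\<And>P Q. P \<in> F \<Longrightarrow> Q \<in> F \<Longrightarrow> \<bar>Re (e * (Q - P))\<bar> \<le> D"
    and pos: "0 < r" "0 < \<epsilon>"
  shows "\<exists>A\<in>sets lborel. emeasure lborel A \<le> ennreal (24 * \<epsilon> * D / r^2) \<and>
    {t. \<exists>P\<in>F. \<exists>Q\<in>F. (\<forall>R\<in>F. Re ((z0 + of_real t * e) * P) \<le> Re ((z0 + of_real t * e) * R)) \<and>
      r \<le> \<bar>Re (e * (Q - P))\<bar> \<and> Re ((z0 + of_real t * e) * (Q - P)) < \<epsilon>} \<subseteq> A"
proof (cases "F = {}")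
  case True
  then show ?thesis by (intro bexI[of _ "{}"]) auto
next
  case False
  define val where "val t P = Re (z0 * P) + t * Re (e * P)" for t P
  have val: "Re ((z0 + of_real t * e) * P) = val t P" for t P
    unfolding val_def by (simp add: algebra_simps)
  have "\<exists>P\<in>F. \<forall>R\<in>F. val t P \<le> val t R" for t
  proof -
    have "Min (val t ` F) \<in> val t ` F" using fin False by (intro Min_in) auto
    then obtain P where "P \<in> F" "val t P = Min (val t ` F)" by auto
    then show ?thesis using fin by (intro bexI[of _ P]) auto
  qed
  then obtain sel where sel: "\<And>t. sel t \<in> F" "\<And>t R. R \<in> F \<Longrightarrow> val t (sel t) \<le> val t R" by metis
  have val_shift: "val s P = val t P + (s - t) * Re (e * P)" for s t P
    by (simp add: val_def algebra_simps)
  have mono: "Re (e * Q) \<le> Re (e * P)"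
    if "s < t" "P \<in> F" "Q \<in> F" "\<forall>R\<in>F. val s P \<le> val s R" "\<forall>R\<in>F. val t Q \<le> val t R" for s t P Q
  proof -
    have "val s P \<le> val s Q" "val t Q \<le> val t P" using that by auto
    then have "(t - s) * Re (e * Q) \<le> (t - s) * Re (e * P)"
      using val_shift[of t P s] val_shift[of t Q s] by linarith
    then show ?thesis using that by simp
  qed
  define p where "p t = Re (e * sel t)" for t
  \<comment> \<open>Tilting by \<eta> shifts the height difference of two points whose components
    differ by r/2 by exactly \<epsilon>. After tilting in favour of Q, the component of the lowest
    point has passed at least to within r/2 of that of Q, hence is r/2 away from that of P.\<close>
  define \<eta> where "\<eta> = 2 * \<epsilon> / r"
  have \<eta>: "0 < \<eta>" using pos by (simp add: \<eta>_def)
  have anti: "p t \<le> p s" if "s \<le> t" for s t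
  proof (cases "s = t")
    case False
    then have "s < t" using that by simp
    then show ?thesis unfolding p_def using sel by (intro mono[of s t]) auto
  qed simp
  have bd: "p s - p t \<le> D" for s t
    using diam[OF sel(1)[of t] sel(1)[of s]] unfolding p_def by (simp add: algebra_simps)
  have "0 < r / 2" using pos by simp
  have "\<exists>A\<in>sets lborel. {t. r / 2 \<le> p (t - \<eta>) - p (t + \<eta>)} \<subseteq> A
      \<and> emeasure lborel A \<le> ennreal (6 * \<eta> * D / (r / 2))"
    using anti bd \<eta> \<open>0 < r / 2\<close> by (rule antimono_drop_measure)
  then obtain A where A: "A \<in> sets lborel"
    "{t. r / 2 \<le> p (t - \<eta>) - p (t + \<eta>)} \<subseteq> A" "emeasure lborel A \<le> ennreal (6 * \<eta> * D / (r / 2))"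
    by blast
  have "r / 2 \<le> p (t - \<eta>) - p (t + \<eta>)"
    if P: "P \<in> F" "\<forall>R\<in>F. val t P \<le> val t R" and Q: "Q \<in> F" "r \<le> \<bar>Re (e * (Q - P))\<bar>" "val t Q - val t P < \<epsilon>"
    for t P Q
  proof -
    have lo: "Re (e * P) \<le> p (t - \<eta>)"
      unfolding p_def using mono[of "t - \<eta>" t "sel (t - \<eta>)" P] sel P \<eta> by simp
    have hi: "p (t + \<eta>) \<le> Re (e * P)"
      unfolding p_def using mono[of t "t + \<eta>" P "sel (t + \<eta>)"] sel P \<eta> by simp
    have e_eq: "\<epsilon> = \<eta> * (r / 2)" using pos by (simp add: \<eta>_def)
    show ?thesis
    proof (cases "0 \<le> Re (e * (Q - P))")
      case True
      then have q: "Re (e * P) + r \<le> Re (e * Q)" using Q(2) by (simp add: algebra_simps)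
      have "val (t - \<eta>) (sel (t - \<eta>)) \<le> val (t - \<eta>) Q" using sel Q by simp
      moreover have "val t P \<le> val t (sel (t - \<eta>))" using sel P by simp
      ultimately have "\<eta> * (Re (e * Q) - p (t - \<eta>)) < \<eta> * (r / 2)"
        using Q(3) val_shift[of "t - \<eta>" Q t] val_shift[of "t - \<eta>" "sel (t - \<eta>)" t] e_eq
        unfolding p_def by (simp add: algebra_simps)
      then have "Re (e * Q) - p (t - \<eta>) < r / 2" using \<eta> by simp
      then show ?thesis using q hi by linarith
    next
      case False
      then have q: "Re (e * Q) + r \<le> Re (e * P)" using Q(2) by (simp add: algebra_simps)
      have "val (t + \<eta>) (sel (t + \<eta>)) \<le> val (t + \<eta>) Q" using sel Q by simp
      moreover have "val t P \<le> val t (sel (t + \<eta>))" using sel P by simp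
      ultimately have "\<eta> * (p (t + \<eta>) - Re (e * Q)) < \<eta> * (r / 2)"
        using Q(3) val_shift[of "t + \<eta>" Q t] val_shift[of "t + \<eta>" "sel (t + \<eta>)" t] e_eq
        unfolding p_def by (simp add: algebra_simps)
      then have "p (t + \<eta>) - Re (e * Q) < r / 2" using \<eta> by simp
      then show ?thesis using q lo by linarith
    qed
  qed
  then have "{t. \<exists>P\<in>F. \<exists>Q\<in>F. (\<forall>R\<in>F. val t P \<le> val t R) \<and> r \<le> \<bar>Re (e * (Q - P))\<bar> \<and> val t Q - val t P < \<epsilon>} \<subseteq> A"
    using A(2) by blast
  moreover have "Re ((z0 + of_real t * e) * (Q - P)) = val t Q - val t P" for t P Q
    unfolding val[symmetric] by (simp add: algebra_simps)
  moreover have "6 * \<eta> * D / (r / 2) = 24 * \<epsilon> * D / r^2" using pos by (simp add: \<eta>_def power2_eq_square)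
  ultimately show ?thesis using A(1,3) unfolding val by (intro bexI[of _ A]) auto
qed

context expanding_eigenvalue
begin

text \<open>
  With diameters of order \<open>b8 ^ (8 * k)\<close>, separation \<open>b8 ^ (7 * k)\<close> and gap \<open>b8 ^ (4 * k)\<close>, the exceptional
  directions at level \<open>k\<close> have measure of order \<open>b8 ^ ((4 + 8 - 2 * 7) * k)\<close>, which is summable.
\<close>

definition b8 :: real where "b8 = root 8 (norm \<beta>)"

lemma b8: "b8 ^ 8 = norm \<beta>" "1 < b8"
  using norm_beta(2) by (simp_all add: b8_def)

text \<open>Candidates for the displacement of one level-k block from another, divided by \<beta>^k.
  The set is finite and the same at every level.\<close>

definition offsets :: "nat \<Rightarrow> complex set" where
  "offsets N = eval3 \<beta> ` ({- int N..int N} \<times> {- int N..int N} \<times> {- int N..int N})"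

text \<open>Heights over two blocks, measured from the start of the first. They depend on the two
  letters and the offset alone, which removes the orbit from the measure estimate.\<close>

definition patch :: "nat \<Rightarrow> letter \<Rightarrow> letter \<Rightarrow> complex \<Rightarrow> complex set" where
  "patch k a c \<delta> = block k a \<union> (\<lambda>p. \<beta>^k * \<delta> + p) ` block k c"

text \<open>The separation is measured in a single direction \<open>e\<close> because the measure
  estimate lets z run along a line with direction \<open>e\<close>.\<close>

definition gap_at :: "nat \<Rightarrow> complex \<Rightarrow> complex \<Rightarrow> complex set \<Rightarrow> bool" where
  "gap_at k e z F \<longleftrightarrow> (\<forall>P\<in>F. \<forall>Q\<in>F. (\<forall>R\<in>F. Re (z * P) \<le> Re (z * R)) \<longrightarrow>
     b8 ^ (7 * k) \<le> \<bar>Re (e * (Q - P))\<bar> \<longrightarrow> b8 ^ (4 * k) \<le> Re (z * (Q - P)))"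

definition eventually_gap :: "nat \<Rightarrow> complex \<Rightarrow> complex \<Rightarrow> bool" where
  "eventually_gap N e z \<longleftrightarrow> (\<exists>k0. \<forall>k\<ge>k0. \<forall>a c. \<forall>\<delta>\<in>offsets N. gap_at k e z (patch k a c \<delta>))"

lemma finite_offsets [simp]: "finite (offsets N)"
  by (simp add: offsets_def)

lemma finite_patch [simp]: "finite (patch k a c \<delta>)"
  by (simp add: patch_def)

lemma patch_diameter:
  obtains C where "0 \<le> C" "\<And>k a c \<delta> P Q. \<delta> \<in> offsets N \<Longrightarrow> P \<in> patch k a c \<delta> \<Longrightarrow> Q \<in> patch k a c \<delta> \<Longrightarrow>
    norm (Q - P) \<le> C * b8 ^ (8 * k)"
proof -
  define M where "M = (\<Sum>\<delta>\<in>offsets N. norm \<delta>)"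
  have M: "norm \<delta> \<le> M" if "\<delta> \<in> offsets N" for \<delta>
    unfolding M_def using that by (intro member_le_sum) auto
  have M0: "0 \<le> M" unfolding M_def by (intro sum_nonneg) auto
  have pow: "norm \<beta> ^ k = b8 ^ (8 * k)" for k by (simp add: b8(1) power_mult)
  have bound: "norm P \<le> (block_bound + M) * b8 ^ (8 * k)" if "\<delta> \<in> offsets N" "P \<in> patch k a c \<delta>" for k a c \<delta> P
  proof -
    have blk: "norm p \<le> block_bound * b8 ^ (8 * k)" if "p \<in> block k d" for p d
      using norm_block_le[OF that] unfolding pow .
    have 1: "block_bound * b8 ^ (8 * k) \<le> (block_bound + M) * b8 ^ (8 * k)"
      using M0 b8(2) by (intro mult_right_mono) auto
    from that(2) consider "P \<in> block k a" | p where "P = \<beta>^k * \<delta> + p" "p \<in> block k c"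
      unfolding patch_def by blast
    then show ?thesis
    proof cases
      case 1
      then show ?thesis using blk[of P a] \<open>block_bound * _ \<le> _\<close> by linarith
    next
      case 2
      have "norm P \<le> norm (\<beta>^k * \<delta>) + norm p" unfolding 2 by (rule norm_triangle_ineq)
      also have "norm (\<beta>^k * \<delta>) = b8 ^ (8 * k) * norm \<delta>" by (simp add: norm_mult norm_power pow)
      also have "\<dots> \<le> b8 ^ (8 * k) * M" using M[OF that(1)] b8(2) by (intro mult_left_mono) auto
      finally show ?thesis using blk[OF 2(2)] by (simp add: algebra_simps)
    qed
  qed
  have "norm (Q - P) \<le> 2 * (block_bound + M) * b8 ^ (8 * k)"
    if "\<delta> \<in> offsets N" "P \<in> patch k a c \<delta>" "Q \<in> patch k a c \<delta>" for k a c \<delta> P Q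
  proof -
    have "norm (Q - P) \<le> (block_bound + M) * b8 ^ (8 * k) + (block_bound + M) * b8 ^ (8 * k)"
      using norm_triangle_ineq4[of Q P] bound[OF that(1,2)] bound[OF that(1,3)] by linarith
    then show ?thesis by (simp add: algebra_simps)
  qed
  then show ?thesis using that[of "2 * (block_bound + M)"] block_bound_nonneg M0 by auto
qed

lemma AE_line_gap: "AE t in lborel. eventually_gap N e (z0 + of_real t * e)"
proof -
  obtain C where C: "0 \<le> C" "\<And>k a c \<delta> P Q. \<delta> \<in> offsets N \<Longrightarrow> P \<in> patch k a c \<delta> \<Longrightarrow> Q \<in> patch k a c \<delta> \<Longrightarrow>
    norm (Q - P) \<le> C * b8 ^ (8 * k)" using patch_diameter[of N] by blast
  define I where "I = (UNIV :: letter set) \<times> (UNIV :: letter set) \<times> offsets N"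
  have finI: "finite I" by (simp add: I_def)
  define K where "K = 24 * (norm e * C)"
  have K: "0 \<le> K" using C by (simp add: K_def)
  define ok where "ok k a c \<delta> A \<longleftrightarrow> A \<in> sets lborel \<and> emeasure lborel A \<le> ennreal (K * (1 / b8^2) ^ k) \<and>
      {t. \<not> gap_at k e (z0 + of_real t * e) (patch k a c \<delta>)} \<subseteq> A" for k a c \<delta> A
  have ex: "\<exists>A. ok k a c \<delta> A" if "\<delta> \<in> offsets N" for k a c \<delta>
  proof -
    let ?bad = "{t. \<exists>P\<in>patch k a c \<delta>. \<exists>Q\<in>patch k a c \<delta>.
        (\<forall>R\<in>patch k a c \<delta>. Re ((z0 + of_real t * e) * P) \<le> Re ((z0 + of_real t * e) * R)) \<and>
        b8 ^ (7 * k) \<le> \<bar>Re (e * (Q - P))\<bar> \<and> Re ((z0 + of_real t * e) * (Q - P)) < b8 ^ (4 * k)}"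
    let ?bound = "24 * b8 ^ (4 * k) * (norm e * (C * b8 ^ (8 * k))) / (b8 ^ (7 * k))^2"
    have "\<bar>Re (e * (Q - P))\<bar> \<le> norm e * (C * b8 ^ (8 * k))"
      if "P \<in> patch k a c \<delta>" "Q \<in> patch k a c \<delta>" for P Q
    proof -
      have "\<bar>Re (e * (Q - P))\<bar> \<le> norm e * norm (Q - P)"
        using abs_Re_le_cmod[of "e * (Q - P)"] by (simp only: norm_mult)
      also have "\<dots> \<le> norm e * (C * b8 ^ (8 * k))"
        using C(2)[OF \<open>\<delta> \<in> offsets N\<close> that] by (intro mult_left_mono) auto
      finally show ?thesis .
    qed
    then have "\<exists>A\<in>sets lborel. emeasure lborel A \<le> ennreal ?bound \<and> ?bad \<subseteq> A"
      using b8(2) by (intro near_minimum_measure finite_patch) auto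
    then obtain A where A: "A \<in> sets lborel" "emeasure lborel A \<le> ennreal ?bound" "?bad \<subseteq> A"
      by blast
    have "?bound = K * (1 / b8^2) ^ k"
    proof -
      have "b8 ^ (4 * k) * b8 ^ (8 * k) * (b8^2) ^ k = (b8 ^ (7 * k))^2"
        by (simp flip: power_add power_mult)
      then show ?thesis using b8(2) by (simp add: K_def field_simps power_one_over)
    qed
    moreover have "{t. \<not> gap_at k e (z0 + of_real t * e) (patch k a c \<delta>)} \<subseteq> A"
      using A(3) unfolding gap_at_def by (fastforce simp: not_le simp del: times_complex.sel)
    ultimately have "ok k a c \<delta> A" using A(1,2) by (simp add: ok_def)
    then show ?thesis ..
  qed
  define A where "A k a c \<delta> = (SOME A. ok k a c \<delta> A)" for k a c \<delta>
  have A: "ok k a c \<delta> (A k a c \<delta>)" if "\<delta> \<in> offsets N" for k a c \<delta>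
    unfolding A_def using ex[OF that] by (rule someI_ex)
  define U where "U k = (\<Union>(a, c, \<delta>)\<in>I. A k a c \<delta>)" for k
  have U: "U k \<in> sets lborel" for k
    unfolding U_def using A finI by (intro sets.finite_UN) (auto simp: I_def ok_def)
  have bound: "emeasure lborel (U k) \<le> ennreal (real (card I) * K * (1 / b8^2) ^ k)" for k
  proof -
    have "emeasure lborel (U k) \<le> (\<Sum>i\<in>I. emeasure lborel (case i of (a, c, \<delta>) \<Rightarrow> A k a c \<delta>))"
      unfolding U_def using A finI by (intro emeasure_subadditive_finite) (auto simp: I_def ok_def)
    also have "\<dots> \<le> (\<Sum>i\<in>I. ennreal (K * (1 / b8^2) ^ k))"
      using A by (intro sum_mono) (auto simp: I_def ok_def)
    also have "\<dots> = ennreal (real (card I) * K * (1 / b8^2) ^ k)"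
      using K b8(2) by (simp add: ennreal_mult' ennreal_of_nat_eq_real_of_nat mult.assoc)
    finally show ?thesis .
  qed
  have finite: "emeasure lborel (U k) < \<infinity>" for k
    using bound[of k] ennreal_less_top order_le_less_trans by (metis infinity_ennreal_def)
  have "summable (\<lambda>k. real (card I) * K * (1 / b8^2) ^ k)"
    using b8(2) by (intro summable_mult summable_geometric) (simp add: power_one_over)
  then have "summable (\<lambda>k. measure lborel (U k))"
  proof (rule summable_comparison_test_ev[rotated])
    show "\<forall>\<^sub>F k in sequentially. norm (measure lborel (U k)) \<le> real (card I) * K * (1 / b8^2) ^ k"
      using bound K b8(2) by (intro always_eventually allI) (auto simp: measure_def intro!: enn2real_leI)
  qed
  from borel_cantelli_AE1[OF U finite this]
  show ?thesis
  proof eventually_elim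
    case (elim t)
    then obtain k0 where k0: "\<And>k. k0 \<le> k \<Longrightarrow> t \<notin> U k"
      unfolding eventually_sequentially by auto
    have "gap_at k e (z0 + of_real t * e) (patch k a c \<delta>)" if "k0 \<le> k" "\<delta> \<in> offsets N" for k a c \<delta>
      using k0[OF that(1)] A[OF that(2), of k a c] that(2) unfolding U_def I_def ok_def by fastforce
    then show ?case unfolding eventually_gap_def by blast
  qed
qed

lemma gap_measurable [measurable]: "Measurable.pred borel (eventually_gap N e)"
proof -
  have [measurable]: "(\<lambda>z. Re (z * P)) \<in> borel_measurable borel" for P :: complex
    by (intro borel_measurable_continuous_onI continuous_intros)
  have [measurable]: "Measurable.pred borel (\<lambda>z. gap_at k e z (patch k a c \<delta>))" for k a c \<delta>
    unfolding gap_at_def by (intro pred_intros_finite pred_intros_logic finite_patch) measurable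
  then show ?thesis
    unfolding eventually_gap_def[abs_def]
    by ((intro pred_intros_countable pred_intros_logic pred_intros_finite finite_offsets); measurable)
qed

text \<open>Fubini with the coordinate of \<open>b\<close> innermost: as it varies, z runs along a
  line with direction \<open>zf b\<close>, the very direction used in the gap condition.\<close>

lemma AE_PiM_gap:
  fixes zf :: "'v \<Rightarrow> complex"
  assumes B: "finite B" "b \<in> B"
  shows "AE x in (\<Pi>\<^sub>M b\<in>B. (lborel :: real measure)). eventually_gap N (zf b) (\<Sum>c\<in>B. of_real (x c) * zf c)"
proof -
  interpret product_sigma_finite "\<lambda>_::'v. lborel :: real measure" by standard
  define B' where "B' = B - {b}"
  have B': "B = insert b B'" "b \<notin> B'" "finite B'" using B by (auto simp: B'_def)
  let ?M = "\<Pi>\<^sub>M b\<in>B. (lborel :: real measure)"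
  let ?g = "\<lambda>x. eventually_gap N (zf b) (\<Sum>c\<in>B. of_real (x c) * zf c)"
  have lin: "(\<lambda>x. \<Sum>c\<in>B. complex_of_real (x c) * zf c) \<in> borel_measurable ?M"
    by measurable
  have pred: "Measurable.pred ?M ?g"
    using measurable_compose[OF lin gap_measurable] .
  have meas: "indicator {x. \<not> ?g x} \<in> borel_measurable ?M"
    using pred by measurable
  have "(\<integral>\<^sup>+ x. indicator {x. \<not> ?g x} x \<partial>?M) = (\<integral>\<^sup>+ x. (\<integral>\<^sup>+ y. indicator {x. \<not> ?g x} (x(b := y)) \<partial>lborel) \<partial>(\<Pi>\<^sub>M b\<in>B'. lborel))"
    using meas unfolding B'(1) by (intro product_nn_integral_insert B') simp
  also have "\<dots> = (\<integral>\<^sup>+ x. 0 \<partial>(\<Pi>\<^sub>M b\<in>B'. (lborel :: real measure)))"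
  proof (intro nn_integral_cong)
    fix x :: "'v \<Rightarrow> real"
    have sum: "(\<Sum>c\<in>B. of_real ((x(b := y)) c) * zf c) = (\<Sum>c\<in>B'. of_real (x c) * zf c) + of_real y * zf b" for y
      using B'(2,3) unfolding B'(1) by (subst sum.insert) (auto simp: add.commute intro!: sum.cong)
    have "AE y in lborel. indicator {x. \<not> ?g x} (x(b := y)) = (0 :: ennreal)"
      using AE_line_gap[of N "zf b" "\<Sum>c\<in>B'. of_real (x c) * zf c"] unfolding sum[symmetric]
      by eventually_elim auto
    then show "(\<integral>\<^sup>+ y. indicator {x. \<not> ?g x} (x(b := y)) \<partial>lborel) = 0"
      by (subst nn_integral_cong_AE[where v = "\<lambda>_. 0"]) auto
  qed
  finally have "(\<integral>\<^sup>+ x. indicator {x. \<not> ?g x} x \<partial>?M) = 0" by simp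
  then have "AE x in ?M. indicator {x. \<not> ?g x} x = (0 :: ennreal)"
    using meas by (simp add: nn_integral_0_iff_AE)
  then show ?thesis by eventually_elim (auto simp: indicator_def split: if_splits)
qed

end

section \<open>Blowing up an orbit\<close>

text \<open>\<open>w n\<close> is the length inserted at the n-th point of the orbit, and
  \<open>w_succ\<close> says that the slopes \<open>l\<close> carry each inserted interval to the
  next. Total weight 1 means that the inserted lengths account for all of [0, 1): the measure on the
  old interval is purely atomic.\<close>

locale orbit_weights =
  fixes x0 :: real and w :: "int \<Rightarrow> real" and l :: "letter \<Rightarrow> real"
  assumes x0: "x0 \<in> {0..<1}" and w_pos: "0 < w n" and l_pos: "0 < l a"
    and w_succ: "w (n + 1) = l (letter_of (orb x0 n)) * w n"
    and w_summable: "w summable_on UNIV" and w_total: "infsum w UNIV = 1"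
begin

definition mass :: "real set \<Rightarrow> real" where
  "mass B = infsum w {n. orb x0 n \<in> B}"

lemma w_summable_on [simp]: "w summable_on A"
  using w_summable summable_on_subset_banach by blast

lemma orb_x0_unit [simp]: "0 \<le> orb x0 n" "orb x0 n < 1"
  using orb_unit[of x0 n] x0 by auto

lemma mass_Un: "B \<inter> C = {} \<Longrightarrow> mass (B \<union> C) = mass B + mass C"
  unfolding mass_def by (subst infsum_Un_disjoint[symmetric]) (auto intro!: arg_cong[of _ _ "infsum w"])

lemma mass_nonneg: "0 \<le> mass B"
  unfolding mass_def using w_pos by (intro infsum_nonneg) (auto intro: less_imp_le)

lemma mass_mono: "B \<subseteq> C \<Longrightarrow> mass B \<le> mass C"
  using mass_Un[of B "C - B"] mass_nonneg[of "C - B"] by (simp add: Un_absorb1)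

lemma mass_orb: "mass {orb x0 n} = w n"
proof -
  have "{m. orb x0 m \<in> {orb x0 n}} = {n}" using orb_aperiodic[OF x0] by auto
  then show ?thesis by (simp add: mass_def)
qed

lemma mass_pos: "orb x0 n \<in> B \<Longrightarrow> 0 < mass B"
  using mass_mono[of "{orb x0 n}" B] mass_orb[of n] w_pos[of n] by simp

text \<open>Moving one step along the orbit multiplies each weight by the slope, so
  \<open>mass\<close> is a conformal measure for T.\<close>

lemma mass_image:
  assumes "B \<subseteq> {0..<1}" "\<And>x. x \<in> B \<Longrightarrow> letter_of x = a"
  shows "mass (T ` B) = l a * mass B"
proof -
  have "{n. orb x0 n \<in> T ` B} = (\<lambda>n. n + 1) ` {n. orb x0 n \<in> B}"
  proof safe
    fix n x assume x: "orb x0 n = T x" "x \<in> B"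
    then have "orb x0 (n - 1) \<in> B" by (simp add: orb_pred)
    then show "n \<in> (\<lambda>n. n + 1) ` {n. orb x0 n \<in> B}" by (intro image_eqI[of _ _ "n - 1"]) auto
  qed (auto simp: orb_succ)
  then have "mass (T ` B) = infsum (w \<circ> (\<lambda>n. n + 1)) {n. orb x0 n \<in> B}"
    unfolding mass_def by (simp add: infsum_reindex inj_on_def)
  also have "\<dots> = infsum (\<lambda>n. l a * w n) {n. orb x0 n \<in> B}"
    using assms by (intro infsum_cong) (auto simp: w_succ)
  also have "\<dots> = l a * mass B"
    unfolding mass_def by (intro infsum_cmult_right) auto
  finally show ?thesis .
qed

text \<open>Finitely many orbit points carry all but less than \<epsilon> of the weight. This gives
  the one-sided continuity of \<open>lower\<close> and \<open>upper\<close> where it is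
  needed.\<close>

lemma mass_small:
  assumes "0 < \<epsilon>"
  obtains A where "finite A" "\<And>B. (\<And>n. n \<in> A \<Longrightarrow> orb x0 n \<notin> B) \<Longrightarrow> mass B < \<epsilon>"
proof -
  have "(w has_sum 1) UNIV" using w_summable w_total by (metis has_sum_infsum)
  then have "\<forall>\<^sub>F A in finite_subsets_at_top UNIV. 1 - \<epsilon> < sum w A"
    unfolding has_sum_def by (rule order_tendstoD) (use assms in simp)
  then obtain A where A: "finite A" "1 - \<epsilon> < sum w A"
    by (auto simp: eventually_finite_subsets_at_top)
  show ?thesis
  proof (rule that[OF A(1)])
    fix B assume B: "\<And>n. n \<in> A \<Longrightarrow> orb x0 n \<notin> B"
    have "infsum w (A \<union> {n. orb x0 n \<in> B}) = infsum w A + infsum w {n. orb x0 n \<in> B}"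
      using B by (intro infsum_Un_disjoint) auto
    moreover have "infsum w (A \<union> {n. orb x0 n \<in> B}) \<le> infsum w UNIV"
      using w_pos by (intro infsum_mono_neutral) (auto intro: less_imp_le)
    ultimately show "mass B < \<epsilon>" using A w_total by (simp add: mass_def)
  qed
qed

text \<open>A point x is blown up to the interval from \<open>lower x\<close> to
  \<open>upper x\<close>, which is nondegenerate exactly when x is on the orbit of x0.\<close>

definition lower :: "real \<Rightarrow> real" where "lower x = mass {..<x}"
definition upper :: "real \<Rightarrow> real" where "upper x = mass {..x}"

lemma lower_0 [simp]: "lower 0 = 0"
proof -
  have "{n. orb x0 n < 0} = {}" using orb_x0_unit(1) not_less by blast
  then show ?thesis by (simp add: lower_def mass_def)
qed

lemma lower_1 [simp]: "lower 1 = 1"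
  by (simp add: lower_def mass_def w_total)

lemma lower_diff: "x \<le> y \<Longrightarrow> lower y - lower x = mass {x..<y}"
  unfolding lower_def using mass_Un[of "{..<x}" "{x..<y}"] by (simp add: ivl_disj_un_one ivl_disj_int_one)

lemma upper_eq: "upper x = lower x + mass {x}"
proof -
  have "{..x} = {..<x} \<union> {x}" by auto
  then show ?thesis unfolding lower_def upper_def using mass_Un[of "{..<x}" "{x}"] by (simp only:) simp
qed

lemma lower_upper_diff: "x < y \<Longrightarrow> lower y - upper x = mass {x<..<y}"
  unfolding lower_def upper_def using mass_Un[of "{..x}" "{x<..<y}"]
  by (simp add: ivl_disj_un_one ivl_disj_int_one)

lemma lower_le_upper: "lower x \<le> upper x"
  using upper_eq mass_nonneg by simp

lemma upper_less_lower:
  assumes "0 \<le> x" "x < y" "y \<le> 1"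
  shows "upper x < lower y"
proof -
  obtain n where "orb x0 n \<in> {x<..<y}" using orb_dense[OF x0 assms] by blast
  then show ?thesis using lower_upper_diff[OF assms(2)] mass_pos[of n "{x<..<y}"] by simp
qed

lemma lower_strict_mono: "0 \<le> x \<Longrightarrow> x < y \<Longrightarrow> y \<le> 1 \<Longrightarrow> lower x < lower y"
  using upper_less_lower lower_le_upper by (meson order_le_less_trans)

lemma lower_nonneg: "0 \<le> lower x"
  unfolding lower_def by (rule mass_nonneg)

lemma upper_less_1: "x \<in> {0..<1} \<Longrightarrow> upper x < 1"
  using upper_less_lower[of x 1] by simp

text \<open>The point is the supremum of those with \<open>lower\<close> at most y. Short intervals
  ending or beginning at it, itself excluded, have small mass, so a jump across y can only come from
  its own atom.\<close>

lemma fiber_exists: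
  assumes y: "y \<in> {0..<1}"
  obtains x where "x \<in> {0..<1}" "lower x \<le> y" "y \<le> upper x"
proof -
  define A where "A = {x \<in> {0..1}. lower x \<le> y}"
  define x where "x = Sup A"
  have A0: "0 \<in> A" using y by (simp add: A_def)
  have bdd: "bdd_above A" by (intro bdd_aboveI[of _ 1]) (auto simp: A_def)
  have x01: "0 \<le> x" "x \<le> 1"
  proof -
    show "0 \<le> x" unfolding x_def by (rule cSup_upper[OF A0 bdd])
    have "A \<noteq> {}" using A0 by blast
    then show "x \<le> 1" unfolding x_def by (rule cSup_least) (simp add: A_def)
  qed
  have lower_x: "lower x \<le> y"
  proof (rule field_le_epsilon)
    fix e :: real assume "0 < e"
    then obtain B where B: "finite B" "\<And>C. (\<And>n. n \<in> B \<Longrightarrow> orb x0 n \<notin> C) \<Longrightarrow> mass C < e"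
      by (rule mass_small) blast
    \<comment> \<open>The default -1 covers the case that no selected orbit point is below x; in
      every case none of them lies strictly between u and x.\<close>
    define u where "u = Max (insert (-1) {orb x0 n | n. n \<in> B \<and> orb x0 n < x})"
    have u: "u < x" "\<And>n. n \<in> B \<Longrightarrow> orb x0 n < x \<Longrightarrow> orb x0 n \<le> u"
      unfolding u_def using B(1) x01 by (auto intro!: Max_ge)
    show "lower x \<le> y + e"
    proof (cases "x = 0")
      case True
      then show ?thesis using y \<open>0 < e\<close> by simp
    next
      case False
      then obtain v where v: "v \<in> A" "max u 0 < v"
        using less_cSup_iff[OF _ bdd, of "max u 0"] A0 u(1) x01 unfolding x_def by auto
      have "v \<le> x" unfolding x_def by (rule cSup_upper[OF v(1) bdd])
      have "mass {v..<x} < e" using u(2) v by (intro B(2)) force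
      then show ?thesis using lower_diff[OF \<open>v \<le> x\<close>] v(1) by (simp add: A_def)
    qed
  qed
  have "x \<noteq> 1" using lower_x y by auto
  then have x: "x \<in> {0..<1}" using x01 by auto
  have "y \<le> upper x"
  proof (rule field_le_epsilon)
    fix e :: real assume "0 < e"
    then obtain B where B: "finite B" "\<And>C. (\<And>n. n \<in> B \<Longrightarrow> orb x0 n \<notin> C) \<Longrightarrow> mass C < e"
      by (rule mass_small) blast
    define u where "u = Min (insert 1 {orb x0 n | n. n \<in> B \<and> x < orb x0 n})"
    have u: "x < u" "u \<le> 1" "\<And>n. n \<in> B \<Longrightarrow> x < orb x0 n \<Longrightarrow> u \<le> orb x0 n"
      unfolding u_def using B(1) x by (auto intro!: Min_le)
    have "mass {x<..<u} < e" using u(3) by (intro B(2)) force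
    then have "lower u < upper x + e" using lower_upper_diff[OF u(1)] by simp
    moreover have "u \<notin> A" using cSup_upper[OF _ bdd, of u] u(1) by (auto simp: x_def)
    then have "y < lower u" using u x by (auto simp: A_def)
    ultimately show "y \<le> upper x + e" by simp
  qed
  then show ?thesis using that x lower_x by blast
qed

definition collapse :: "real \<Rightarrow> real" where
  "collapse y = (THE x. x \<in> {0..<1} \<and> lower x \<le> y \<and> y \<le> upper x)"

lemma fiber_unique:
  assumes "x \<in> {0..<1}" "lower x \<le> y" "y \<le> upper x" "x' \<in> {0..<1}" "lower x' \<le> y'" "y' \<le> upper x'" "y \<le> y'"
  shows "x \<le> x'"
  using upper_less_lower[of x' x] assms by force

lemma collapse_eq:
  assumes "x \<in> {0..<1}" "lower x \<le> y" "y \<le> upper x"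
  shows "collapse y = x"
  unfolding collapse_def
  by (rule the_equality) (use assms fiber_unique[of _ y _ y] in \<open>blast intro: antisym\<close>)+

lemma collapse:
  assumes "y \<in> {0..<1}"
  shows "collapse y \<in> {0..<1}" "lower (collapse y) \<le> y" "y \<le> upper (collapse y)"
  using fiber_exists[OF assms] collapse_eq by metis+

lemma collapse_mono: "y \<in> {0..<1} \<Longrightarrow> y' \<in> {0..<1} \<Longrightarrow> y \<le> y' \<Longrightarrow> collapse y \<le> collapse y'"
  using fiber_unique collapse by blast

lemma collapse_lower: "x \<in> {0..<1} \<Longrightarrow> collapse (lower x) = x"
  by (rule collapse_eq) (auto simp: lower_le_upper)

lemma lower_unit: "x \<in> {0..<1} \<Longrightarrow> lower x \<in> {0..<1}"
  using lower_nonneg upper_less_1[of x] lower_le_upper[of x] by auto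

lemma collapse_image: "collapse ` {0..<1} = {0..<1}"
proof
  show "{0..<1} \<subseteq> collapse ` {0..<1}"
  proof
    fix x :: real assume "x \<in> {0..<1}"
    then show "x \<in> collapse ` {0..<1}"
      using collapse_lower[of x] lower_unit[of x] by (intro image_eqI[of _ _ "lower x"]) simp_all
  qed
qed (use collapse(1) in blast)

text \<open>A monotone map with open range is continuous; extending by the identity outside [0, 1)
  makes the range the whole line.\<close>

lemma collapse_continuous: "continuous_on {0..<1} collapse"
proof -
  define H where "H y = (if y \<in> {0..<1} then collapse y else y)" for y
  have "continuous_on UNIV H"
  proof (rule continuous_onI_mono)
    have "z \<in> range H" for z
    proof (cases "z \<in> {0..<1}")
      case True
      then obtain y where "y \<in> {0..<1}" "z = collapse y" using collapse_image by blast
      then show ?thesis by (intro image_eqI[of _ _ y]) (auto simp: H_def)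
    next
      case False
      then show ?thesis by (intro image_eqI[of _ _ z]) (auto simp: H_def)
    qed
    then have "range H = UNIV" by blast
    then show "open (range H)" by simp
  next
    fix y y' :: real assume "y \<le> y'"
    then show "H y \<le> H y'"
      using collapse(1)[of y] collapse(1)[of y'] collapse_mono[of y y'] by (force simp: H_def)
  qed
  then have "continuous_on {0..<1} H" by (rule continuous_on_subset) simp
  then show ?thesis by (rule continuous_on_eq) (simp add: H_def)
qed

text \<open>The interval over x is mapped affinely onto the one over T x, with the slope dictated by
  the letter of x; where these are single points the formula returns the point over T x.\<close>

definition lift :: "real \<Rightarrow> real" where
  "lift y = lower (T (collapse y)) + l (letter_of (collapse y)) * (y - lower (collapse y))"

lemma mass_T: "x \<in> {0..<1} \<Longrightarrow> mass {T x} = l (letter_of x) * mass {x}"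
  using mass_image[of "{x}" "letter_of x"] by simp

lemma lift_fiber:
  assumes "y \<in> {0..<1}"
  shows "lower (T (collapse y)) \<le> lift y" "lift y \<le> upper (T (collapse y))"
proof -
  note c = collapse[OF assms]
  have pos: "0 < l (letter_of (collapse y))" by (rule l_pos)
  show "lower (T (collapse y)) \<le> lift y" using c pos by (simp add: lift_def)
  have "l (letter_of (collapse y)) * (y - lower (collapse y)) \<le> l (letter_of (collapse y)) * mass {collapse y}"
    using c pos upper_eq[of "collapse y"] by (intro mult_left_mono) auto
  then show "lift y \<le> upper (T (collapse y))"
    unfolding lift_def upper_eq mass_T[OF c(1)] by simp
qed

lemma collapse_lift:
  assumes "y \<in> {0..<1}"
  shows "lift y \<in> {0..<1}" "collapse (lift y) = T (collapse y)"
proof -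
  have Tc: "T (collapse y) \<in> {0..<1}" using collapse(1)[OF assms] by (simp del: atLeastLessThan_iff)
  show "lift y \<in> {0..<1}"
    using lift_fiber[OF assms] upper_less_1[OF Tc] lower_nonneg[of "T (collapse y)"] by auto
  show "collapse (lift y) = T (collapse y)"
    using Tc lift_fiber[OF assms] by (rule collapse_eq)
qed

lemma lift_bij: "bij_betw lift {0..<1} {0..<1}"
proof (rule bij_betwI')
  fix y y' :: real assume y: "y \<in> {0..<1}" "y' \<in> {0..<1}"
  show "lift y = lift y' \<longleftrightarrow> y = y'"
  proof
    assume eq: "lift y = lift y'"
    then have "T (collapse y) = T (collapse y')" using collapse_lift y by metis
    then have "collapse y = collapse y'" by (metis arnoux_yoccoz_inv(1))
    then show "y = y'" using eq l_pos[of "letter_of (collapse y)"] by (simp add: lift_def)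
  qed simp
next
  fix y' :: real assume y': "y' \<in> {0..<1}"
  define x where "x = T' (collapse y')"
  have Tx: "T x = collapse y'" by (simp add: x_def)
  have x: "x \<in> {0..<1}" using collapse(1)[OF y'] by (simp add: x_def del: atLeastLessThan_iff)
  define a where "a = letter_of x"
  define y where "y = lower x + (y' - lower (T x)) / l a"
  have a: "0 < l a" by (rule l_pos)
  have "lower x \<le> y" using collapse(2)[OF y'] a by (simp add: y_def Tx)
  moreover have "y \<le> upper x"
  proof -
    have "y' - lower (T x) \<le> l a * mass {x}"
      using collapse(3)[OF y'] upper_eq[of "T x"] mass_T[OF x] by (simp add: Tx a_def)
    then show ?thesis unfolding y_def upper_eq using a by (simp add: field_simps)
  qed
  ultimately have cy: "collapse y = x" and "y \<in> {0..<1}"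
    using collapse_eq[OF x] lower_nonneg[of x] upper_less_1[OF x] by auto
  moreover have "lift y = y'" unfolding lift_def cy a_def[symmetric] using a by (simp add: y_def)
  ultimately show "\<exists>y\<in>{0..<1}. y' = lift y" by auto
qed (use collapse_lift in blast)

lemma collapse_range:
  assumes "0 \<le> d" "d \<le> d'" "d' \<le> 1" "y \<in> {lower d..<lower d'}"
  shows "y \<in> {0..<1}" "collapse y \<in> {d..<d'}"
proof -
  have "lower d' \<le> 1" using lower_diff[of d' 1] mass_nonneg[of "{d'..<1}"] assms by simp
  then show y: "y \<in> {0..<1}" using assms lower_nonneg[of d] by auto
  note c = collapse[OF y]
  have "d \<le> collapse y"
    using upper_less_lower[of "collapse y" d] c assms by (force simp: not_less[symmetric])
  moreover have "collapse y < d'"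
  proof (rule ccontr)
    assume "\<not> collapse y < d'"
    then have "lower d' \<le> lower (collapse y)"
      using lower_diff[of d' "collapse y"] mass_nonneg[of "{d'..<collapse y}"] by simp
    then show False using c assms by simp
  qed
  ultimately show "collapse y \<in> {d..<d'}" by simp
qed

text \<open>
  The right end \<open>x = d'\<close> is allowed, which matches the two pieces of \<^const>\<open>L2\<close> modulo 1 in \<open>lift_affine_L2\<close>.
\<close>

lemma mass_translate:
  assumes "letter_lo a \<le> d" "d' \<le> letter_hi a" "\<And>x. x \<in> {d..<d'} \<Longrightarrow> T x = x + \<tau>" "d \<le> x" "x \<le> d'"
  shows "lower (x + \<tau>) - lower (d + \<tau>) = l a * (lower x - lower d)"
proof -
  have "T ` {d..<x} = (\<lambda>u. u + \<tau>) ` {d..<x}"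
    using assms by (intro image_cong) auto
  also have "\<dots> = {d + \<tau>..<x + \<tau>}" by (simp add: image_add_atLeastLessThan')
  finally have "mass {d + \<tau>..<x + \<tau>} = l a * mass {d..<x}"
    using mass_image[of "{d..<x}" a] assms letter_lo_nonneg[of a] letter_hi_le_1[of a]
    by (force intro!: letter_of_eq)
  then show ?thesis using lower_diff[of d x] lower_diff[of "d + \<tau>" "x + \<tau>"] assms by simp
qed

text \<open>Although \<open>lift\<close> is defined fibre by fibre, T scales the mass between fibres
  by the same factor \<open>l a\<close>, so the pieces fit into one affine map.\<close>

lemma lift_affine:
  assumes d: "letter_lo a \<le> d" "d \<le> d'" "d' \<le> letter_hi a" and tr: "\<And>x. x \<in> {d..<d'} \<Longrightarrow> T x = x + \<tau>"
    and y: "y \<in> {lower d..<lower d'}"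
  shows "lift y = l a * y + (lower (d + \<tau>) - l a * lower d)"
proof -
  have "0 \<le> d" "d' \<le> 1" using d letter_lo_nonneg[of a] letter_hi_le_1[of a] by auto
  note c = collapse_range[OF this(1) d(2) this(2) y]
  have "letter_of (collapse y) = a" using c(2) d by (intro letter_of_eq) auto
  moreover have "lower (collapse y + \<tau>) - lower (d + \<tau>) = l a * (lower (collapse y) - lower d)"
    using c(2) d tr by (intro mass_translate[of a d d']) auto
  ultimately show ?thesis
    unfolding lift_def using tr[OF c(2)] by (simp add: algebra_simps)
qed

lemma lift_affine_letter:
  assumes "a \<noteq> L2" "y \<in> {lower (letter_lo a)..<lower (letter_hi a)}"
  shows "lift y = l a * y + (lower (letter_lo a + letter_shift a) - l a * lower (letter_lo a))"
proof (rule lift_affine[where d = "letter_lo a" and d' = "letter_hi a"])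
  show "T x = x + letter_shift a" if "x \<in> {letter_lo a..<letter_hi a}" for x
    using that assms(1) T_eq_shift[of a x] by simp
qed (use assms letter_lo_less_hi[of a] in auto)

text \<open>The constant is normalized at the break, whose image is 1 from the left and 0 from the
  right. It therefore differs by exactly 1 from the constant on the other half of
  \<open>L2\<close>.\<close>

lemma lift_affine_L2:
  assumes "y \<in> {lower (letter_lo L2)..<lower ((1 - \<alpha>) / 2)}"
  shows "lift y = l L2 * y + (1 - l L2 * lower ((1 - \<alpha>) / 2))"
proof -
  have d: "letter_lo L2 \<le> letter_lo L2" "letter_lo L2 \<le> (1 - \<alpha>) / 2" "(1 - \<alpha>) / 2 \<le> letter_hi L2"
    using ay_alpha_bounds by (auto simp: field_simps)
  have tr: "T x = x + letter_shift L2" if "x \<in> {letter_lo L2..<(1 - \<alpha>) / 2}" for x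
    using that d T_eq_shift[of L2 x] by (auto simp del: letter_lo.simps letter_hi.simps)
  have "(1 - \<alpha>) / 2 + letter_shift L2 = 1" by (simp add: field_simps)
  then show ?thesis
    using lift_affine[OF d tr assms] mass_translate[OF d(1,3) tr d(2) order_refl]
    by (simp add: algebra_simps)
qed

lemma lift_affine_L2':
  assumes "y \<in> {lower ((1 - \<alpha>) / 2)..<lower (letter_hi L2)}"
  shows "lift y = l L2 * y - l L2 * lower ((1 - \<alpha>) / 2)"
proof -
  have d: "letter_lo L2 \<le> (1 - \<alpha>) / 2" "(1 - \<alpha>) / 2 \<le> letter_hi L2" "letter_hi L2 \<le> letter_hi L2"
    using ay_alpha_bounds by (auto simp: field_simps)
  have tr: "T x = x + (letter_shift L2 - 1)" if "x \<in> {(1 - \<alpha>) / 2..<letter_hi L2}" for x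
    using that d T_eq_shift[of L2 x] by (auto simp del: letter_lo.simps letter_hi.simps)
  have "(1 - \<alpha>) / 2 + (letter_shift L2 - 1) = 0" by (simp add: field_simps)
  then show ?thesis using lift_affine[OF d tr assms] by simp
qed

lemma affine_iem_lift: "affine_iem lift"
  unfolding affine_iem_def
proof (intro conjI exI)
  \<comment> \<open>Here \<open>L2\<close> is cut at the break, since the ten pieces must be affine
    in [0, 1) itself and not only on the circle.\<close>
  define d where "d = [0, letter_hi L1, (1 - \<alpha>) / 2, letter_hi L2, letter_hi L3, letter_hi L4, letter_hi L5,
    letter_hi L6, letter_hi L7, letter_hi L8, 1]"
  define p where "p i = lower (d ! i)" for i
  show "bij_betw lift {0..<1} {0..<1}" by (rule lift_bij)
  show "p 0 = 0" "p 10 = 1" by (simp_all add: p_def d_def)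
  have cases10: "i = 0 \<or> i = 1 \<or> i = 2 \<or> i = 3 \<or> i = 4 \<or> i = 5 \<or> i = 6 \<or> i = 7 \<or> i = 8 \<or> i = 9"
    if "i < 10" for i :: nat using that by presburger
  show "\<forall>i<10. p i < p (Suc i)"
  proof (intro allI impI)
    fix i :: nat assume "i < 10"
    from cases10[OF this] have "0 \<le> d ! i \<and> d ! i < d ! Suc i \<and> d ! Suc i \<le> 1"
      using ay_alpha_bounds by (elim disjE) (auto simp: d_def field_simps)
    then show "p i < p (Suc i)" unfolding p_def by (intro lower_strict_mono) auto
  qed
  show "\<forall>i<10. \<exists>s>0. \<exists>c. \<forall>x\<in>{p i..<p (Suc i)}. lift x = s * x + c"
  proof (intro allI impI)
    fix i :: nat assume i: "i < 10"
    have letter: "\<exists>s>0. \<exists>c. \<forall>x\<in>{p i..<p (Suc i)}. lift x = s * x + c"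
      if a: "p i = lower (letter_lo a)" "p (Suc i) = lower (letter_hi a)" "a \<noteq> L2" for a
    proof (intro exI conjI ballI)
      show "0 < l a" by (rule l_pos)
      show "lift x = l a * x + (lower (letter_lo a + letter_shift a) - l a * lower (letter_lo a))"
        if "x \<in> {p i..<p (Suc i)}" for x
        using that lift_affine_letter[OF a(3), of x] a by simp
    qed
    from cases10[OF i] show "\<exists>s>0. \<exists>c. \<forall>x\<in>{p i..<p (Suc i)}. lift x = s * x + c"
    proof (elim disjE)
      assume "i = 1"
      then have "p i = lower (letter_lo L2)" "p (Suc i) = lower ((1 - \<alpha>) / 2)" by (simp_all add: p_def d_def)
      then have "\<forall>x\<in>{p i..<p (Suc i)}. lift x = l L2 * x + (1 - l L2 * lower ((1 - \<alpha>) / 2))"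
        using lift_affine_L2 by simp
      then show ?thesis using l_pos[of L2] by blast
    next
      assume "i = 2"
      then have "p i = lower ((1 - \<alpha>) / 2)" "p (Suc i) = lower (letter_hi L2)" by (simp_all add: p_def d_def)
      then have "\<forall>x\<in>{p i..<p (Suc i)}. lift x = l L2 * x + (- l L2 * lower ((1 - \<alpha>) / 2))"
        using lift_affine_L2' by simp
      then show ?thesis using l_pos[of L2] by blast
    qed (rule letter[of L1] letter[of L3] letter[of L4] letter[of L5] letter[of L6] letter[of L7]
        letter[of L8] letter[of L9]; simp add: p_def d_def; fail)+
  qed
qed

lemma has_slope_vector_lift: "has_slope_vector lift (\<chi> a. l a)"
  unfolding has_slope_vector_def
proof (intro exI conjI)
  define d where "d = [0, letter_hi L1, letter_hi L2, letter_hi L3, letter_hi L4, letter_hi L5,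
    letter_hi L6, letter_hi L7, letter_hi L8, 1]"
  define p where "p i = lower (d ! i)" for i
  have p_letter: "p (letter_number a - 1) = lower (letter_lo a)" "p (letter_number a) = lower (letter_hi a)" for a
    by (cases a; simp add: p_def d_def)+
  show "p 0 = 0" "p 9 = 1" by (simp_all add: p_def d_def)
  show "\<forall>i<9. p i < p (Suc i)"
  proof (intro allI impI)
    fix i :: nat assume "i < 9"
    then have "i \<in> {0, 1, 2, 3, 4, 5, 6, 7, 8}" by auto
    then have "0 \<le> d ! i \<and> d ! i < d ! Suc i \<and> d ! Suc i \<le> 1"
      using ay_alpha_bounds by (auto simp: d_def field_simps)
    then show "p i < p (Suc i)" unfolding p_def by (intro lower_strict_mono) auto
  qed
  have frac: "lift y = frac (lift y + of_int k)" if "y \<in> {lower (letter_lo a)..<lower (letter_hi a)}" for y k a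
  proof -
    have "y \<in> {0..<1}"
      using collapse_range(1)[OF letter_lo_nonneg _ letter_hi_le_1 that] letter_lo_less_hi[of a] by simp
    then have "lift y \<in> {0..<1}" by (rule collapse_lift)
    then have "frac (lift y + of_int k) = lift y" by (simp add: frac_unique_iff)
    then show ?thesis by simp
  qed
  show "\<forall>a. \<exists>c. \<forall>x\<in>{p (letter_number a - 1)..<p (letter_number a)}. lift x = frac ((\<chi> a. l a) $ a * x + c)"
  proof
    fix a
    show "\<exists>c. \<forall>x\<in>{p (letter_number a - 1)..<p (letter_number a)}. lift x = frac ((\<chi> a. l a) $ a * x + c)"
    proof (cases "a = L2")
      case False
      then show ?thesis
        unfolding p_letter using lift_affine_letter[OF False] frac[of _ a 0]
        by (intro exI[of _ "lower (letter_lo a + letter_shift a) - l a * lower (letter_lo a)"]) fastforce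
    next
      case True
      have "lift y = frac (l L2 * y + (1 - l L2 * lower ((1 - \<alpha>) / 2)))"
        if y: "y \<in> {lower (letter_lo L2)..<lower (letter_hi L2)}" for y
      proof (cases "y < lower ((1 - \<alpha>) / 2)")
        case True
        then show ?thesis using lift_affine_L2[of y] y frac[OF y, of 0] by simp
      next
        case False
        then have e: "lift y + of_int 1 = l L2 * y + (1 - l L2 * lower ((1 - \<alpha>) / 2))"
          using lift_affine_L2'[of y] y by simp
        show ?thesis using frac[OF y, of 1] unfolding e .
      qed
      then show ?thesis unfolding True p_letter by auto
    qed
  qed
qed

lemma semiconjugate_lift: "semiconjugate lift T"
  unfolding semiconjugate_def
  using collapse_continuous collapse_image collapse_mono collapse_lift(2)
  by (intro exI[of _ collapse]) (auto simp: mono_on_def)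

text \<open>The n-th iterate stays in the fibre over \<open>orb x0 n\<close>, and distinct orbit
  points have disjoint fibres.\<close>

lemma wandering_interval_lift: "wandering_interval lift {lower x0..upper x0}"
  unfolding wandering_interval_def
proof (intro conjI)
  have orb0: "mass {x0} = w 0" using mass_orb[of 0] by simp
  show sub: "{lower x0..upper x0} \<subseteq> {0..<1}"
    using lower_nonneg[of x0] upper_less_1[OF x0] by auto
  show "is_interval {lower x0..upper x0}" by (rule is_interval_cc)
  show "\<exists>x\<in>{lower x0..upper x0}. \<exists>y\<in>{lower x0..upper x0}. x < y"
    using upper_eq[of x0] w_pos[of 0] orb0 by (intro bexI[of _ "lower x0"] bexI[of _ "upper x0"]) auto
  have fwd: "(lift ^^ k) y \<in> {0..<1} \<and> collapse ((lift ^^ k) y) = orb x0 (int k)"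
    if "y \<in> {lower x0..upper x0}" for y k
  proof (induction k)
    case 0
    then show ?case using that sub collapse_eq[OF x0] by auto
  next
    case (Suc k)
    then show ?case using collapse_lift[of "(lift ^^ k) y"] orb_succ[of x0 "int k"]
      by (simp add: add.commute)
  qed
  have bwd: "(inv_into {0..<1} lift ^^ k) y \<in> {0..<1} \<and> collapse ((inv_into {0..<1} lift ^^ k) y) = orb x0 (- int k)"
    if "y \<in> {lower x0..upper x0}" for y k
  proof (induction k)
    case 0
    then show ?case using that sub collapse_eq[OF x0] by auto
  next
    case (Suc k)
    define u where "u = (inv_into {0..<1} lift ^^ k) y"
    have u: "u \<in> {0..<1}" "collapse u = orb x0 (- int k)" using Suc by (auto simp: u_def)
    have im: "u \<in> lift ` {0..<1}" using lift_bij u by (simp add: bij_betw_def)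
    define v where "v = inv_into {0..<1} lift u"
    have v: "v \<in> {0..<1}" "lift v = u"
      unfolding v_def using inv_into_into[OF im] f_inv_into_f[OF im] by auto
    have "T (collapse v) = orb x0 (- int k)" using collapse_lift(2)[OF v(1)] v u by simp
    then have "collapse v = orb x0 (- int (Suc k))"
      using orb_pred[of x0 "- int k"] by (metis arnoux_yoccoz_inv(1) minus_add_distrib of_nat_Suc
          add.commute uminus_add_conv_diff)
    then show ?case using v by (simp add: u_def v_def)
  qed
  have "collapse (int_iterate lift n y) = orb x0 n" if "y \<in> {lower x0..upper x0}" for n y
    using fwd[OF that, of "nat n"] bwd[OF that, of "nat (- n)"] by (auto simp: int_iterate_def)
  then have sub: "int_iterate lift n ` {lower x0..upper x0} \<subseteq> {y. collapse y = orb x0 n}" for n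
    by blast
  show "disjoint_family (\<lambda>n. int_iterate lift n ` {lower x0..upper x0})"
    unfolding disjoint_family_on_def
  proof (intro ballI impI)
    fix m n :: int assume "m \<noteq> n"
    then have "orb x0 m \<noteq> orb x0 n" using orb_aperiodic[OF x0] by blast
    then have "{y. collapse y = orb x0 m} \<inter> {y. collapse y = orb x0 n} = {}" by auto
    then show "int_iterate lift m ` {lower x0..upper x0} \<inter> int_iterate lift n ` {lower x0..upper x0} = {}"
      using sub[of m] sub[of n] by blast
  qed
qed

end

section \<open>Summability along the extremal orbit\<close>

lemma summable_on_times:
  fixes f :: "'a \<Rightarrow> real" and g :: "'b \<Rightarrow> real"
  assumes "f summable_on A" "g summable_on B" "\<And>x. 0 \<le> f x" "\<And>y. 0 \<le> g y"
  shows "(\<lambda>(x, y). f x * g y) summable_on A \<times> B"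
proof (rule summable_on_SigmaI)
  show "((\<lambda>y. case (x, y) of (x, y) \<Rightarrow> f x * g y) has_sum f x * infsum g B) B" for x
    using has_sum_cmult_right[OF has_sum_infsum[OF assms(2)]] by simp
  show "(\<lambda>x. f x * infsum g B) summable_on A"
    using assms(1) by (rule summable_on_cmult_left)
qed (use assms in auto)

lemma summable_inverse_square: "(\<lambda>i::int. 1 / (1 + \<bar>real_of_int i\<bar>)^2) summable_on UNIV"
proof -
  let ?f = "\<lambda>i::int. 1 / (1 + \<bar>real_of_int i\<bar>)^2"
  have "summable (\<lambda>n. inverse (real n ^ 2))" by (rule inverse_power_summable) simp
  then have "summable (\<lambda>n. inverse (real (Suc n) ^ 2))" by (subst summable_Suc_iff)
  then have s: "summable (\<lambda>n. norm (1 / (1 + real n)^2))" by (simp add: field_simps)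
  have 1: "?f summable_on range int"
    using norm_summable_imp_summable_on[OF s] by (subst summable_on_reindex) (auto simp: comp_def)
  have 2: "?f summable_on range (\<lambda>n. - int n)"
    using norm_summable_imp_summable_on[OF s] by (subst summable_on_reindex) (auto simp: comp_def inj_on_def)
  have "i \<in> range int \<union> range (\<lambda>n. - int n)" for i
    by (cases i rule: int_cases2) auto
  then have "UNIV = range int \<union> range (\<lambda>n. - int n)" by blast
  then show ?thesis using summable_on_union[OF 1 2] by simp
qed

text \<open>The exponent 12 serves for u of the order of the square root of norm S, so as to yield
  the sixth power of norm S.\<close>

lemma exp_minus_le_power:
  fixes u :: real
  assumes "0 < u"
  shows "exp (- u) \<le> 12^12 / u^12"
proof -
  have "u / 12 \<le> exp (u / 12)" using exp_ge_add_one_self[of "u / 12"] by linarith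
  then have "(u / 12)^12 \<le> exp (u / 12)^12" using assms by (intro power_mono) auto
  also have "\<dots> = exp u" by (simp flip: exp_of_nat_mult)
  finally have "u^12 \<le> 12^12 * exp u" by (simp add: power_divide field_simps)
  then show ?thesis using assms by (simp add: exp_minus field_simps)
qed

context expanding_eigenvalue
begin

text \<open>The first summand is norm \<beta>, the ratio of consecutive scales; the rest allows for
  the positions of the two points inside their blocks.\<close>

definition gap_radius :: real where
  "gap_radius = b8^8 + 2 * (block_bound)"

text \<open>One bound for all points and times: the almost sure gap condition must be fixed before
  the extremal point is known.\<close>

definition gap_size :: nat where
  "gap_size = (SOME N. \<forall>y\<in>{0..<1}. \<forall>j. norm (S y j) \<le> gap_radius \<longrightarrow> S y j \<in> offsets N)"

lemma offset_mem:
  assumes "y \<in> {0..<1}" "norm (S y j) \<le> gap_radius"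
  shows "S y j \<in> offsets gap_size"
proof -
  obtain K where K: "0 \<le> K"
    "\<And>x n. x \<in> {0..<1} \<Longrightarrow> real_of_int (size3 (cocycle vec3 x n)) \<le> K * (1 + norm (S x n))"
    by (rule size3_bounded, rule that)
  obtain N :: nat where N: "K * (1 + gap_radius) \<le> real N" using real_arch_simple by blast
  have "S y j \<in> offsets N" if y: "y \<in> {0..<1}" and le: "norm (S y j) \<le> gap_radius" for y j
  proof -
    have "K * (1 + norm (S y j)) \<le> K * (1 + gap_radius)" using K(1) le by (intro mult_left_mono) auto
    then have "K * (1 + norm (S y j)) \<le> real N" using N by linarith
    then have "real_of_int (size3 (cocycle vec3 y j)) \<le> real N" using K(2)[OF y, of j] by linarith
    then have "size3 (cocycle vec3 y j) \<le> int N" by linarith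
    then show ?thesis
      unfolding S_def offsets_def
      by (intro imageI) (auto simp: size3_def mem_Times_iff abs_le_iff)
  qed
  then have "\<exists>N. \<forall>y\<in>{0..<1}. \<forall>j. norm (S y j) \<le> gap_radius \<longrightarrow> S y j \<in> offsets N"
    by blast
  then have "\<forall>y\<in>{0..<1}. \<forall>j. norm (S y j) \<le> gap_radius \<longrightarrow> S y j \<in> offsets gap_size"
    unfolding gap_size_def by (rule someI_ex)
  then show ?thesis using assms by blast
qed

text \<open>At scale norm \<beta> ^ k, up to the next scale, the height is at least norm \<beta> ^
  (k/2), since b8^8 = norm \<beta>.\<close>

definition grows_from :: "nat \<Rightarrow> complex \<Rightarrow> real \<Rightarrow> bool" where
  "grows_from k1 z x \<longleftrightarrow> (\<forall>k\<ge>k1. \<forall>n. b8 ^ (8 * k) \<le> norm (S x n) \<longrightarrow> norm (S x n) \<le> b8 ^ (8 * k) * b8^8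
    \<longrightarrow> b8 ^ (4 * k) \<le> Re (z * S x n))"

text \<open>Place x0 and its n-th iterate into level-k blocks. At this scale their offset is one of
  finitely many, and extremality makes x0 lowest in the resulting patch. Some direction in Z sees
  the separation up to the factor \<kappa>, and its gap condition applies.\<close>

lemma extremal_growth:
  assumes x0: "x0 \<in> {0..<1}" and ext: "\<And>n. 0 \<le> Re (z * S x0 n)"
    and \<kappa>: "0 < \<kappa>" "\<And>u. \<exists>e\<in>Z. \<kappa> * norm u \<le> \<bar>Re (e * u)\<bar>"
    and Z: "finite Z" "\<And>e. e \<in> Z \<Longrightarrow> eventually_gap gap_size e z"
  obtains k1 where "grows_from k1 z x0"
proof -
  have "\<exists>k0. \<forall>k\<ge>k0. \<forall>a c. \<forall>\<delta>\<in>offsets gap_size. gap_at k e z (patch k a c \<delta>)" if "e \<in> Z" for e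
    using Z(2)[OF that] unfolding eventually_gap_def .
  then obtain k0 where k0: "\<And>e k a c \<delta>. e \<in> Z \<Longrightarrow> k0 e \<le> k \<Longrightarrow> \<delta> \<in> offsets gap_size \<Longrightarrow> gap_at k e z (patch k a c \<delta>)"
    by metis
  \<comment> \<open>From this level on \<kappa> * b8 ^ k is at least 1, so weakening the separation
    from b8 ^ (8 * k) to b8 ^ (7 * k) absorbs \<kappa>.\<close>
  obtain k2 where k2: "1 / \<kappa> < b8 ^ k2" using real_arch_pow[OF b8(2)] by blast
  define k1 where "k1 = Max (insert k2 (k0 ` Z))"
  have k1: "k2 \<le> k1" "\<And>e. e \<in> Z \<Longrightarrow> k0 e \<le> k1" unfolding k1_def using Z(1) by (auto intro: Max_ge)
  show ?thesis
  proof (rule that, unfold grows_from_def, intro allI impI)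
    fix k n
    assume k: "k1 \<le> k" and lo: "b8 ^ (8 * k) \<le> norm (S x0 n)" and hi: "norm (S x0 n) \<le> b8 ^ (8 * k) * b8^8"
    obtain y i0 where y: "y \<in> {0..<1}" "x0 = orb ((renorm ^^ k) y) i0" "0 \<le> i0" "i0 < tower k (letter_of y)"
      using renorm_cover[OF x0] by metis
    define P where "P = S ((renorm ^^ k) y) i0"
    have P_block: "P \<in> block k (letter_of y)"
      using S_block[OF y(1), of "nat i0" k] y(3,4) unfolding P_def block_def by auto
    have S_x0: "S ((renorm ^^ k) y) (i0 + m) = P + S x0 m" for m
      by (simp add: S_add y(2) P_def)
    obtain j p where j: "p \<in> block k (letter_of (orb y j))" "S ((renorm ^^ k) y) (i0 + n) = \<beta>^k * S y j + p"
      using S_in_block[OF y(1), of k "i0 + n"] by metis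
    define Q where "Q = P + S x0 n"
    have Q: "Q = \<beta>^k * S y j + p" using S_x0[of n] j(2) by (simp add: Q_def)
    have pow: "norm \<beta> ^ k = b8 ^ (8 * k)" by (simp add: b8(1) power_mult)
      have "norm (S y j) \<le> gap_radius"
    proof -
      have "\<beta>^k * S y j = S x0 n + P - p" using Q by (simp add: Q_def algebra_simps)
      then have "b8 ^ (8 * k) * norm (S y j) = norm (S x0 n + P - p)"
        by (metis norm_mult norm_power pow)
      also have "\<dots> \<le> norm (S x0 n) + norm P + norm p"
        using norm_triangle_ineq4[of "S x0 n + P" p] norm_triangle_ineq[of "S x0 n" P] by linarith
      also have "\<dots> \<le> b8 ^ (8 * k) * b8^8 + block_bound * b8 ^ (8 * k) + block_bound * b8 ^ (8 * k)"
        using hi norm_block_le[OF P_block] norm_block_le[OF j(1)] unfolding pow by linarith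
      also have "\<dots> = b8 ^ (8 * k) * gap_radius" by (simp add: gap_radius_def algebra_simps)
      finally show ?thesis using b8(2) by simp
    qed
    then have \<delta>: "S y j \<in> offsets gap_size" using y(1) by (intro offset_mem)
    define F where "F = patch k (letter_of y) (letter_of (orb y j)) (S y j)"
    have PF: "P \<in> F" using P_block by (simp add: F_def patch_def)
    have QF: "Q \<in> F" using j(1) Q by (simp add: F_def patch_def)
    have min: "Re (z * P) \<le> Re (z * R)" if "R \<in> F" for R
    proof -
      have "\<exists>m. S ((renorm ^^ k) y) m = R"
      proof -
        from that consider "R \<in> block k (letter_of y)"
          | q where "R = \<beta>^k * S y j + q" "q \<in> block k (letter_of (orb y j))"
          unfolding F_def patch_def by blast
        then show ?thesis
        proof cases
          case 1
          then show ?thesis using block_in_S[OF y(1), of R k 0] by auto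
        next
          case 2
          then show ?thesis using block_in_S[OF y(1) 2(2)] by metis
        qed
      qed
      then obtain m where "S ((renorm ^^ k) y) m = R" by blast
      then have "R = P + S x0 (m - i0)" using S_x0[of "m - i0"] by simp
      then have "Re (z * R) = Re (z * P) + Re (z * S x0 (m - i0))" by (simp add: algebra_simps)
      then show ?thesis using ext[of "m - i0"] by linarith
    qed
    obtain e where e: "e \<in> Z" "\<kappa> * norm (S x0 n) \<le> \<bar>Re (e * S x0 n)\<bar>" using \<kappa>(2) by blast
    have "b8 ^ (7 * k) \<le> \<bar>Re (e * (Q - P))\<bar>"
    proof -
      have "b8 ^ k2 \<le> b8 ^ k" using k k1(1) b8(2) by (intro power_increasing) auto
      then have "\<kappa> * b8 ^ k2 \<le> \<kappa> * b8 ^ k" using \<kappa>(1) by (intro mult_left_mono) auto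
      moreover have "1 < \<kappa> * b8 ^ k2" using k2 \<kappa>(1) by (simp add: field_simps)
      ultimately have "1 \<le> \<kappa> * b8 ^ k" by linarith
      then have "b8 ^ (7 * k) * 1 \<le> b8 ^ (7 * k) * (\<kappa> * b8 ^ k)"
        using b8(2) by (intro mult_left_mono) auto
      also have "\<dots> = \<kappa> * b8 ^ (8 * k)" by (simp flip: power_add)
      also have "\<dots> \<le> \<kappa> * norm (S x0 n)" using lo \<kappa>(1) by (intro mult_left_mono) auto
      finally show ?thesis using e(2) by (simp add: Q_def)
    qed
    moreover have "gap_at k e z F" unfolding F_def using k0[OF e(1) _ \<delta>] k k1(2)[OF e(1)] by simp
    ultimately have "b8 ^ (4 * k) \<le> Re (z * (Q - P))"
      unfolding gap_at_def using PF QF min by blast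
    then show "b8 ^ (4 * k) \<le> Re (z * S x0 n)" by (simp add: Q_def)
  qed
qed

lemma extremal_decay:
  assumes ext: "\<And>n. 0 \<le> Re (z * S x0 n)"
    and growth: "grows_from k1 z x0"
  obtains C where "0 \<le> C" "\<And>n. exp (- Re (z * S x0 n)) \<le> C / (1 + norm (S x0 n))^6"
proof -
  define B where "B = norm \<beta>"
  have B: "1 < B" "B = b8^8" using norm_beta(2) b8(1) by (auto simp: B_def)
  have pow: "B ^ k = b8 ^ (8 * k)" for k by (simp add: B(2) power_mult)
  define C1 where "C1 = (1 + B ^ k1)^6"
  define C2 where "C2 = 64 * B^6 * (12::real)^12"
  have C: "0 \<le> C1" "0 \<le> C2" using B by (auto simp: C1_def C2_def)
  show ?thesis
  proof (rule that)
    show "0 \<le> C1 + C2" using C by simp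
    fix n
    define s where "s = norm (S x0 n)"
    define R where "R = Re (z * S x0 n)"
    have s0: "0 \<le> s" by (simp add: s_def)
    have "exp (- R) * (1 + s)^6 \<le> C1 + C2"
    proof (cases "s < B ^ k1")
      case True
      have "exp (- R) * (1 + s)^6 \<le> 1 * (1 + B ^ k1)^6"
        using ext[of n] True s0 by (intro mult_mono power_mono) (auto simp: R_def)
      then show ?thesis using C by (simp add: C1_def)
    next
      case False
      then have "1 \<le> s" using one_le_power[of B k1] B by linarith
      obtain m where m: "s < B ^ m" using real_arch_pow[OF B(1)] by blast
      \<comment> \<open>Locates s between two consecutive powers of B; the lower exponent is the
        level at which the growth condition is used.\<close>
      define m0 where "m0 = (LEAST m. s < B ^ m)"
      have m0: "s < B ^ m0" unfolding m0_def using m by (rule LeastI)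
      have "m0 \<noteq> 0" using m0 \<open>1 \<le> s\<close> by (intro notI) simp
      then obtain k where k: "m0 = Suc k" by (cases m0) auto
      have lo: "B ^ k \<le> s" using not_less_Least[of k "\<lambda>m. s < B ^ m"] k by (simp add: m0_def not_less)
      have "k1 \<le> k"
      proof (rule ccontr)
        assume "\<not> k1 \<le> k"
        then have "B ^ Suc k \<le> B ^ k1" using B by (intro power_increasing) auto
        then show False using False m0 k by simp
      qed
      define u where "u = b8 ^ (4 * k)"
      have u: "0 < u" "B ^ k = u^2" using b8(2) unfolding u_def pow by (auto simp flip: power_mult)
      have "u \<le> R"
        unfolding u_def R_def
      proof (rule growth[unfolded grows_from_def, rule_format, OF \<open>k1 \<le> k\<close>])
        show "b8 ^ (8 * k) \<le> norm (S x0 n)" using lo unfolding pow s_def .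
        have "s < B ^ k * B" using m0 by (simp add: k mult.commute)
        moreover have "B ^ k * B = b8 ^ (8 * k) * b8^8" unfolding pow[of k] using B(2) by simp
        ultimately show "norm (S x0 n) \<le> b8 ^ (8 * k) * b8^8" unfolding s_def by linarith
      qed
      then have "exp (- R) \<le> 12^12 / u^12"
        using exp_minus_le_power[OF u(1)] by (smt (verit) exp_less_mono)
      moreover have "(1 + s)^6 \<le> 64 * B^6 * u^12"
      proof -
        have "1 + s \<le> 2 * (B * u^2)" using \<open>1 \<le> s\<close> m0 k u(2) by simp
        then have "(1 + s)^6 \<le> (2 * (B * u^2))^6" using s0 by (intro power_mono) auto
        also have "\<dots> = 64 * B^6 * u^12" by (simp add: power_mult_distrib flip: power_mult)
        finally show ?thesis .
      qed
      ultimately have "exp (- R) * (1 + s)^6 \<le> 12^12 / u^12 * (64 * B^6 * u^12)"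
        using s0 u by (intro mult_mono) auto
      also have "\<dots> = C2" using u(1) by (simp add: C2_def)
      finally show ?thesis using C by simp
    qed
    then show "exp (- Re (z * S x0 n)) \<le> (C1 + C2) / (1 + norm (S x0 n))^6"
      unfolding R_def[symmetric] s_def[symmetric] using s0 by (simp add: field_simps)
  qed
qed

text \<open>On each piece of \<open>theta\<close> an integer vector occurs at most once, and its
  three coordinates are at most of order 1 + norm S. The sixth power thus yields an inverse square
  for each coordinate, summable over the lattice.\<close>

lemma extremal_summable:
  assumes x0: "x0 \<in> {0..<1}"
    and decay: "0 \<le> C" "\<And>n. exp (- Re (z * S x0 n)) \<le> C / (1 + norm (S x0 n))^6"
  shows "(\<lambda>n. exp (- Re (z * S x0 n))) summable_on UNIV"
proof -
  obtain K where K: "0 \<le> K"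
    "\<And>x n. x \<in> {0..<1} \<Longrightarrow> real_of_int (size3 (cocycle vec3 x n)) \<le> K * (1 + norm (S x n))"
    by (rule size3_bounded, rule that)
  define q where "q i = 1 / (1 + \<bar>real_of_int i\<bar>)^2" for i :: int
  have q: "q summable_on UNIV" "0 \<le> q i" for i
    unfolding q_def by (rule summable_inverse_square) simp
  define h where "h = (\<lambda>(i, v). q i * (case v of (j, k) \<Rightarrow> q j * q k))"
  have h: "h summable_on UNIV"
    unfolding h_def UNIV_Times_UNIV[symmetric] using q
    by (intro summable_on_times) (auto split: prod.splits)
  have le: "exp (- Re (z * S x0 n)) \<le> C * (1 + K)^6 * h (cocycle vec3 x0 n)" for n
  proof -
    define s where "s = 1 + norm (S x0 n)"
    have s: "1 \<le> s" by (simp add: s_def)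
    obtain i j k where v: "cocycle vec3 x0 n = (i, j, k)" by (cases "cocycle vec3 x0 n") auto
    have qq: "1 / s^2 \<le> (1 + K)^2 * q m" if "\<bar>real_of_int m\<bar> \<le> K * s" for m
    proof -
      have "1 + \<bar>real_of_int m\<bar> \<le> (1 + K) * s" using that s by (simp add: algebra_simps)
      then have "(1 + \<bar>real_of_int m\<bar>)^2 \<le> ((1 + K) * s)^2" by (intro power_mono) auto
      then have "(1 + \<bar>real_of_int m\<bar>)^2 \<le> (1 + K)^2 * s^2" by (simp only: power_mult_distrib)
      moreover have "0 < (1 + \<bar>real_of_int m\<bar>)^2" "0 < s^2" using s by (auto intro: zero_less_power)
      ultimately show ?thesis unfolding q_def by (simp add: divide_simps)
    qed
    have "1 / s^2 \<le> (1 + K)^2 * q i" "1 / s^2 \<le> (1 + K)^2 * q j" "1 / s^2 \<le> (1 + K)^2 * q k"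
      using K(2)[OF x0, of n] unfolding v s_def[symmetric] by (auto simp: size3_def intro!: qq)
    then have "1 / s^2 * (1 / s^2 * (1 / s^2)) \<le> (1 + K)^2 * q i * ((1 + K)^2 * q j * ((1 + K)^2 * q k))"
      using K(1) q(2) by (intro mult_mono) auto
    then have "1 / s^6 \<le> (1 + K)^6 * (q i * (q j * q k))"
      by (simp add: mult.commute mult.left_commute power_numeral_reduce flip: power_add)
    then have "C * (1 / s^6) \<le> C * ((1 + K)^6 * (q i * (q j * q k)))"
      using decay(1) by (rule mult_left_mono)
    then show ?thesis using decay(2)[of n] unfolding v h_def s_def by simp
  qed
  have piece: "(\<lambda>n. exp (- Re (z * S x0 n))) summable_on {n. theta_piece (orb x0 n) = c}" for c
  proof -
    let ?A = "{n. theta_piece (orb x0 n) = c}"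
    have "inj_on (cocycle vec3 x0) ?A" using cocycle_vec3_inj[OF x0] by (auto simp: inj_on_def)
    moreover have "h summable_on (cocycle vec3 x0 ` ?A)" using h by (rule summable_on_subset_banach) simp
    ultimately have "(h \<circ> cocycle vec3 x0) summable_on ?A" by (simp add: summable_on_reindex)
    then have "(\<lambda>n. C * (1 + K)^6 * (h \<circ> cocycle vec3 x0) n) summable_on ?A"
      by (rule summable_on_cmult_right)
    then show ?thesis by (rule summable_on_comparison_test) (use le in auto)
  qed
  have "UNIV = {n. theta_piece (orb x0 n) = 0} \<union> ({n. theta_piece (orb x0 n) = 1} \<union> {n. theta_piece (orb x0 n) = 2})"
    by (auto simp: theta_piece_def)
  then show ?thesis using summable_on_union[OF piece[of 0] summable_on_union[OF piece[of 1] piece[of 2]]] by simp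
qed

lemma wandering_exists:
  assumes z: "z \<noteq> 0" and \<kappa>: "0 < \<kappa>" "\<And>u. \<exists>e\<in>Z. \<kappa> * norm u \<le> \<bar>Re (e * u)\<bar>"
    and Z: "finite Z" "\<And>e. e \<in> Z \<Longrightarrow> eventually_gap gap_size e z"
  shows "\<exists>f. affine_iem f \<and> semiconjugate f arnoux_yoccoz \<and>
    has_slope_vector f (\<chi> a. exp (- Re (z * step a))) \<and> (\<exists>J. wandering_interval f J)"
proof -
  obtain x0 where x0: "x0 \<in> {0..<1}" "\<And>n. 0 \<le> Re (z * S x0 n)" by (rule extremal_exists[OF z], rule that)
  obtain k1 where "grows_from k1 z x0" using extremal_growth[OF x0 \<kappa> Z] by blast
  then obtain C where "0 \<le> C" "\<And>n. exp (- Re (z * S x0 n)) \<le> C / (1 + norm (S x0 n))^6"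
    using extremal_decay[OF x0(2)] by blast
  then have sum: "(\<lambda>n. exp (- Re (z * S x0 n))) summable_on UNIV"
    by (rule extremal_summable[OF x0(1)])
  define W where "W = infsum (\<lambda>n. exp (- Re (z * S x0 n))) UNIV"
  have "infsum (\<lambda>n. exp (- Re (z * S x0 n))) {0} \<le> W"
    unfolding W_def using sum by (intro infsum_mono_neutral) auto
  then have W: "0 < W" by simp
  interpret orbit_weights x0 "\<lambda>n. exp (- Re (z * S x0 n)) / W" "\<lambda>a. exp (- Re (z * step a))"
  proof
    show "(\<lambda>n. exp (- Re (z * S x0 n)) / W) summable_on UNIV"
      using summable_on_cmult_left[OF sum, of "1 / W"] by simp
    have "infsum (\<lambda>n. exp (- Re (z * S x0 n)) * (1 / W)) UNIV = W * (1 / W)"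
      unfolding W_def using sum by (intro infsum_cmult_left) auto
    then show "infsum (\<lambda>n. exp (- Re (z * S x0 n)) / W) UNIV = 1" using W by simp
    fix n
    have "S x0 (n + 1) = S x0 n + step (letter_of (orb x0 n))" by (simp add: S_add S_1)
    then have "- Re (z * S x0 (n + 1)) = - Re (z * step (letter_of (orb x0 n))) + - Re (z * S x0 n)"
      by (simp add: algebra_simps)
    then show "exp (- Re (z * S x0 (n + 1))) / W
        = exp (- Re (z * step (letter_of (orb x0 n)))) * (exp (- Re (z * S x0 n)) / W)"
      by (simp only: exp_add times_divide_eq_right)
  qed (use x0 W in auto)
  show ?thesis
    using affine_iem_lift semiconjugate_lift has_slope_vector_lift wandering_interval_lift by blast
qed

end

section \<open>Almost every eigenvector\<close>

theorem theoremC: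
  fixes \<beta> :: complex
  assumes "eigenvalue ay_matrix \<beta>"
    and "\<beta> \<notin> \<real>"
    and "norm \<beta> > 1"
    and "\<forall>n>0. (\<beta> / of_real (norm \<beta>)) ^ n \<noteq> 1"
  shows "AE \<gamma> in subspace_lborel (eigenspace ay_matrix \<beta>).
           eigenvector ay_matrix \<beta> \<gamma> \<longrightarrow>
           (\<exists>f. affine_iem f \<and> semiconjugate f arnoux_yoccoz \<and>
                has_slope_vector f (\<chi> a. exp (- Re (\<gamma> $ a))) \<and>
                (\<exists>J. wandering_interval f J))"
proof -
  obtain \<gamma>0 where \<gamma>0: "eigenvector ay_matrix \<beta> \<gamma>0" using assms(1) by (auto simp: eigenvalue_def)
  \<comment> \<open>If \<beta>^3 were real, its square would be norm \<beta> ^ 6 and \<beta> / norm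
    \<beta> a sixth root of unity.\<close>
  have nr3: "Im (\<beta>^3) \<noteq> 0"
  proof
    assume "Im (\<beta>^3) = 0"
    then have r: "\<beta>^3 = of_real (Re (\<beta>^3))" by (simp add: complex_eq_iff)
    have "(Re (\<beta>^3))^2 = (norm (\<beta>^3))^2" unfolding cmod_power2 using \<open>Im (\<beta>^3) = 0\<close> by simp
    then have "(\<beta>^3)^2 = of_real ((norm (\<beta>^3))^2)" by (subst r) (simp flip: of_real_power)
    then have "\<beta>^6 = of_real (norm \<beta>) ^ 6" by (simp add: norm_power flip: power_mult)
    moreover have "\<beta> \<noteq> 0" using assms(3) by auto
    ultimately have "(\<beta> / of_real (norm \<beta>)) ^ 6 = 1" by (simp add: power_divide)
    then show False using assms(4) by auto
  qed
  interpret expanding_eigenvalue \<beta>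
    using eigenvector_form(1)[OF \<gamma>0 assms(2,3)] nr3 assms(2)
    by unfold_locales (auto simp: complex_is_Real_iff)
  define E where "E = eigenspace ay_matrix \<beta>"
  define V where "V = (\<chi> a. step a)"
  have eig: "\<gamma> $ a = \<gamma> $ L8 * step a" if "eigenvector ay_matrix \<beta> \<gamma>" for \<gamma> a
    using eigenvector_form(2)[OF that assms(2,3), of a] by (simp add: step_def)
  have L8: "step L8 = 1" by (simp add: step_def eval3_def)
  have scale: "c *s v \<in> E" if "v \<in> E" for c v
    using that unfolding E_def eigenspace_def
    by (simp add: matrix_vector_mult_def vector_scalar_mult_def vec_eq_iff mult.left_commute[of _ c] flip: sum_distrib_left)
  have E_sub: "subspace E"
    unfolding E_def eigenspace_def subspace_def
    by (auto simp: matrix_vector_right_distrib vector_add_ldistrib matrix_vector_mult_def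
        vector_scalar_mult_def vec_eq_iff sum.distrib distrib_left simp flip: scaleR_sum_right)
  have V: "V \<in> E"
  proof -
    define r where "r = \<gamma>0 $ L8"
    have e: "\<gamma>0 $ a = r * step a" for a unfolding r_def by (rule eig[OF \<gamma>0])
    have "r \<noteq> 0" using \<gamma>0 e by (auto simp: eigenvector_def vec_eq_iff)
    then have "V = (1 / r) *s \<gamma>0" by (simp add: V_def vec_eq_iff e)
    moreover have "\<gamma>0 \<in> E" using \<gamma>0 by (simp add: E_def eigenspace_def eigenvector_def)
    ultimately show ?thesis using scale by metis
  qed
  define B where "B = (SOME B. B \<subseteq> E \<and> pairwise orthogonal B \<and> (\<forall>b\<in>B. norm b = 1) \<and> span B = E)"
  have "B \<subseteq> E \<and> pairwise orthogonal B \<and> (\<forall>b\<in>B. norm b = 1) \<and> span B = E"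
    unfolding B_def
    by (rule someI_ex) (use orthonormal_basis_subspace[OF E_sub] in metis)
  then have B: "B \<subseteq> E" "pairwise orthogonal B" "\<forall>b\<in>B. norm b = 1" "span B = E" by auto
  have "0 \<notin> B" using B(3) by force
  then have finB: "finite B" using pairwise_orthogonal_independent[OF B(2)] independent_imp_finite by blast
  \<comment> \<open>Moving an eigenvector along a basis vector moves its entry at \<open>L8\<close>,
    which plays the role of z, in the corresponding direction of Z.\<close>
  define Z where "Z = (\<lambda>b. b $ L8) ` B"
  have finZ: "finite Z" using finB by (simp add: Z_def)
  have coeff: "\<exists>c. v $ L8 = (\<Sum>b\<in>B. of_real (c b) * b $ L8)" if "v \<in> E" for v
  proof -
    have "v \<in> range (\<lambda>u. \<Sum>b\<in>B. u b *\<^sub>R b)" using that B(4) span_finite[OF finB] by simp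
    then obtain u where "v = (\<Sum>b\<in>B. u b *\<^sub>R b)" by blast
    then have "v $ L8 = (\<Sum>b\<in>B. of_real (u b) * b $ L8)" by (simp add: scaleR_conv_of_real[where 'a = complex])
    then show ?thesis by blast
  qed
  \<comment> \<open>Real combinations of Z that equal 1 and - \<i> recover Re u and Im u from the
    numbers Re (e * u), so these cannot all be small compared with u.\<close>
  obtain c where c: "1 = (\<Sum>b\<in>B. of_real (c b) * b $ L8)"
    using coeff[OF V] by (auto simp: V_def L8)
  obtain d where d: "- \<i> = (\<Sum>b\<in>B. of_real (d b) * b $ L8)"
    using coeff[OF scale[OF V, of "- \<i>"]] by (auto simp: V_def L8)
  \<comment> \<open>The extra 1 turns the estimate into norm u \<le> norm u - norm u / M, which
    leaves only u = 0.\<close>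
  define M where "M = 1 + (\<Sum>b\<in>B. \<bar>c b\<bar> + \<bar>d b\<bar>)"
  have M: "1 \<le> M" by (simp add: M_def sum_nonneg)
  have pos_M: "0 < 1 / M" using M by simp
  have \<kappa>: "\<exists>e\<in>Z. (1 / M) * norm u \<le> \<bar>Re (e * u)\<bar>" for u
  proof (rule ccontr)
    assume no: "\<not> ?thesis"
    then have lt: "\<bar>Re (b $ L8 * u)\<bar> \<le> norm u / M" if "b \<in> B" for b
      using that by (force simp: Z_def not_le)
    have comp: "\<bar>Re ((\<Sum>b\<in>B. of_real (g b) * b $ L8) * u)\<bar> \<le> (\<Sum>b\<in>B. \<bar>g b\<bar>) * (norm u / M)" for g
    proof -
      have "Re ((\<Sum>b\<in>B. of_real (g b) * b $ L8) * u) = (\<Sum>b\<in>B. g b * Re (b $ L8 * u))"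
      proof -
        have "(\<Sum>b\<in>B. of_real (g b) * b $ L8) * u = (\<Sum>b\<in>B. g b *\<^sub>R (b $ L8 * u))"
          by (simp add: sum_distrib_right scaleR_conv_of_real mult.assoc)
        then show ?thesis by (simp only: Re_sum scaleR_complex.sel)
      qed
      also have "\<bar>\<dots>\<bar> \<le> (\<Sum>b\<in>B. \<bar>g b\<bar> * \<bar>Re (b $ L8 * u)\<bar>)"
        using sum_abs[of "\<lambda>b. g b * Re (b $ L8 * u)" B] by (simp only: abs_mult)
      also have "\<dots> \<le> (\<Sum>b\<in>B. \<bar>g b\<bar> * (norm u / M))" using lt by (intro sum_mono mult_left_mono) auto
      finally show ?thesis by (simp only: sum_distrib_right)
    qed
    have "norm u \<le> \<bar>Re u\<bar> + \<bar>Im u\<bar>" by (rule cmod_le)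
    also have "\<dots> \<le> (\<Sum>b\<in>B. \<bar>c b\<bar>) * (norm u / M) + (\<Sum>b\<in>B. \<bar>d b\<bar>) * (norm u / M)"
      using comp[of c] comp[of d] unfolding c[symmetric] d[symmetric] by simp
    also have "\<dots> = (M - 1) * (norm u / M)"
    proof -
      have "M - 1 = (\<Sum>b\<in>B. \<bar>c b\<bar>) + (\<Sum>b\<in>B. \<bar>d b\<bar>)" by (simp add: M_def sum.distrib)
      then show ?thesis by (simp only: distrib_right)
    qed
    also have "\<dots> = norm u - norm u / M" using M by (simp add: field_simps)
    finally have "u = 0" using M by (simp add: divide_le_0_iff)
    moreover obtain b where "b \<in> B" using c by force
    ultimately show False using no by (force simp: Z_def)
  qed
  let ?g = "\<lambda>x. \<Sum>b\<in>B. x b *\<^sub>R b"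
  let ?M = "\<Pi>\<^sub>M b\<in>B. (lborel :: real measure)"
  define P where "P \<gamma> \<longleftrightarrow> (\<forall>e\<in>Z. eventually_gap gap_size e (\<gamma> $ L8))" for \<gamma> :: "complex ^ letter"
  have lebesgue: "subspace_lborel E = distr ?M (restrict_space borel E) ?g"
    unfolding subspace_lborel_def B_def Let_def ..
  have "AE x in ?M. \<forall>b\<in>B. eventually_gap gap_size (b $ L8) (\<Sum>c\<in>B. of_real (x c) * c $ L8)"
    using finB AE_PiM_gap[OF finB] by (intro AE_finite_allI) auto
  then have AE_P: "AE x in ?M. P (?g x)"
    by (simp add: P_def Z_def scaleR_conv_of_real[where 'a = complex])
  have g_meas: "?g \<in> measurable ?M (restrict_space borel E)"
  proof (rule measurable_restrict_space2)
    show "?g \<in> space ?M \<rightarrow> E"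
      unfolding B(4)[symmetric] by (intro Pi_I span_sum span_scale span_base)
    show "?g \<in> borel_measurable ?M" by measurable
  qed
  have P_meas: "{\<gamma> \<in> space (restrict_space borel E). P \<gamma>} \<in> sets (restrict_space borel E)"
  proof -
    have "(\<lambda>\<gamma>::complex ^ letter. \<gamma> $ L8) \<in> borel_measurable borel"
      by (intro borel_measurable_continuous_onI continuous_intros)
    from measurable_compose[OF this gap_measurable]
    have "Measurable.pred borel P"
      unfolding P_def[abs_def] by (intro pred_intros_finite finZ)
    then have "{\<gamma>. P \<gamma>} \<in> sets borel" by (simp add: pred_def)
    moreover have "{\<gamma> \<in> space (restrict_space borel E). P \<gamma>} = E \<inter> {\<gamma>. P \<gamma>}"
      by (auto simp: space_restrict_space)
    ultimately show ?thesis by (auto simp: sets_restrict_space)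
  qed
  have "AE \<gamma> in subspace_lborel E. P \<gamma>"
    unfolding lebesgue AE_distr_iff[OF g_meas P_meas] by (rule AE_P)
  then show ?thesis
    unfolding E_def[symmetric]
  proof eventually_elim
    case (elim \<gamma>)
    show ?case
    proof
      assume ev: "eigenvector ay_matrix \<beta> \<gamma>"
      have nz: "\<gamma> $ L8 \<noteq> 0"
      proof
        assume "\<gamma> $ L8 = 0"
        then have "\<gamma> $ a = 0" for a by (subst eig[OF ev]) simp
        then have "\<gamma> = 0" by (simp add: vec_eq_iff)
        then show False using ev by (simp add: eigenvector_def)
      qed
      have "eventually_gap gap_size e (\<gamma> $ L8)" if "e \<in> Z" for e using elim that by (simp add: P_def)
      with nz pos_M \<kappa> finZ have "\<exists>f. affine_iem f \<and> semiconjugate f arnoux_yoccoz \<and>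
          has_slope_vector f (\<chi> a. exp (- Re (\<gamma> $ L8 * step a))) \<and> (\<exists>J. wandering_interval f J)"
        by (rule wandering_exists)
      then show "\<exists>f. affine_iem f \<and> semiconjugate f arnoux_yoccoz \<and>
          has_slope_vector f (\<chi> a. exp (- Re (\<gamma> $ a))) \<and> (\<exists>J. wandering_interval f J)"
        unfolding eig[OF ev, symmetric] .
    qed
  qed
qed

end
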